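(* Let $\Omega$ be a partially rectangular billiard with rectangular part $R\subset\Omega$, and let $\partial R=\Gamma_1\cup\Gamma_2$ be the decomposition of $\partial R$ into its two pairs of parallel sides, where $\Gamma_2\subset\partial\Omega$. Let $\Delta$ be the Dirichlet or the Neumann Laplacian on $\Omega$. Then for any neighbourhood $V$ of $\Gamma_1$ in $\Omega$ there exists a constant $C>0$ such that, for every $\lambda$ and every $u$ (in the domain of $\Delta$), $$-\Delta u=\lambda u\ \Longrightarrow\ \int_V |u(x)|^2\,dx\ \ge\ \frac1C\int_R |u(x)|^2\,dx .$$
   Context: A partially rectangular billiard is a connected planar domain $\Omega$ with piecewise smooth boundary which contains a rectangle $R\subset\Omega$ such that, if the boundary of $R$ is decomposed into its two pairs of parallel segments, $\partial R=\Gamma_1\cup\Gamma_2$ (each $\Gamma_i$ being the union of two opposite closed sides), then $\Gamma_i\subset\partial\Omega$ for at least one $i$. A neighbourhood of $\Gamma_1$ in $\Omega$ means the intersection with $\Omega$ of a neighbourhood of $\Gamma_1$ in the plane. The constant $C$ depends on $\Omega$, $R$, $V$ and the boundary condition, but not on $u$ or $\lambda$. *)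

theory Defs
  imports "HOL-Analysis.Analysis"
begin

type_synonym plane = "real \<times> real"

primrec C_k :: "nat \<Rightarrow> ('a::euclidean_space \<Rightarrow> 'b::real_normed_vector) \<Rightarrow> bool" where
  "C_k 0 f \<longleftrightarrow> continuous_on UNIV f"
| "C_k (Suc k) f \<longleftrightarrow>
     (\<forall>x. f differentiable (at x)) \<and> (\<forall>v. C_k k (\<lambda>x. frechet_derivative f (at x) v))"

definition smooth :: "('a::euclidean_space \<Rightarrow> 'b::real_normed_vector) \<Rightarrow> bool" where
  "smooth f \<longleftrightarrow> (\<forall>k. C_k k f)"

(* Only \<gamma> on [0,1] matters geometrically; smoothness on the whole line is smoothness up to and
   including the endpoints, since a map smooth on [0,1] extends smoothly to the line. *)
definition smooth_arc :: "(real \<Rightarrow> plane) \<Rightarrow> bool" where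
  "smooth_arc \<gamma> \<longleftrightarrow> smooth \<gamma> \<and> arc \<gamma> \<and> (\<forall>t\<in>{0..1}. vector_derivative \<gamma> (at t) \<noteq> 0)"

(* The boundary is a locally finite union of smooth arcs which meet at most in common endpoints
   (for bounded \<Omega>, a finite union). *)
definition piecewise_smooth_boundary :: "plane set \<Rightarrow> bool" where
  "piecewise_smooth_boundary \<Omega> \<longleftrightarrow>
     (\<exists>A. (\<forall>\<gamma>\<in>A. smooth_arc \<gamma>) \<and>
          frontier \<Omega> = (\<Union>\<gamma>\<in>A. path_image \<gamma>) \<and>
          (\<forall>K. compact K \<longrightarrow> finite {\<gamma>\<in>A. path_image \<gamma> \<inter> K \<noteq> {}}) \<and>
          (\<forall>\<gamma>\<in>A. \<forall>\<eta>\<in>A. \<gamma> \<noteq> \<eta> \<longrightarrow>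
             path_image \<gamma> \<inter> path_image \<eta>
               \<subseteq> {pathstart \<gamma>, pathfinish \<gamma>} \<inter> {pathstart \<eta>, pathfinish \<eta>}))"

(* The open rectangle with corner p spanned by a and b. As it lies in the open set \<Omega> while two
   of its sides lie on the boundary of \<Omega>, it cannot be taken closed. *)
definition rectangle :: "plane \<Rightarrow> plane \<Rightarrow> plane \<Rightarrow> plane set" where
  "rectangle p a b = {p + s *\<^sub>R a + t *\<^sub>R b | s t. 0 < s \<and> s < 1 \<and> 0 < t \<and> t < 1}"

(* The two closed sides parallel to a; those parallel to b are parallel_sides p b a. *)
definition parallel_sides :: "plane \<Rightarrow> plane \<Rightarrow> plane \<Rightarrow> plane set" where
  "parallel_sides p a b = closed_segment p (p + a) \<union> closed_segment (p + b) (p + b + a)"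

definition partially_rectangular_billiard ::
    "plane set \<Rightarrow> plane \<Rightarrow> plane \<Rightarrow> plane \<Rightarrow> bool" where
  "partially_rectangular_billiard \<Omega> p a b \<longleftrightarrow>
     open \<Omega> \<and> connected \<Omega> \<and> piecewise_smooth_boundary \<Omega> \<and>
     a \<noteq> 0 \<and> b \<noteq> 0 \<and> a \<bullet> b = 0 \<and>
     rectangle p a b \<subseteq> \<Omega> \<and>
     (parallel_sides p a b \<subseteq> frontier \<Omega> \<or> parallel_sides p b a \<subseteq> frontier \<Omega>)"

definition L2 :: "plane set \<Rightarrow> (plane \<Rightarrow> complex) \<Rightarrow> bool" where
  "L2 \<Omega> u \<longleftrightarrow>
     u \<in> borel_measurable (lebesgue_on \<Omega>) \<and> integrable (lebesgue_on \<Omega>) (\<lambda>x. (cmod (u x))\<^sup>2)"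

definition test_function :: "plane set \<Rightarrow> (plane \<Rightarrow> complex) \<Rightarrow> bool" where
  "test_function \<Omega> \<phi> \<longleftrightarrow>
     smooth \<phi> \<and> compact (closure {x. \<phi> x \<noteq> 0}) \<and> closure {x. \<phi> x \<noteq> 0} \<subseteq> \<Omega>"

definition weak_partial :: "plane set \<Rightarrow> plane \<Rightarrow> (plane \<Rightarrow> complex) \<Rightarrow> (plane \<Rightarrow> complex) \<Rightarrow> bool" where
  "weak_partial \<Omega> e u g \<longleftrightarrow>
     (\<forall>\<phi>. test_function \<Omega> \<phi> \<longrightarrow>
        (LINT x|lebesgue_on \<Omega>. u x * frechet_derivative \<phi> (at x) e)
          = - (LINT x|lebesgue_on \<Omega>. g x * \<phi> x))"

(* u is in the Sobolev space H^1(\<Omega>) and G e, for e in Basis, are its weak partial derivatives.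
   The values G e for e outside Basis are irrelevant. *)
definition H1 :: "plane set \<Rightarrow> (plane \<Rightarrow> complex) \<Rightarrow> (plane \<Rightarrow> plane \<Rightarrow> complex) \<Rightarrow> bool" where
  "H1 \<Omega> u G \<longleftrightarrow> L2 \<Omega> u \<and> (\<forall>e\<in>Basis. L2 \<Omega> (G e) \<and> weak_partial \<Omega> e u (G e))"

(* The same for H^1_0(\<Omega>), the closure of the test functions in H^1(\<Omega>). *)
definition H10 :: "plane set \<Rightarrow> (plane \<Rightarrow> complex) \<Rightarrow> (plane \<Rightarrow> plane \<Rightarrow> complex) \<Rightarrow> bool" where
  "H10 \<Omega> u G \<longleftrightarrow> H1 \<Omega> u G \<and>
     (\<exists>\<phi>. (\<forall>n::nat. test_function \<Omega> (\<phi> n)) \<and>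
          (\<lambda>n. LINT x|lebesgue_on \<Omega>. (cmod (u x - \<phi> n x))\<^sup>2) \<longlonglongrightarrow> 0 \<and>
          (\<forall>e\<in>Basis.
             (\<lambda>n. LINT x|lebesgue_on \<Omega>. (cmod (G e x - frechet_derivative (\<phi> n) (at x) e))\<^sup>2)
               \<longlonglongrightarrow> 0))"

datatype boundary_condition = Dirichlet | Neumann

fun form_domain ::
    "boundary_condition \<Rightarrow> plane set \<Rightarrow> (plane \<Rightarrow> complex) \<Rightarrow> (plane \<Rightarrow> plane \<Rightarrow> complex) \<Rightarrow> bool" where
  "form_domain Dirichlet \<Omega> u G \<longleftrightarrow> H10 \<Omega> u G"
| "form_domain Neumann \<Omega> u G \<longleftrightarrow> H1 \<Omega> u G"

(* The graph of the self-adjoint operator -\<Delta> on L^2(\<Omega>) associated with the closed form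
   (u, v) |-> \<integral> \<nabla>u \<cdot> cnj \<nabla>v on H^1_0 (Dirichlet) or H^1 (Neumann):
   u is in the domain of \<Delta> and -\<Delta>u = f. Taking all of H^1 as the form domain encodes the vanishing
   of the normal derivative in the Neumann case. *)
definition neg_laplacian ::
    "boundary_condition \<Rightarrow> plane set \<Rightarrow> (plane \<Rightarrow> complex) \<Rightarrow> (plane \<Rightarrow> complex) \<Rightarrow> bool" where
  "neg_laplacian bc \<Omega> u f \<longleftrightarrow> L2 \<Omega> f \<and>
     (\<exists>G. form_domain bc \<Omega> u G \<and>
          (\<forall>v H. form_domain bc \<Omega> v H \<longrightarrow>
             (\<Sum>e\<in>Basis. LINT x|lebesgue_on \<Omega>. G e x * cnj (H e x))
               = (LINT x|lebesgue_on \<Omega>. f x * cnj (v x))))"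

end

theory Submission
  imports Defs "HOL-Computational_Algebra.Polynomial"
begin

text \<open>
  In coordinates \<open>(s, t)\<close> on the rectangle, with \<open>s\<close> running from one component of \<open>\<Gamma>\<^sub>1\<close> to the
  other, an eigenfunction satisfies \<open>u\<^sub>s\<^sub>s = (A - \<lambda>) u\<close> where \<open>A = - \<partial>\<^sub>t\<^sup>2\<close> is symmetric with the
  boundary conditions on \<open>\<Gamma>\<^sub>2\<close> and \<open>\<lambda>\<close> is real. Hence \<open>P(s, s') = \<integral> u(s, t) cnj (u(s', t)) dt\<close> solves
  the wave equation in \<open>(s, s')\<close>, so that \<open>P(y, y) - P(x, x) = P(y - h, y + h) - P(x - h, x + h)\<close>.
  Choosing \<open>x\<close> near \<open>\<Gamma>\<^sub>1\<close> and estimating \<open>P\<close> off the diagonal by Cauchy-Schwarz bounds \<open>P(y, y)\<close> by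
  the values near \<open>\<Gamma>\<^sub>1\<close> plus the geometric mean of \<open>P(y - h, y - h)\<close> and \<open>P(y + h, y + h)\<close>. Finitely
  many such steps, whose number does not depend on \<open>\<lambda>\<close>, cross the rectangle. Since \<open>u\<close> is only a weak
  solution, \<open>P\<close> is averaged along the diagonal against a smooth weight, and its constancy is obtained by
  testing with cut off translates of \<open>u\<close>.
\<close>

section \<open>Smooth functions\<close>

text \<open>The delicate point is that the cut off translates of \<open>u\<close> must lie in the
  form domain. Translation along \<open>a\<close> slides the sides in
  \<open>\<Gamma>\<^sub>2\<close> along themselves and so respects either boundary condition there;
  a cutoff in the coordinate along \<open>a\<close> keeps the support away from
  \<open>\<Gamma>\<^sub>1\<close>; and restricting sharply to the rectangle makes no jump inside
  \<Omega>, because \<open>\<Gamma>\<^sub>2\<close> lies on the boundary. Testing with two mutually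
  adjoint cutoff translations cancels the gradient and the eigenvalue terms, so that no constant can
  depend on the eigenvalue. What remains carries only the derivative of the cutoff. Choosing this
  derivative as a difference of two equal bumps gives a compactly supported cutoff and compares two
  positions in the rectangle. The geometric mean closes the argument: its two factors can be
  weighted unequally, the neighbour on the known side by a large factor and the other one by a small
  factor, so that the largest mass is finally absorbed. The spacing \<open>h\<close> depends only on
  the width of the neighbourhood of \<open>\<Gamma>\<^sub>1\<close>.\<close>

lemma C_k_SucI:
  assumes "\<And>x. (f has_derivative f' x) (at x)" "\<And>v. C_k k (\<lambda>x. f' x v)"
  shows "C_k (Suc k) f"
proof -
  have "frechet_derivative f (at x) = f' x" for x
    using frechet_derivative_at[OF assms(1)] by metis
  with assms show ?thesis
    by (auto simp: differentiable_def)
qed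

lemma C_k_Suc_has_derivative:
  "C_k (Suc k) f \<Longrightarrow> (f has_derivative frechet_derivative f (at x)) (at x)"
  using frechet_derivative_works by fastforce

lemma C_k_Suc_imp_C_k: "C_k (Suc k) f \<Longrightarrow> C_k k f"
proof (induction k arbitrary: f)
  case 0
  then show ?case
    by (auto simp: continuous_on_eq_continuous_at differentiable_imp_continuous_within)
next
  case (Suc k)
  then show ?case by (metis C_k.simps(2))
qed

lemma C_k_const: "C_k k (\<lambda>x. c)"
proof (induction k arbitrary: c)
  case 0
  show ?case by simp
next
  case (Suc k)
  show ?case
    by (rule C_k_SucI[where f' = "\<lambda>x v. 0"]) (auto intro: Suc)
qed

lemma C_k_add: "C_k k f \<Longrightarrow> C_k k g \<Longrightarrow> C_k k (\<lambda>x. f x + g x)"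
proof (induction k arbitrary: f g)
  case 0
  then show ?case by (auto intro: continuous_intros)
next
  case (Suc k)
  show ?case
    by (rule C_k_SucI[OF has_derivative_add[OF C_k_Suc_has_derivative C_k_Suc_has_derivative]])
      (use Suc in auto)
qed

lemma C_k_bounded_linear:
  "bounded_linear T \<Longrightarrow> C_k k f \<Longrightarrow> C_k k (\<lambda>x. T (f x))"
proof (induction k arbitrary: f)
  case 0
  then show ?case
    by (auto intro: bounded_linear.continuous_on)
next
  case (Suc k)
  show ?case
    by (rule C_k_SucI[OF bounded_linear.has_derivative[OF _ C_k_Suc_has_derivative]])
      (use Suc in auto)
qed

text \<open>The product rule pairs each function with a directional derivative of the other. The
  factor that is not differentiated is demoted from order \<open>Suc k\<close> to order
  \<open>k\<close> before the induction hypothesis applies.\<close>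

lemma (in bounded_bilinear) C_k_prod:
  "C_k k f \<Longrightarrow> C_k k g \<Longrightarrow> C_k k (\<lambda>x. prod (f x) (g x))"
proof (induction k arbitrary: f g)
  case 0
  then show ?case by (auto intro: continuous_on)
next
  case (Suc k)
  show ?case
  proof (rule C_k_SucI[OF FDERIV[OF C_k_Suc_has_derivative C_k_Suc_has_derivative]])
    show "C_k k (\<lambda>x. prod (f x) (frechet_derivative g (at x) v)
            + prod (frechet_derivative f (at x) v) (g x))" for v
      using Suc.prems Suc.prems[THEN C_k_Suc_imp_C_k] by (intro C_k_add Suc.IH) simp_all
  qed (use Suc in auto)
qed

lemma C_k_compose_affine:
  "bounded_linear A \<Longrightarrow> C_k k f \<Longrightarrow> C_k k (\<lambda>x. f (A x + c))"
proof (induction k arbitrary: f)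
  case 0
  have "continuous_on UNIV (\<lambda>x. A x + c)"
    using bounded_linear.continuous_on[OF 0(1) continuous_on_id] by (intro continuous_intros)
  then show ?case
    using 0(2) continuous_on_compose2[of UNIV f UNIV "\<lambda>x. A x + c"] by simp
next
  case (Suc k)
  show ?case
  proof (rule C_k_SucI)
    show "((\<lambda>x. f (A x + c)) has_derivative
        (\<lambda>v. frechet_derivative f (at (A x + c)) (A v))) (at x)" for x
      using has_derivative_compose[OF
          has_derivative_add[OF bounded_linear.has_derivative[OF Suc.prems(1) has_derivative_ident]
            has_derivative_const] C_k_Suc_has_derivative[OF Suc.prems(2)]]
      by simp
    show "C_k k (\<lambda>x. frechet_derivative f (at (A x + c)) (A v))" for v
      using Suc.IH[of "\<lambda>x. frechet_derivative f (at x) (A v)"] Suc.prems by simp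
  qed
qed

text \<open>Equality on an open set passes to the derivatives, so the induction goes through. The
  lemma serves functions that are cut off sharply at the rectangle and have a smooth formula only
  locally.\<close>

lemma C_k_local:
  assumes "\<And>x. \<exists>g S. open S \<and> x \<in> S \<and> C_k k g \<and> (\<forall>y\<in>S. f y = g y)"
  shows "C_k k f"
  using assms
proof (induction k arbitrary: f)
  case 0
  have "isCont f x" for x
  proof -
    obtain g S where "open S" "x \<in> S" "continuous_on UNIV g" "\<forall>y\<in>S. f y = g y"
      using 0[of x] by auto
    then show ?thesis
      by (metis continuous_on_eq continuous_on_eq_continuous_at continuous_on_subset top_greatest)
  qed
  then show ?case
    by (simp add: continuous_at_imp_continuous_on)
next
  case (Suc k)
  have *: "(f has_derivative frechet_derivative g (at y)) (at y)"
    if "open S" "C_k (Suc k) g" "\<forall>y\<in>S. f y = g y" "y \<in> S" for g S y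
    using has_derivative_transform_within_open[OF C_k_Suc_has_derivative[OF that(2)] that(1,4)]
      that(3) by metis
  have "f differentiable at x" for x
    using Suc.prems[of x] * unfolding differentiable_def by meson
  moreover have "C_k k (\<lambda>x. frechet_derivative f (at x) v)" for v
  proof (rule Suc.IH)
    fix x
    obtain g S where gS: "open S" "x \<in> S" "C_k (Suc k) g" "\<forall>y\<in>S. f y = g y"
      using Suc.prems[of x] by auto
    have "\<forall>y\<in>S. frechet_derivative f (at y) v = frechet_derivative g (at y) v"
      using *[OF gS(1,3,4)] frechet_derivative_at by metis
    then show "\<exists>g S. open S \<and> x \<in> S \<and> C_k k g \<and> (\<forall>y\<in>S. frechet_derivative f (at y) v = g y)"
      using gS by (auto intro!: exI[of _ "\<lambda>x. frechet_derivative g (at x) v"])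
  qed
  ultimately show ?case by simp
qed

lemma smooth_const: "smooth (\<lambda>x. c)"
  by (simp add: smooth_def C_k_const)

lemma smooth_add: "smooth f \<Longrightarrow> smooth g \<Longrightarrow> smooth (\<lambda>x. f x + g x)"
  by (simp add: smooth_def C_k_add)

lemma smooth_bounded_linear: "bounded_linear T \<Longrightarrow> smooth f \<Longrightarrow> smooth (\<lambda>x. T (f x))"
  by (simp add: smooth_def C_k_bounded_linear)

lemma smooth_scaleR:
  fixes f :: "'a::euclidean_space \<Rightarrow> real"
  shows "smooth f \<Longrightarrow> smooth g \<Longrightarrow> smooth (\<lambda>x. f x *\<^sub>R g x)"
  by (simp add: smooth_def bounded_bilinear.C_k_prod[OF bounded_bilinear_scaleR])

lemma smooth_mult:
  fixes f g :: "'a::euclidean_space \<Rightarrow> 'b::real_normed_algebra"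
  shows "smooth f \<Longrightarrow> smooth g \<Longrightarrow> smooth (\<lambda>x. f x * g x)"
  by (simp add: smooth_def bounded_bilinear.C_k_prod[OF bounded_bilinear_mult])

lemma smooth_compose_affine: "bounded_linear A \<Longrightarrow> smooth f \<Longrightarrow> smooth (\<lambda>x. f (A x + c))"
  by (simp add: smooth_def C_k_compose_affine)

lemma smooth_local:
  assumes "\<And>x. \<exists>g S. open S \<and> x \<in> S \<and> smooth g \<and> (\<forall>y\<in>S. f y = g y)"
  shows "smooth f"
  unfolding smooth_def
proof
  show "C_k k f" for k
    by (rule C_k_local) (use assms smooth_def in meson)
qed

lemma smooth_has_derivative:
  "smooth f \<Longrightarrow> (f has_derivative frechet_derivative f (at x)) (at x)"
  unfolding smooth_def by (metis C_k_Suc_has_derivative)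

lemma smooth_frechet_derivative:
  "smooth f \<Longrightarrow> smooth (\<lambda>x. frechet_derivative f (at x) v)"
  unfolding smooth_def by (metis C_k.simps(2))

lemma smooth_continuous: "smooth f \<Longrightarrow> continuous_on UNIV f"
  unfolding smooth_def by (metis C_k.simps(1))

text \<open>Makes a cutoff smooth when only its derivative is known explicitly.\<close>

lemma smooth_antiderivative:
  fixes f :: "real \<Rightarrow> 'b::real_normed_vector"
  assumes "\<And>x. (f has_vector_derivative f' x) (at x)" "smooth f'"
  shows "smooth f"
  unfolding smooth_def
proof
  fix k
  have "C_k (Suc k) f" for k
    using assms(2)
    by (intro C_k_SucI[OF assms(1)[unfolded has_vector_derivative_def]]
        C_k_bounded_linear[OF bounded_linear_scaleR_right]) (simp add: smooth_def)
  then show "C_k k f" by (rule C_k_Suc_imp_C_k)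
qed

section \<open>The flat function exp (- 1 / x)\<close>

definition poly_exp_inverse :: "real poly \<Rightarrow> real \<Rightarrow> real" where
  "poly_exp_inverse P x = (if x > 0 then poly P (1 / x) * exp (- (1 / x)) else 0)"

lemma tendsto_poly_exp_minus: "((\<lambda>y::real. poly P y * exp (- y)) \<longlongrightarrow> 0) at_top"
proof -
  have "((\<lambda>y::real. \<Sum>i\<le>degree P. coeff P i * (y ^ i / exp y)) \<longlongrightarrow> (\<Sum>i\<le>degree P. coeff P i * 0)) at_top"
    by (intro tendsto_intros tendsto_power_div_exp_0)
  then show ?thesis
    by (simp add: poly_altdef exp_minus sum_distrib_right divide_inverse mult.assoc)
qed

text \<open>The family is closed under differentiation: for positive x, differentiating replaces
  \<open>P\<close> by \<open>[:0, 0, 1:] * (P - pderiv P)\<close>, the square of the variable coming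
  from the inner derivative of 1 / x. Carrying a general polynomial therefore yields all orders by
  iteration.\<close>

lemma poly_exp_inverse_has_derivative:
  "(poly_exp_inverse P has_real_derivative poly_exp_inverse ([:0, 0, 1:] * (P - pderiv P)) x) (at x)"
proof -
  consider "x < 0" | "x > 0" | "x = 0" by linarith
  then show ?thesis
  proof cases
    case 1
    have "((\<lambda>x. 0) has_real_derivative 0) (at x)" by simp
    then show ?thesis
      by (rule has_field_derivative_transform_within_open[of _ _ _ "{..<0}", THEN DERIV_cong])
        (use 1 in \<open>auto simp: poly_exp_inverse_def\<close>)
  next
    case 2
    have "((\<lambda>x. poly P (1 / x) * exp (- (1 / x))) has_real_derivative
        poly_exp_inverse ([:0, 0, 1:] * (P - pderiv P)) x) (at x)"
      using 2 by (auto intro!: derivative_eq_intros poly_DERIV[THEN DERIV_chain2]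
          simp: poly_exp_inverse_def field_simps power2_eq_square)
    then show ?thesis
      by (rule has_field_derivative_transform_within_open[of _ _ _ "{0<..}"])
        (use 2 in \<open>auto simp: poly_exp_inverse_def\<close>)
  next
    case 3
    \<comment> \<open>Dividing by \<open>h\<close> multiplies by one more power of
      \<open>1 / h\<close>, so the right difference quotient at 0 belongs to the polynomial
      \<open>[:0, 1:] * P\<close>.\<close>
    have "((\<lambda>h. poly ([:0, 1:] * P) (inverse h) * exp (- inverse h)) \<longlongrightarrow> 0) (at_right 0)"
      by (rule filterlim_compose[OF tendsto_poly_exp_minus filterlim_inverse_at_top_right])
    then have "((\<lambda>h. poly_exp_inverse P h / h) \<longlongrightarrow> 0) (at_right 0)"
      by (rule Lim_transform_eventually)
        (auto simp: poly_exp_inverse_def eventually_at_filter divide_simps)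
    moreover have "((\<lambda>h. poly_exp_inverse P h / h) \<longlongrightarrow> 0) (at_left 0)"
      by (rule Lim_transform_eventually[OF tendsto_const])
        (auto simp: poly_exp_inverse_def eventually_at_filter)
    ultimately have "((\<lambda>h. poly_exp_inverse P h / h) \<longlongrightarrow> 0) (at 0)"
      by (simp add: filterlim_split_at)
    then show ?thesis
      using 3 by (simp add: DERIV_def poly_exp_inverse_def)
  qed
qed

lemma smooth_poly_exp_inverse: "smooth (poly_exp_inverse P)"
  unfolding smooth_def
proof
  show "C_k k (poly_exp_inverse P)" for k
  proof (induction k arbitrary: P)
    case 0
    show ?case
      using poly_exp_inverse_has_derivative[THEN DERIV_isCont]
      by (simp add: continuous_at_imp_continuous_on)
  next
    case (Suc k)
    show ?case
      by (rule C_k_SucI[OF poly_exp_inverse_has_derivative[THEN has_field_derivative_imp_has_derivative]])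
        (rule bounded_bilinear.C_k_prod[OF bounded_bilinear_mult Suc C_k_const])
  qed
qed

text \<open>There is no plateau: the values only tend to 1 at infinity. Indicators are obtained as
  limits under rescaling of the argument, and lower bounds hold only at a distance from 0.\<close>

definition cutoff :: "real \<Rightarrow> real" where "cutoff = poly_exp_inverse 1"

lemma cutoff_eq: "cutoff x = (if x > 0 then exp (- (1 / x)) else 0)"
  by (simp add: cutoff_def poly_exp_inverse_def)

lemma smooth_cutoff: "smooth cutoff"
  by (simp add: cutoff_def smooth_poly_exp_inverse)

lemma cutoff_nonneg: "0 \<le> cutoff x" and cutoff_le_1: "cutoff x \<le> 1"
  by (auto simp: cutoff_eq)

section \<open>Square integrable functions\<close>

text \<open>An arbitrary measure is allowed so that functions on \<Omega> and their zero extensions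
  to the plane, which can be translated, share one calculus.\<close>

definition square_integrable :: "'a measure \<Rightarrow> ('a \<Rightarrow> complex) \<Rightarrow> bool" where
  "square_integrable M f \<longleftrightarrow> f \<in> borel_measurable M \<and> integrable M (\<lambda>x. (cmod (f x))\<^sup>2)"

lemma L2_eq_square_integrable: "L2 \<Omega> = square_integrable (lebesgue_on \<Omega>)"
  by (simp add: fun_eq_iff L2_def square_integrable_def)

lemma square_integrable_measurable [measurable_dest]:
  "square_integrable M f \<Longrightarrow> f \<in> borel_measurable M"
  by (simp add: square_integrable_def)

lemma norm_add_power2_le: "(norm (x + y))\<^sup>2 \<le> 2 * (norm x)\<^sup>2 + 2 * (norm y)\<^sup>2"
proof -
  have "(norm (x + y))\<^sup>2 \<le> (norm x + norm y)\<^sup>2"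
    by (simp add: norm_triangle_ineq power_mono)
  also have "\<dots> \<le> 2 * (norm x)\<^sup>2 + 2 * (norm y)\<^sup>2"
    using sum_squares_bound[of "norm x" "norm y"] by (simp add: power2_sum)
  finally show ?thesis .
qed

lemma square_integrable_mult_bounded:
  assumes "square_integrable M f" and [measurable]: "m \<in> borel_measurable M"
    and "\<And>x. x \<in> space M \<Longrightarrow> cmod (m x) \<le> B"
  shows "square_integrable M (\<lambda>x. m x * f x)"
  unfolding square_integrable_def
proof
  have [measurable]: "f \<in> borel_measurable M" using assms(1) by (simp add: square_integrable_def)
  show "(\<lambda>x. m x * f x) \<in> borel_measurable M" by simp
  show "integrable M (\<lambda>x. (cmod (m x * f x))\<^sup>2)"
  proof (rule Bochner_Integration.integrable_bound)
    show "integrable M (\<lambda>x. B\<^sup>2 * (cmod (f x))\<^sup>2)"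
      using assms(1) by (simp add: square_integrable_def)
    show "AE x in M. norm ((cmod (m x * f x))\<^sup>2) \<le> norm (B\<^sup>2 * (cmod (f x))\<^sup>2)"
      using assms(3) by (auto simp: norm_mult power_mult_distrib intro!: mult_right_mono power_mono)
  qed simp
qed

lemma square_integrable_cmult: "square_integrable M f \<Longrightarrow> square_integrable M (\<lambda>x. c * f x)"
  by (rule square_integrable_mult_bounded[where B = "cmod c"]) auto

lemma square_integrable_cnj: "square_integrable M f \<Longrightarrow> square_integrable M (\<lambda>x. cnj (f x))"
  by (auto simp: square_integrable_def intro: measurable_compose[OF _ borel_measurable_continuous_onI]
      continuous_intros)

lemma square_integrable_add:
  assumes "square_integrable M f" "square_integrable M g"
  shows "square_integrable M (\<lambda>x. f x + g x)"
  unfolding square_integrable_def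
proof
  have [measurable]: "f \<in> borel_measurable M" "g \<in> borel_measurable M"
    using assms by (simp_all add: square_integrable_def)
  show "(\<lambda>x. f x + g x) \<in> borel_measurable M" by simp
  show "integrable M (\<lambda>x. (cmod (f x + g x))\<^sup>2)"
  proof (rule Bochner_Integration.integrable_bound)
    show "integrable M (\<lambda>x. 2 * (cmod (f x))\<^sup>2 + 2 * (cmod (g x))\<^sup>2)"
      using assms by (simp add: square_integrable_def)
    show "AE x in M. norm ((cmod (f x + g x))\<^sup>2) \<le> norm (2 * (cmod (f x))\<^sup>2 + 2 * (cmod (g x))\<^sup>2)"
      using norm_add_power2_le by (auto intro!: AE_I2)
  qed simp
qed

lemma square_integrable_uminus: "square_integrable M f \<Longrightarrow> square_integrable M (\<lambda>x. - f x)"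
  by (auto simp: square_integrable_def)

lemma square_integrable_diff:
  "square_integrable M f \<Longrightarrow> square_integrable M g \<Longrightarrow> square_integrable M (\<lambda>x. f x - g x)"
  using square_integrable_add[OF _ square_integrable_uminus] by fastforce

lemma square_integrable_sum:
  "(\<And>i. i \<in> I \<Longrightarrow> square_integrable M (f i)) \<Longrightarrow> square_integrable M (\<lambda>x. \<Sum>i\<in>I. f i x)"
proof (induction I rule: infinite_finite_induct)
  case (insert i I)
  then show ?case using square_integrable_add by fastforce
qed (auto simp: square_integrable_def)

lemma integral_add_power2_le:
  assumes "square_integrable M f" "square_integrable M g"
  shows "(LINT x|M. (cmod (f x + g x))\<^sup>2)
    \<le> 2 * (LINT x|M. (cmod (f x))\<^sup>2) + 2 * (LINT x|M. (cmod (g x))\<^sup>2)"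
proof -
  have "(LINT x|M. (cmod (f x + g x))\<^sup>2) \<le> (LINT x|M. 2 * (cmod (f x))\<^sup>2 + 2 * (cmod (g x))\<^sup>2)"
    using assms square_integrable_add[OF assms] norm_add_power2_le
    by (intro integral_mono) (auto simp: square_integrable_def)
  also have "\<dots> = 2 * (LINT x|M. (cmod (f x))\<^sup>2) + 2 * (LINT x|M. (cmod (g x))\<^sup>2)"
    using assms by (simp add: square_integrable_def)
  finally show ?thesis .
qed

lemma integral_mult_bounded_power2_le:
  assumes "square_integrable M f" and [measurable]: "m \<in> borel_measurable M"
    and "\<And>x. x \<in> space M \<Longrightarrow> cmod (m x) \<le> B"
  shows "(LINT x|M. (cmod (m x * f x))\<^sup>2) \<le> B\<^sup>2 * (LINT x|M. (cmod (f x))\<^sup>2)"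
proof -
  have "(LINT x|M. (cmod (m x * f x))\<^sup>2) \<le> (LINT x|M. B\<^sup>2 * (cmod (f x))\<^sup>2)"
    using assms(1,3) square_integrable_mult_bounded[OF assms]
    by (intro integral_mono)
      (auto simp: square_integrable_def norm_mult power_mult_distrib intro!: mult_right_mono power_mono)
  then show ?thesis by simp
qed

lemma integrable_mult_square_integrable:
  assumes "square_integrable M f" "square_integrable M g"
  shows "integrable M (\<lambda>x. f x * g x)"
proof (rule Bochner_Integration.integrable_bound)
  show "integrable M (\<lambda>x. (cmod (f x))\<^sup>2 + (cmod (g x))\<^sup>2)"
    using assms by (simp add: square_integrable_def)
  show "(\<lambda>x. f x * g x) \<in> borel_measurable M"
    using assms by (auto simp: square_integrable_def intro: borel_measurable_times)
  have "cmod z * cmod w \<le> (cmod z)\<^sup>2 + (cmod w)\<^sup>2" for z w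
  proof -
    have "0 \<le> cmod z * cmod w" by simp
    then show ?thesis using sum_squares_bound[of "cmod z" "cmod w"] by linarith
  qed
  then show "AE x in M. norm (f x * g x) \<le> norm ((cmod (f x))\<^sup>2 + (cmod (g x))\<^sup>2)"
    by (auto simp: norm_mult intro!: AE_I2)
qed

text \<open>Cauchy-Schwarz in bilinear form; conjugates are put into \<open>g\<close> by the caller.
  It comes from the inequality for nonnegative integrals of the moduli, whose finiteness is square
  integrability.\<close>

lemma norm_integral_mult_le:
  assumes "square_integrable M f" "square_integrable M g"
  shows "cmod (LINT x|M. f x * g x)
    \<le> sqrt (LINT x|M. (cmod (f x))\<^sup>2) * sqrt (LINT x|M. (cmod (g x))\<^sup>2)"
proof -
  have [measurable]: "f \<in> borel_measurable M" "g \<in> borel_measurable M"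
    and int: "integrable M (\<lambda>x. (cmod (f x))\<^sup>2)" "integrable M (\<lambda>x. (cmod (g x))\<^sup>2)"
    using assms by (simp_all add: square_integrable_def)
  have intfg: "integrable M (\<lambda>x. cmod (f x) * cmod (g x))"
    using integrable_norm[OF integrable_mult_square_integrable[OF assms]] by (simp add: norm_mult)
  have "ennreal ((LINT x|M. cmod (f x) * cmod (g x))\<^sup>2)
      = (\<integral>\<^sup>+x. ennreal (cmod (f x)) * ennreal (cmod (g x)) \<partial>M)\<^sup>2"
    by (simp add: nn_integral_eq_integral[OF intfg] ennreal_power flip: ennreal_mult)
  also have "\<dots> \<le> (\<integral>\<^sup>+x. (ennreal (cmod (f x)))\<^sup>2 \<partial>M) * (\<integral>\<^sup>+x. (ennreal (cmod (g x)))\<^sup>2 \<partial>M)"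
    by (rule Cauchy_Schwarz_nn_integral) simp_all
  also have "\<dots> = ennreal ((LINT x|M. (cmod (f x))\<^sup>2) * (LINT x|M. (cmod (g x))\<^sup>2))"
    by (simp add: ennreal_power nn_integral_eq_integral int ennreal_mult)
  finally have "(LINT x|M. cmod (f x) * cmod (g x))\<^sup>2
      \<le> (LINT x|M. (cmod (f x))\<^sup>2) * (LINT x|M. (cmod (g x))\<^sup>2)"
    by (simp add: ennreal_le_iff)
  then have "(LINT x|M. cmod (f x) * cmod (g x))
      \<le> sqrt ((LINT x|M. (cmod (f x))\<^sup>2) * (LINT x|M. (cmod (g x))\<^sup>2))"
    by (rule real_le_rsqrt)
  moreover have "cmod (LINT x|M. f x * g x) \<le> (LINT x|M. cmod (f x * g x))"
    by (rule integral_norm_bound)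
  ultimately show ?thesis
    by (simp add: norm_mult real_sqrt_mult)
qed

section \<open>Lebesgue measure under translation and restriction\<close>

lemma distr_lebesgue_translation: "distr lebesgue lebesgue (\<lambda>x. x + c) = (lebesgue :: 'a::euclidean_space measure)"
  and measurable_lebesgue_translation: "(\<lambda>x. x + c) \<in> lebesgue \<rightarrow>\<^sub>M (lebesgue :: 'a::euclidean_space measure)"
proof -
  \<comment> \<open>A translation is the affine map whose scaling factors are all 1, so the density
    in the affine change of variables is 1.\<close>
  have *: "(\<lambda>x. c + (\<Sum>j\<in>Basis. (1 * (x \<bullet> j)) *\<^sub>R j)) = (\<lambda>x::'a. x + c)"
    by (simp add: euclidean_representation add.commute)
  show "distr lebesgue lebesgue (\<lambda>x. x + c) = (lebesgue :: 'a measure)"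
    using lebesgue_affine_euclidean[of "\<lambda>_. 1" c] unfolding * by (simp add: density_1)
  show "(\<lambda>x. x + c) \<in> lebesgue \<rightarrow>\<^sub>M (lebesgue :: 'a measure)"
    using lebesgue_affine_measurable[of "\<lambda>_. 1" c] unfolding * by simp
qed

lemma borel_measurable_lebesgue_translation:
  "f \<in> borel_measurable lebesgue \<Longrightarrow> (\<lambda>x. f (x + c)) \<in> borel_measurable lebesgue"
  using measurable_compose[OF measurable_lebesgue_translation] by blast

lemma integral_lebesgue_translation:
  fixes f :: "'a::euclidean_space \<Rightarrow> 'b::{banach, second_countable_topology}"
  assumes "f \<in> borel_measurable lebesgue"
  shows "(LINT x|lebesgue. f (x + c)) = (LINT x|lebesgue. f x)"
  using integral_distr[OF measurable_lebesgue_translation assms, of c]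
  by (simp add: distr_lebesgue_translation)

lemma integrable_lebesgue_translation:
  fixes f :: "'a::euclidean_space \<Rightarrow> 'b::{banach, second_countable_topology}"
  assumes "integrable lebesgue f"
  shows "integrable lebesgue (\<lambda>x. f (x + c))"
  using integrable_distr_eq[OF measurable_lebesgue_translation borel_measurable_integrable[OF assms], of c]
  by (simp add: distr_lebesgue_translation assms)

lemma square_integrable_translation:
  assumes "square_integrable lebesgue f"
  shows "square_integrable lebesgue (\<lambda>x. f (x + c))"
  using assms integrable_lebesgue_translation[of "\<lambda>x. (cmod (f x))\<^sup>2" c]
  by (simp add: square_integrable_def borel_measurable_lebesgue_translation)

text \<open>Here \<open>g\<close> is the zero extension of \<open>f\<close>, left abstract so that
  it can be supplied in whatever closed form is at hand.\<close>

lemma integral_lebesgue_on_eq: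
  fixes f g :: "'a::euclidean_space \<Rightarrow> 'b::{banach, second_countable_topology}"
  assumes "S \<in> sets lebesgue" "\<And>x. x \<in> S \<Longrightarrow> f x = g x" "\<And>x. x \<notin> S \<Longrightarrow> g x = 0"
  shows "(LINT x|lebesgue_on S. f x) = (LINT x|lebesgue. g x)"
proof -
  have "(\<lambda>x. indicator S x *\<^sub>R f x) = g"
    using assms(2,3) by (auto simp: fun_eq_iff indicator_def)
  then show ?thesis
    using assms(1) by (subst integral_restrict_space) auto
qed

lemma square_integrable_lebesgue_on_iff:
  assumes "S \<in> sets lebesgue" "\<And>x. x \<in> S \<Longrightarrow> f x = g x" "\<And>x. x \<notin> S \<Longrightarrow> g x = 0"
  shows "square_integrable (lebesgue_on S) f \<longleftrightarrow> square_integrable lebesgue g"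
proof -
  have g: "g = (\<lambda>x. if x \<in> S then f x else 0)"
    using assms(2,3) by (auto simp: fun_eq_iff)
  have "(\<lambda>x. indicator S x *\<^sub>R (cmod (f x))\<^sup>2) = (\<lambda>x. (cmod (g x))\<^sup>2)"
    by (auto simp: fun_eq_iff g indicator_def)
  then show ?thesis
    using assms(1) borel_measurable_if[OF assms(1), of f]
    by (simp add: square_integrable_def integrable_restrict_space g)
qed

lemma square_integrable_restrict:
  assumes "square_integrable (lebesgue_on S) f" "R \<subseteq> S" "S \<in> sets lebesgue" "R \<in> sets lebesgue"
  shows "square_integrable lebesgue (\<lambda>x. if x \<in> R then f x else 0)"
proof -
  have "square_integrable lebesgue (\<lambda>x. if x \<in> S then f x else 0)"
    using assms square_integrable_lebesgue_on_iff[of S f] by auto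
  then have "square_integrable lebesgue (\<lambda>x. indicator R x * (if x \<in> S then f x else 0))"
    by (rule square_integrable_mult_bounded[where B = 1])
      (use assms in \<open>auto simp: indicator_def\<close>)
  moreover have "(\<lambda>x. indicator R x * (if x \<in> S then f x else 0)) = (\<lambda>x. if x \<in> R then f x else 0)"
    using assms(2) by (auto simp: fun_eq_iff)
  ultimately show ?thesis by simp
qed

section \<open>Density of test functions\<close>

lemma integrable_indicator_fmeasurable:
  "A \<in> fmeasurable M \<Longrightarrow> integrable M (indicator A :: _ \<Rightarrow> real)"
  by (rule integrable_real_indicator) (simp_all add: fmeasurable_def)

lemma test_functionI:
  assumes "smooth \<phi>" "compact K" "K \<subseteq> \<Omega>" "\<And>x. x \<notin> K \<Longrightarrow> \<phi> x = 0"
  shows "test_function \<Omega> \<phi>"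
proof -
  have "closure {x. \<phi> x \<noteq> 0} \<subseteq> K"
    using assms(2,4) by (intro closure_minimal compact_imp_closed) auto
  moreover from this have "compact (closure {x. \<phi> x \<noteq> 0})"
    using assms(2) by (metis closed_closure compact_Int_closed inf.absorb2)
  ultimately show ?thesis
    using assms(1,3) by (auto simp: test_function_def)
qed

lemma test_functionE:
  assumes "test_function \<Omega> \<phi>"
  obtains K where "smooth \<phi>" "compact K" "K \<subseteq> \<Omega>" "\<And>x. x \<notin> K \<Longrightarrow> \<phi> x = 0"
  using assms closure_subset[of "{x. \<phi> x \<noteq> 0}"] unfolding test_function_def by blast

lemma test_function_mono: "test_function A \<phi> \<Longrightarrow> A \<subseteq> B \<Longrightarrow> test_function B \<phi>"
  by (auto simp: test_function_def)

lemma test_function_smooth: "test_function \<Omega> \<phi> \<Longrightarrow> smooth \<phi>"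
  by (simp add: test_function_def)

lemma test_function_eq_0: "test_function \<Omega> \<phi> \<Longrightarrow> x \<notin> \<Omega> \<Longrightarrow> \<phi> x = 0"
  by (metis test_functionE subsetD)

lemma test_function_zero: "test_function \<Omega> (\<lambda>x. 0)"
  by (rule test_functionI[of _ "{}"]) (auto intro: smooth_const)

lemma test_function_mult:
  assumes "smooth m" "test_function \<Omega> \<phi>"
  shows "test_function \<Omega> (\<lambda>x. m x * \<phi> x)"
proof -
  obtain K where "smooth \<phi>" "compact K" "K \<subseteq> \<Omega>" "\<And>x. x \<notin> K \<Longrightarrow> \<phi> x = 0"
    using assms(2) test_functionE by blast
  then show ?thesis
    using assms(1) by (intro test_functionI[of _ K]) (auto intro: smooth_mult)
qed

lemma test_function_add:
  assumes "test_function \<Omega> \<phi>" "test_function \<Omega> \<theta>"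
  shows "test_function \<Omega> (\<lambda>x. \<phi> x + \<theta> x)"
proof -
  obtain K where K: "smooth \<phi>" "compact K" "K \<subseteq> \<Omega>" "\<And>x. x \<notin> K \<Longrightarrow> \<phi> x = 0"
    using assms(1) test_functionE by blast
  obtain K' where "smooth \<theta>" "compact K'" "K' \<subseteq> \<Omega>" "\<And>x. x \<notin> K' \<Longrightarrow> \<theta> x = 0"
    using assms(2) test_functionE by blast
  with K show ?thesis
    by (intro test_functionI[of _ "K \<union> K'"]) (auto intro: smooth_add)
qed

lemma test_function_translation:
  assumes "test_function A \<phi>" "\<And>x. x \<in> A \<Longrightarrow> x - c \<in> B"
  shows "test_function B (\<lambda>x. \<phi> (x + c))"
proof -
  obtain K where K: "smooth \<phi>" "compact K" "K \<subseteq> A" "\<And>x. x \<notin> K \<Longrightarrow> \<phi> x = 0"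
    using assms(1) test_functionE by blast
  show ?thesis
  proof (rule test_functionI)
    show "smooth (\<lambda>x. \<phi> (x + c))"
      using smooth_compose_affine[OF bounded_linear_ident K(1)] .
    show "compact ((\<lambda>x. x - c) ` K)"
      by (intro compact_continuous_image K(2) continuous_intros)
    show "(\<lambda>x. x - c) ` K \<subseteq> B"
      using K(3) assms(2) by auto
    show "\<phi> (x + c) = 0" if "x \<notin> (\<lambda>x. x - c) ` K" for x
      using that K(4)[of "x + c"] by (metis add_diff_cancel_right' image_eqI)
  qed
qed

lemma test_function_frechet_derivative:
  assumes "test_function \<Omega> \<phi>"
  shows "test_function \<Omega> (\<lambda>x. frechet_derivative \<phi> (at x) v)"
proof -
  obtain K where K: "smooth \<phi>" "compact K" "K \<subseteq> \<Omega>" "\<And>x. x \<notin> K \<Longrightarrow> \<phi> x = 0"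
    using assms test_functionE by blast
  show ?thesis
  proof (rule test_functionI)
    show "smooth (\<lambda>x. frechet_derivative \<phi> (at x) v)"
      by (rule smooth_frechet_derivative[OF K(1)])
    show "frechet_derivative \<phi> (at x) v = 0" if "x \<notin> K" for x
    proof -
      have "(\<phi> has_derivative (\<lambda>h. 0)) (at x)"
        by (rule has_derivative_transform_within_open[OF has_derivative_const, of "- K"])
          (use that K in \<open>auto simp: compact_imp_closed\<close>)
      then show ?thesis
        using frechet_derivative_at by metis
    qed
  qed (use K in auto)
qed

lemma test_function_bounded:
  assumes "test_function \<Omega> \<phi>"
  obtains B where "0 \<le> B" "\<And>x. cmod (\<phi> x) \<le> B"
proof -
  obtain K where K: "smooth \<phi>" "compact K" "K \<subseteq> \<Omega>" "\<And>x. x \<notin> K \<Longrightarrow> \<phi> x = 0"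
    using assms test_functionE by blast
  have "bounded (\<phi> ` K)"
    using K(2) continuous_on_subset[OF smooth_continuous[OF K(1)]]
    by (auto intro: compact_imp_bounded compact_continuous_image)
  then obtain B where "\<And>x. x \<in> K \<Longrightarrow> cmod (\<phi> x) \<le> B"
    by (auto simp: bounded_iff)
  then have "cmod (\<phi> x) \<le> max B 0" for x
    using K(4)[of x] by (cases "x \<in> K") (auto simp: max.coboundedI1)
  then show ?thesis using that[of "max B 0"] by simp
qed

lemma smooth_borel_measurable_lebesgue:
  fixes f :: "plane \<Rightarrow> complex"
  assumes "smooth f"
  shows "f \<in> borel_measurable lebesgue"
  by (rule measurable_completion)
    (simp add: borel_measurable_continuous_onI[OF smooth_continuous[OF assms]])

lemma test_function_square_integrable:
  assumes "test_function \<Omega> \<phi>"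
  shows "square_integrable lebesgue \<phi>"
proof -
  obtain K where K: "smooth \<phi>" "compact K" "K \<subseteq> \<Omega>" "\<And>x. x \<notin> K \<Longrightarrow> \<phi> x = 0"
    using assms test_functionE by blast
  obtain B where B: "\<And>x. cmod (\<phi> x) \<le> B"
    using test_function_bounded[OF assms] by blast
  have "square_integrable lebesgue (indicator K)"
    unfolding square_integrable_def
  proof
    have K': "K \<in> fmeasurable lebesgue" using lmeasurable_compact[OF K(2)] .
    then show "indicator K \<in> borel_measurable lebesgue"
      by (intro borel_measurable_indicator) (simp add: fmeasurable_def)
    have "(\<lambda>x. (cmod (indicator K x))\<^sup>2) = (indicator K :: plane \<Rightarrow> real)"
      by (auto simp: indicator_def fun_eq_iff)
    then show "integrable lebesgue (\<lambda>x. (cmod (indicator K x))\<^sup>2)"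
      using integrable_indicator_fmeasurable[OF K'] by simp
  qed
  then have "square_integrable lebesgue (\<lambda>x. \<phi> x * indicator K x)"
    by (rule square_integrable_mult_bounded[OF _ smooth_borel_measurable_lebesgue[OF K(1)] B])
  moreover have "(\<lambda>x. \<phi> x * indicator K x) = \<phi>"
    using K(4) by (auto simp: fun_eq_iff indicator_def)
  ultimately show ?thesis by simp
qed

text \<open>The closure of the test functions on \<open>S\<close> in L2 of the plane. That it
  contains every square integrable function vanishing off \<open>S\<close> is shown below by measure
  theory, without convolutions.\<close>

definition L2_approximable :: "plane set \<Rightarrow> (plane \<Rightarrow> complex) \<Rightarrow> bool" where
  "L2_approximable S f \<longleftrightarrow> square_integrable lebesgue f \<and>
     (\<forall>\<epsilon>>0. \<exists>q. test_function S q \<and> (LINT x|lebesgue. (cmod (f x - q x))\<^sup>2) < \<epsilon>)"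

lemma test_function_L2_approximable:
  assumes "test_function S q"
  shows "L2_approximable S q"
proof -
  have "square_integrable lebesgue q"
    by (rule test_function_square_integrable[OF assms])
  moreover have "(LINT x|lebesgue. (cmod (q x - q x))\<^sup>2) < \<epsilon>" if "\<epsilon> > 0" for \<epsilon>
    using that by simp
  ultimately show ?thesis
    using assms unfolding L2_approximable_def by auto
qed

lemma L2_approximable_add:
  assumes "L2_approximable S f" "L2_approximable S g"
  shows "L2_approximable S (\<lambda>x. f x + g x)"
  unfolding L2_approximable_def
proof (intro conjI allI impI)
  have sq: "square_integrable lebesgue f" "square_integrable lebesgue g"
    using assms by (auto simp: L2_approximable_def)
  then show "square_integrable lebesgue (\<lambda>x. f x + g x)"
    by (rule square_integrable_add)
  fix \<epsilon> :: real assume "\<epsilon> > 0"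
  \<comment> \<open>The estimate for the square of a sum doubles each error, so two errors below
    \<epsilon> / 4 give one below \<epsilon>.\<close>
  then obtain q r where q: "test_function S q" "(LINT x|lebesgue. (cmod (f x - q x))\<^sup>2) < \<epsilon> / 4"
    and r: "test_function S r" "(LINT x|lebesgue. (cmod (g x - r x))\<^sup>2) < \<epsilon> / 4"
    using assms unfolding L2_approximable_def by (meson zero_less_divide_iff zero_less_numeral)
  have "(LINT x|lebesgue. (cmod ((f x - q x) + (g x - r x)))\<^sup>2)
      \<le> 2 * (LINT x|lebesgue. (cmod (f x - q x))\<^sup>2) + 2 * (LINT x|lebesgue. (cmod (g x - r x))\<^sup>2)"
    by (intro integral_add_power2_le square_integrable_diff sq test_function_square_integrable[OF q(1)]
        test_function_square_integrable[OF r(1)])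
  moreover have "(f x - q x) + (g x - r x) = f x + g x - (q x + r x)" for x
    by simp
  ultimately show "\<exists>q. test_function S q \<and> (LINT x|lebesgue. (cmod (f x + g x - q x))\<^sup>2) < \<epsilon>"
    using q r by (intro exI[of _ "\<lambda>x. q x + r x"]) (auto intro: test_function_add)
qed

lemma L2_approximable_cmult:
  assumes "L2_approximable S f"
  shows "L2_approximable S (\<lambda>x. c * f x)"
  unfolding L2_approximable_def
proof (intro conjI allI impI)
  have sq: "square_integrable lebesgue f"
    using assms by (auto simp: L2_approximable_def)
  then show "square_integrable lebesgue (\<lambda>x. c * f x)"
    by (rule square_integrable_cmult)
  fix \<epsilon> :: real assume "\<epsilon> > 0"
  \<comment> \<open>The summand 1 covers the case \<open>c = 0\<close>.\<close>
  have pos: "(cmod c)\<^sup>2 + 1 > 0" by (simp add: add_nonneg_pos)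
  then obtain q where q: "test_function S q"
    "(LINT x|lebesgue. (cmod (f x - q x))\<^sup>2) < \<epsilon> / ((cmod c)\<^sup>2 + 1)"
    using assms \<open>\<epsilon> > 0\<close> unfolding L2_approximable_def by (meson divide_pos_pos)
  have "(LINT x|lebesgue. (cmod (c * f x - c * q x))\<^sup>2)
      = (cmod c)\<^sup>2 * (LINT x|lebesgue. (cmod (f x - q x))\<^sup>2)"
    by (simp add: norm_mult power_mult_distrib flip: right_diff_distrib)
  also have "\<dots> \<le> ((cmod c)\<^sup>2 + 1) * (LINT x|lebesgue. (cmod (f x - q x))\<^sup>2)"
    by (intro mult_right_mono) auto
  also have "\<dots> < \<epsilon>"
    using q(2) pos by (simp add: field_simps)
  finally show "\<exists>q. test_function S q \<and> (LINT x|lebesgue. (cmod (c * f x - q x))\<^sup>2) < \<epsilon>"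
    using q(1) test_function_mult[OF smooth_const] by blast
qed

lemma L2_approximable_sum:
  "(\<And>i. i \<in> I \<Longrightarrow> L2_approximable S (f i)) \<Longrightarrow> L2_approximable S (\<lambda>x. \<Sum>i\<in>I. f i x)"
proof (induction I rule: infinite_finite_induct)
  case (insert i I)
  then show ?case using L2_approximable_add by fastforce
qed (auto simp: test_function_L2_approximable test_function_zero)

text \<open>Dominated convergence turns the pointwise limit into an L2 limit: the bound by
  \<open>w\<close> passes to \<open>g\<close>, so the distance of \<open>g\<close> and
  \<open>f n\<close> is at most \<open>2 * w x\<close>.\<close>

lemma L2_approximable_limit:
  assumes f: "\<And>n. L2_approximable S (f n)"
    and w: "integrable lebesgue (\<lambda>x. (w x)\<^sup>2)" "\<And>n x. cmod (f n x) \<le> w x"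
    and lim: "\<And>x. (\<lambda>n. f n x) \<longlonglongrightarrow> g x"
  shows "L2_approximable S g"
proof -
  have sqf: "square_integrable lebesgue (f n)" for n
    using f by (auto simp: L2_approximable_def)
  have f_meas[measurable]: "f n \<in> borel_measurable lebesgue" for n
    using sqf by (simp add: square_integrable_def)
  have g_meas[measurable]: "g \<in> borel_measurable lebesgue"
    by (rule borel_measurable_LIMSEQ_metric[OF f_meas lim])
  have g_le: "cmod (g x) \<le> w x" for x
    using tendsto_norm[OF lim[of x]] by (rule LIMSEQ_le_const2) (auto simp: w(2))
  have sqg: "square_integrable lebesgue g"
    unfolding square_integrable_def
    by (auto intro!: Bochner_Integration.integrable_bound[OF w(1)] AE_I2 power_mono g_le)
  have le: "cmod (g x - f n x) \<le> 2 * w x" for n x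
    using norm_triangle_ineq4[of "g x" "f n x"] g_le[of x] w(2)[of n x] by linarith
  have "(\<lambda>n. LINT x|lebesgue. (cmod (g x - f n x))\<^sup>2) \<longlonglongrightarrow> (LINT x::plane|lebesgue. 0 :: real)"
  proof (rule integral_dominated_convergence[where w = "\<lambda>x. (2 * w x)\<^sup>2"
        and s = "\<lambda>n x. (cmod (g x - f n x))\<^sup>2" and f = "\<lambda>x. 0" and M = lebesgue])
    show "AE x in lebesgue. (\<lambda>n. (cmod (g x - f n x))\<^sup>2) \<longlonglongrightarrow> 0"
    proof (rule AE_I2)
      fix x
      have "(\<lambda>n. (cmod (g x - f n x))\<^sup>2) \<longlonglongrightarrow> (cmod (g x - g x))\<^sup>2"
        by (intro tendsto_intros lim)
      then show "(\<lambda>n. (cmod (g x - f n x))\<^sup>2) \<longlonglongrightarrow> 0" by simp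
    qed
    show "integrable lebesgue (\<lambda>x. (2 * w x)\<^sup>2)"
      using w(1) by (simp add: power_mult_distrib)
    show "AE x in lebesgue. norm ((cmod (g x - f n x))\<^sup>2) \<le> (2 * w x)\<^sup>2" for n
      using power_mono[OF le norm_ge_zero, of _ _ 2] by (intro AE_I2) simp
  qed simp_all
  then have lim0: "(\<lambda>n. LINT x|lebesgue. (cmod (g x - f n x))\<^sup>2) \<longlonglongrightarrow> 0" by simp
  show ?thesis
    unfolding L2_approximable_def
  proof (intro conjI allI impI sqg)
    fix \<epsilon> :: real assume "\<epsilon> > 0"
    then have "\<epsilon> / 4 > 0" by simp
    then obtain n where n: "(LINT x|lebesgue. (cmod (g x - f n x))\<^sup>2) < \<epsilon> / 4"
      using order_tendstoD(2)[OF lim0] eventually_happens'[OF sequentially_bot] by blast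
    obtain q where q: "test_function S q" "(LINT x|lebesgue. (cmod (f n x - q x))\<^sup>2) < \<epsilon> / 4"
      using f[of n] \<open>\<epsilon> / 4 > 0\<close> unfolding L2_approximable_def by blast
    have "(LINT x|lebesgue. (cmod ((g x - f n x) + (f n x - q x)))\<^sup>2)
        \<le> 2 * (LINT x|lebesgue. (cmod (g x - f n x))\<^sup>2) + 2 * (LINT x|lebesgue. (cmod (f n x - q x))\<^sup>2)"
      by (intro integral_add_power2_le square_integrable_diff sqf sqg test_function_square_integrable[OF q(1)])
    then show "\<exists>q. test_function S q \<and> (LINT x|lebesgue. (cmod (g x - q x))\<^sup>2) < \<epsilon>"
      using q n by (intro exI[of _ q]) auto
  qed
qed

text \<open>Used to pass from Borel sets to Lebesgue measurable sets, which differ from them by null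
  sets.\<close>

lemma L2_approximable_AE:
  assumes "L2_approximable S f" "g \<in> borel_measurable lebesgue" "AE x in lebesgue. f x = g x"
  shows "L2_approximable S g"
proof -
  have sq: "square_integrable lebesgue f"
    using assms(1) by (simp add: L2_approximable_def)
  then have f: "f \<in> borel_measurable lebesgue" "integrable lebesgue (\<lambda>x. (cmod (f x))\<^sup>2)"
    by (simp_all add: square_integrable_def)
  have "integrable lebesgue (\<lambda>x. (cmod (g x))\<^sup>2)"
    by (rule integrable_cong_AE_imp[OF f(2)]) (use assms in auto)
  moreover have eq: "(LINT x|lebesgue. (cmod (g x - q x))\<^sup>2) = (LINT x|lebesgue. (cmod (f x - q x))\<^sup>2)"
    if "test_function S q" for q
  proof (rule integral_cong_AE)
    have [measurable]: "q \<in> borel_measurable lebesgue"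
      using smooth_borel_measurable_lebesgue[OF test_function_smooth[OF that]] .
    note [measurable] = f(1) assms(2)
    show "(\<lambda>x. (cmod (g x - q x))\<^sup>2) \<in> borel_measurable lebesgue"
      "(\<lambda>x. (cmod (f x - q x))\<^sup>2) \<in> borel_measurable lebesgue"
      by measurable
    show "AE x in lebesgue. (cmod (g x - q x))\<^sup>2 = (cmod (f x - q x))\<^sup>2"
      using assms(3) by eventually_elim simp
  qed
  moreover have "\<exists>q. test_function S q \<and> (LINT x|lebesgue. (cmod (g x - q x))\<^sup>2) < \<epsilon>" if \<epsilon>: "\<epsilon> > 0" for \<epsilon>
  proof -
    obtain q where "test_function S q" "(LINT x|lebesgue. (cmod (f x - q x))\<^sup>2) < \<epsilon>"
      using assms(1) \<epsilon> unfolding L2_approximable_def by blast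
    then show ?thesis using eq[of q] by (intro exI[of _ q]) simp
  qed
  ultimately show ?thesis
    using assms(2) unfolding L2_approximable_def square_integrable_def by simp
qed

text \<open>For nonpositive \<open>s\<close> the argument is never positive and the sequence is
  constantly 0. The offset \<open>c\<close> does not change the limit, but \<open>c = 1\<close>
  makes the n-th function vanish already for \<open>s\<close> up to \<open>1 / n\<close>.\<close>

lemma cutoff_scaled_LIMSEQ:
  assumes "0 \<le> c"
  shows "(\<lambda>n. cutoff (real n * s - c)) \<longlonglongrightarrow> (if s > 0 then 1 else 0)"
proof (cases "s > 0")
  case True
  have "((\<lambda>x::real. exp (- inverse x)) \<longlongrightarrow> exp (- 0)) at_top"
    by (intro tendsto_intros tendsto_inverse_0_at_top filterlim_ident)
  then have "((\<lambda>x::real. exp (- inverse x)) \<longlongrightarrow> 1) at_top" by simp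
  then have "(cutoff \<longlongrightarrow> 1) at_top"
    by (rule Lim_transform_eventually)
      (auto intro: eventually_mono[OF eventually_gt_at_top[of 0]] simp: cutoff_eq divide_simps)
  moreover have "filterlim (\<lambda>n. - c + s * real n) at_top sequentially"
    using True by (intro filterlim_tendsto_add_at_top[OF tendsto_const]
        filterlim_tendsto_pos_mult_at_top[OF tendsto_const _ filterlim_real_sequentially])
  ultimately have "(\<lambda>n. cutoff (- c + s * real n)) \<longlonglongrightarrow> 1"
    by (rule filterlim_compose)
  then show ?thesis using True by (simp add: algebra_simps)
next
  case False
  then have "real n * s \<le> 0" for n
    by (simp add: mult_nonneg_nonpos)
  then have "cutoff (real n * s - c) = 0" for n
    using assms by (smt (verit) cutoff_eq)
  then show ?thesis using False by simp
qed

lemma smooth_cutoff_inner: "smooth (\<lambda>x::plane. complex_of_real (cutoff (k * (x \<bullet> e) + c)))"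
  using smooth_bounded_linear[OF bounded_linear_of_real[where 'a = complex]
      smooth_compose_affine[OF bounded_linear_const_mult[OF bounded_linear_inner_left[of e]] smooth_cutoff]]
  by simp

text \<open>The cutoffs \<open>r n\<close> localize smooth approximations to test functions on \<open>S\<close>.\<close>

locale exhausting_cutoffs =
  fixes S :: "plane set" and r :: "nat \<Rightarrow> plane \<Rightarrow> complex"
  assumes S_fmeasurable: "S \<in> fmeasurable lebesgue"
    and test: "\<And>n. test_function S (r n)"
    and norm_le: "\<And>n x. cmod (r n x) \<le> 1"
    and LIMSEQ: "\<And>x. (\<lambda>n. r n x) \<longlonglongrightarrow> indicator S x"
begin

lemma S_sets: "S \<in> sets lebesgue"
  using S_fmeasurable by (simp add: fmeasurable_def)

lemma L2_approximable_dominated: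
  assumes "\<And>n. L2_approximable S (f n)" "\<And>n x. cmod (f n x) \<le> indicator S x"
    "\<And>x. (\<lambda>n. f n x) \<longlonglongrightarrow> g x"
  shows "L2_approximable S g"
proof (rule L2_approximable_limit[OF assms(1) _ assms(2,3)])
  have "(\<lambda>x. (indicator S x)\<^sup>2) = (indicator S :: plane \<Rightarrow> real)"
    by (auto simp: indicator_def)
  then show "integrable lebesgue (\<lambda>x. (indicator S x :: real)\<^sup>2)"
    using integrable_indicator_fmeasurable[OF S_fmeasurable] by simp
qed

lemma norm_mult_r_le: "0 \<le> c \<Longrightarrow> c \<le> 1 \<Longrightarrow> cmod (complex_of_real c * r n x) \<le> indicator S x"
  using norm_le[of n x] test_function_eq_0[OF test, of x n]
  by (cases "x \<in> S") (auto simp: norm_mult mult_le_one)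

text \<open>A box is an intersection of four half planes, and a product of rescaled cutoffs tends to
  its indicator. These factors may be positive right up to the sides of the box, as
  \<open>r n\<close> supplies a compact support in \<open>S\<close>.\<close>

lemma L2_approximable_box: "L2_approximable S (indicator (box l u \<inter> S))"
proof (rule L2_approximable_dominated)
  let ?c = "\<lambda>n x. cutoff (real n * (fst x - fst l)) * cutoff (real n * (fst u - fst x)) *
      cutoff (real n * (snd x - snd l)) * cutoff (real n * (snd u - snd x))"
  have "smooth (\<lambda>x::plane. complex_of_real (?c n x))" for n
    using smooth_mult[OF smooth_mult[OF smooth_mult[OF
      smooth_cutoff_inner[of n "(1, 0)" "- n * fst l"] smooth_cutoff_inner[of "- n" "(1, 0)" "n * fst u"]]
      smooth_cutoff_inner[of n "(0, 1)" "- n * snd l"]] smooth_cutoff_inner[of "- n" "(0, 1)" "n * snd u"]]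
    by (simp add: inner_prod_def algebra_simps)
  then show "L2_approximable S (\<lambda>x. complex_of_real (?c n x) * r n x)" for n
    by (intro test_function_L2_approximable test_function_mult test)
  show "cmod (complex_of_real (?c n x) * r n x) \<le> indicator S x" for n x
    by (intro norm_mult_r_le mult_nonneg_nonneg mult_le_one cutoff_nonneg cutoff_le_1)
  have *: "complex_of_real ((if 0 < fst x - fst l then 1 else 0) * (if 0 < fst u - fst x then 1 else 0) *
        (if 0 < snd x - snd l then 1 else 0) * (if 0 < snd u - snd x then 1 else 0)) * indicator S x
      = indicator (box l u \<inter> S) x" for x
    by (cases "fst l < fst x"; cases "fst x < fst u"; cases "snd l < snd x"; cases "snd x < snd u")
      (simp_all add: indicator_def box_def Basis_prod_def inner_prod_def)
  show "(\<lambda>n. complex_of_real (?c n x) * r n x) \<longlonglongrightarrow> indicator (box l u \<inter> S) x" for x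
    unfolding *[symmetric] 
    by (intro tendsto_mult tendsto_of_real cutoff_scaled_LIMSEQ[of 0, simplified] LIMSEQ)
qed

lemma L2_approximable_indicator_S: "L2_approximable S (indicator S)"
  using norm_mult_r_le[of 1]
  by (intro L2_approximable_dominated[OF test_function_L2_approximable[OF test] _ LIMSEQ]) simp

text \<open>Boxes generate the Borel sets and are stable under intersection, so closure under
  complements and countable disjoint unions suffices. The former is linearity; the latter is
  dominated convergence with the indicator of \<open>S\<close>, which is square integrable since
  \<open>S\<close> has finite measure.\<close>

lemma L2_approximable_borel:
  assumes "A \<in> sets borel"
  shows "L2_approximable S (indicator (A \<inter> S))"
proof -
  let ?E = "range (\<lambda>(a, b). box a b :: plane set)"
  have "Int_stable ?E"
    by (auto simp: Int_stable_def box_Int_box)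
  moreover have "?E \<subseteq> Pow UNIV" by simp
  moreover have "A \<in> sigma_sets UNIV ?E"
    using assms by (simp add: borel_eq_box)
  ultimately show ?thesis
  proof (induction rule: sigma_sets_induct_disjoint)
    case (basic A)
    then show ?case using L2_approximable_box by auto
  next
    case empty
    show ?case using test_function_L2_approximable[OF test_function_zero] by simp
  next
    case (compl A)
    have "indicator ((UNIV - A) \<inter> S) = (\<lambda>x. indicator S x + (- 1) * indicator (A \<inter> S) x :: complex)"
      by (auto simp: fun_eq_iff indicator_def)
    then show ?case
      using L2_approximable_add[OF L2_approximable_indicator_S L2_approximable_cmult[OF compl(2)]]
      by metis
  next
    case (union A)
    show ?case
    proof (rule L2_approximable_dominated)
      have eq: "(\<Sum>i<n. indicator (A i \<inter> S) x) = (indicator (\<Union>i<n. A i \<inter> S) x :: complex)" for n x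
        using union(1) by (intro indicator_UN_disjoint[symmetric]) (auto simp: disjoint_family_on_def)
      show "L2_approximable S (\<lambda>x. \<Sum>i<n. indicator (A i \<inter> S) x)" for n
        by (intro L2_approximable_sum union(3))
      show "cmod (\<Sum>i<n. indicator (A i \<inter> S) x) \<le> indicator S x" for n x
        unfolding eq by (auto simp: indicator_def)
      have "(\<Union>i. A i) \<inter> S = (\<Union>i. A i \<inter> S)" by blast
      then show "(\<lambda>n. \<Sum>i<n. indicator (A i \<inter> S) x :: complex) \<longlonglongrightarrow> indicator ((\<Union>i. A i) \<inter> S) x" for x
        unfolding eq using LIMSEQ_indicator_UN[of "\<lambda>i. A i \<inter> S" x] by metis
    qed
  qed
qed

lemma L2_approximable_lebesgue:
  assumes "A \<in> sets lebesgue"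
  shows "L2_approximable S (indicator (A \<inter> S))"
proof -
  obtain B N N' where B: "A = B \<union> N" "N \<subseteq> N'" "N' \<in> null_sets lborel" "B \<in> sets lborel"
    using assms by (rule sets_completionE)
  have "AE x in lebesgue. x \<notin> N'"
    using AE_not_in[OF B(3)] by (simp add: AE_completion)
  then have "AE x in lebesgue. indicator (B \<inter> S) x = (indicator (A \<inter> S) x :: complex)"
    by (rule AE_mp) (use B(1,2) in \<open>auto simp: indicator_def intro!: AE_I2\<close>)
  moreover have "indicator (A \<inter> S) \<in> borel_measurable lebesgue"
    using assms S_sets by simp
  ultimately show ?thesis
    using L2_approximable_AE[OF L2_approximable_borel[of B]] B(4) by simp
qed

text \<open>The simple functions approximating \<open>f\<close> are bounded by
  \<open>2 * cmod (f x)\<close>. This dominates the limit and also forces them to vanish off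
  \<open>S\<close>, so each is a finite combination of indicators of measurable subsets of
  \<open>S\<close>.\<close>

lemma dense:
  assumes "square_integrable lebesgue f" "\<And>x. x \<notin> S \<Longrightarrow> f x = 0"
  shows "L2_approximable S f"
proof -
  have f_meas: "f \<in> borel_measurable lebesgue"
    using assms(1) by (simp add: square_integrable_def)
  then obtain F where F: "\<And>i. simple_function lebesgue (F i)" "\<And>x. (\<lambda>i. F i x) \<longlonglongrightarrow> f x"
    "\<And>i x. cmod (F i x) \<le> 2 * cmod (f x)"
    using borel_measurable_implies_sequence_metric[OF f_meas, of 0]
    by (auto simp: dist_norm)
  show ?thesis
  proof (rule L2_approximable_limit[OF _ _ F(3,2)])
    show "integrable lebesgue (\<lambda>x. (2 * cmod (f x))\<^sup>2)"
      using assms(1) by (simp add: square_integrable_def power_mult_distrib)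
    fix i
    have F_eq: "F i x = (\<Sum>y\<in>range (F i). y * indicator (F i -` {y} \<inter> S) x)" for x
    proof -
      have "(\<Sum>y\<in>range (F i). y * indicator (F i -` {y} \<inter> S) x)
          = (\<Sum>y\<in>range (F i). if y = F i x then y * indicator S x else 0)"
        by (intro sum.cong) (auto simp: indicator_def)
      also have "\<dots> = F i x * indicator S x"
        using simple_functionD(1)[OF F(1)[of i]] by (subst sum.delta) auto
      also have "\<dots> = F i x"
        using F(3)[of i x] assms(2)[of x] by (auto simp: indicator_def)
      finally show ?thesis ..
    qed
    have "L2_approximable S (\<lambda>x. \<Sum>y\<in>range (F i). y * indicator (F i -` {y} \<inter> S) x)"
    proof (intro L2_approximable_sum L2_approximable_cmult L2_approximable_lebesgue)
      show "F i -` {y} \<in> sets lebesgue" for y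
        using simple_functionD(2)[OF F(1)[of i], of "{y}"] by simp
    qed
    then show "L2_approximable S (F i)"
      unfolding F_eq[symmetric] .
  qed
qed

end

section \<open>The rectangle\<close>

text \<open>Measured in multiples of \<open>a\<close> from the corner \<open>p\<close>, so that the
  rectangle becomes the unit square in the two coordinates.\<close>

definition coord :: "plane \<Rightarrow> plane \<Rightarrow> plane \<Rightarrow> real" where
  "coord p a x = ((x - p) \<bullet> a) / (a \<bullet> a)"

lemma coord_has_derivative: "(coord p a has_derivative (\<lambda>v. (v \<bullet> a) / (a \<bullet> a))) (at x)"
  unfolding coord_def divide_inverse by (auto intro!: derivative_eq_intros)

lemma continuous_on_coord: "continuous_on S (coord p a)"
  unfolding coord_def[abs_def] divide_inverse by (intro continuous_intros)

lemma smooth_compose_coord: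
  assumes "smooth f"
  shows "smooth (\<lambda>x. f (coord p a x))"
proof -
  have A: "bounded_linear (\<lambda>x. (x \<bullet> a) * inverse (a \<bullet> a))"
    by (intro bounded_linear_mult_const bounded_linear_inner_left)
  have eq: "coord p a x = (x \<bullet> a) * inverse (a \<bullet> a) + - (p \<bullet> a) * inverse (a \<bullet> a)" for x
    by (simp add: coord_def inner_diff_left divide_inverse algebra_simps)
  show ?thesis
    unfolding eq by (rule smooth_compose_affine[OF A assms])
qed

locale rectangular_frame =
  fixes p a b :: plane
  assumes a_nonzero: "a \<noteq> 0" and b_nonzero: "b \<noteq> 0" and orthogonal: "a \<bullet> b = 0"
begin

abbreviation \<sigma> :: "plane \<Rightarrow> real" where "\<sigma> \<equiv> coord p a"
abbreviation \<tau> :: "plane \<Rightarrow> real" where "\<tau> \<equiv> coord p b"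
abbreviation R :: "plane set" where "R \<equiv> rectangle p a b"

lemma coord_combination:
  "\<sigma> (p + s *\<^sub>R a + t *\<^sub>R b) = s" "\<tau> (p + s *\<^sub>R a + t *\<^sub>R b) = t"
  using a_nonzero b_nonzero orthogonal
  by (simp_all add: coord_def inner_add_left inner_commute[of b a])

lemma coord_shift [simp]: "\<sigma> (x + c *\<^sub>R a) = \<sigma> x + c" "\<tau> (x + c *\<^sub>R a) = \<tau> x"
  "\<sigma> (x - c *\<^sub>R a) = \<sigma> x - c" "\<tau> (x - c *\<^sub>R a) = \<tau> x"
  using a_nonzero orthogonal
  by (simp_all add: coord_def inner_add_left inner_diff_left diff_divide_distrib add_divide_distrib)

text \<open>The remainder \<open>y\<close> is orthogonal to both vectors. Cramer's rule with the
  determinant \<open>d\<close> makes it vanish, and \<open>d\<close> is nonzero by Lagrange's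
  identity, which expresses its square through the inner products of \<open>a\<close> and
  \<open>b\<close>.\<close>

lemma decomposition: "x = p + \<sigma> x *\<^sub>R a + \<tau> x *\<^sub>R b"
proof -
  define y where "y = x - (p + \<sigma> x *\<^sub>R a + \<tau> x *\<^sub>R b)"
  have "y \<bullet> a = 0" "y \<bullet> b = 0"
    using a_nonzero b_nonzero orthogonal
    by (simp_all add: y_def coord_def inner_diff_left inner_add_left inner_commute[of b a])
  then have ya: "fst y * fst a + snd y * snd a = 0" and yb: "fst y * fst b + snd y * snd b = 0"
    by (simp_all add: inner_prod_def)
  define d where "d = fst a * snd b - snd a * fst b"
  have "d\<^sup>2 + (a \<bullet> b)\<^sup>2 = (a \<bullet> a) * (b \<bullet> b)"
    by (simp add: d_def inner_prod_def power2_eq_square algebra_simps)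
  then have "d \<noteq> 0"
    using a_nonzero b_nonzero orthogonal by auto
  moreover have "fst y * d = snd b * (fst y * fst a + snd y * snd a) - snd a * (fst y * fst b + snd y * snd b)"
    "snd y * d = fst a * (fst y * fst b + snd y * snd b) - fst b * (fst y * fst a + snd y * snd a)"
    by (simp_all add: d_def algebra_simps)
  ultimately have "fst y = 0" "snd y = 0"
    unfolding ya yb by simp_all
  then show ?thesis
    by (simp add: y_def prod_eq_iff)
qed

lemma mem_R_iff: "x \<in> R \<longleftrightarrow> 0 < \<sigma> x \<and> \<sigma> x < 1 \<and> 0 < \<tau> x \<and> \<tau> x < 1"
proof
  assume "x \<in> R"
  then show "0 < \<sigma> x \<and> \<sigma> x < 1 \<and> 0 < \<tau> x \<and> \<tau> x < 1"
    by (auto simp: rectangle_def coord_combination)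
next
  assume "0 < \<sigma> x \<and> \<sigma> x < 1 \<and> 0 < \<tau> x \<and> \<tau> x < 1"
  then show "x \<in> R"
    unfolding rectangle_def using decomposition[of x] by blast
qed

text \<open>Closed in the direction of \<open>a\<close>, where a cutoff controls the support, and
  open in the direction of \<open>b\<close>, where the boundary of \<Omega> does.\<close>

definition strip :: "real \<Rightarrow> real \<Rightarrow> plane set" where
  "strip \<alpha> \<beta> = {x \<in> R. \<alpha> \<le> \<sigma> x \<and> \<sigma> x \<le> \<beta>}"

lemma strip_subset_R: "strip \<alpha> \<beta> \<subseteq> R"
  by (auto simp: strip_def)

lemma open_R: "open R"
proof -
  have "R = {x. 0 < \<sigma> x} \<inter> {x. \<sigma> x < 1} \<inter> {x. 0 < \<tau> x} \<inter> {x. \<tau> x < 1}"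
    by (auto simp: mem_R_iff)
  then show ?thesis
    by (auto intro!: open_Int open_Collect_less continuous_on_coord continuous_on_const)
qed

lemma bounded_coords: "bounded {x. \<bar>\<sigma> x\<bar> \<le> 1 \<and> \<bar>\<tau> x\<bar> \<le> 1}"
  unfolding bounded_iff
proof (intro exI ballI)
  fix x assume x: "x \<in> {x. \<bar>\<sigma> x\<bar> \<le> 1 \<and> \<bar>\<tau> x\<bar> \<le> 1}"
  have "norm x = norm (p + \<sigma> x *\<^sub>R a + \<tau> x *\<^sub>R b)"
    using decomposition[of x] by simp
  also have "\<dots> \<le> norm p + \<bar>\<sigma> x\<bar> * norm a + \<bar>\<tau> x\<bar> * norm b"
    by (intro norm_triangle_le add_mono) simp_all
  also have "\<dots> \<le> norm p + 1 * norm a + 1 * norm b"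
    using x by (intro add_mono mult_right_mono) auto
  finally show "norm x \<le> norm p + 1 * norm a + 1 * norm b" .
qed

lemma R_subset_coords: "R \<subseteq> {x. \<bar>\<sigma> x\<bar> \<le> 1 \<and> \<bar>\<tau> x\<bar> \<le> 1}"
  by (auto simp: mem_R_iff)

lemma R_sets: "R \<in> sets lebesgue"
  using open_R by (simp add: borel_open)

text \<open>The offset 1 in the four cutoffs keeps the n-th support at coordinate distance at least
  \<open>1 / n\<close> from all sides, hence in a compact set; for \<open>n = 0\<close> the function
  is 0.\<close>

lemma exhausting_cutoffs_inner_rectangle:
  assumes "0 \<le> \<alpha>" "\<beta> \<le> 1"
  shows "\<exists>r. exhausting_cutoffs {x \<in> R. \<alpha> < \<sigma> x \<and> \<sigma> x < \<beta>} r"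
proof -
  let ?S = "{x \<in> R. \<alpha> < \<sigma> x \<and> \<sigma> x < \<beta>}"
  let ?c = "\<lambda>n x. cutoff (real n * (\<sigma> x - \<alpha>) - 1) * cutoff (real n * (\<beta> - \<sigma> x) - 1) *
      (cutoff (real n * (\<tau> x) - 1) * cutoff (real n * (1 - \<tau> x) - 1))"
  have "open ?S"
  proof -
    have "?S = R \<inter> {x. \<alpha> < \<sigma> x} \<inter> {x. \<sigma> x < \<beta>}" by auto
    then show ?thesis
      by (auto intro!: open_Int open_Collect_less continuous_on_coord continuous_on_const open_R)
  qed
  have bdd: "bounded ?S"
    by (rule bounded_subset[OF bounded_coords]) (use R_subset_coords in auto)
  have "exhausting_cutoffs ?S (\<lambda>n x. complex_of_real (?c n x))"
  proof
    show "?S \<in> fmeasurable lebesgue"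
      using bdd \<open>open ?S\<close> by (rule lmeasurable_open)
    show "cmod (complex_of_real (?c n x)) \<le> 1" for n x
      unfolding norm_of_real
      by (subst abs_of_nonneg) (intro mult_nonneg_nonneg mult_le_one cutoff_nonneg cutoff_le_1)+
    have lim: "(if 0 < \<sigma> x - \<alpha> then 1 else 0) * (if 0 < \<beta> - \<sigma> x then 1 else 0) *
        ((if 0 < \<tau> x then 1 else 0) * (if 0 < 1 - \<tau> x then 1 else 0)) = (indicator ?S x :: real)" for x
      using assms by (auto simp: indicator_def mem_R_iff)
    have "(\<lambda>n. ?c n x) \<longlonglongrightarrow> indicator ?S x" for x
      unfolding lim[symmetric] by (intro tendsto_mult cutoff_scaled_LIMSEQ) simp_all
    then show "(\<lambda>n. complex_of_real (?c n x)) \<longlonglongrightarrow> indicator ?S x" for x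
      using tendsto_of_real[of "\<lambda>n. ?c n x" "indicator ?S x" sequentially, where 'a = complex]
      by (simp only: of_real_indicator)
    show "test_function ?S (\<lambda>x. complex_of_real (?c n x))" for n
    proof (rule test_functionI)
      have aff: "smooth (\<lambda>s. cutoff (k * s + c))" for k c
        by (rule smooth_compose_affine[OF bounded_linear_mult_right smooth_cutoff])
      have "smooth (\<lambda>x. ?c n x)"
        using smooth_mult[OF smooth_mult[OF smooth_compose_coord[OF aff[of n "- n * \<alpha> - 1"]]
              smooth_compose_coord[OF aff[of "- n" "n * \<beta> - 1"]]]
            smooth_mult[OF smooth_compose_coord[OF aff[of n "- 1"]]
              smooth_compose_coord[OF aff[of "- n" "real n - 1"]]], of p a p a p b p b]
        by (simp add: algebra_simps)
      then show "smooth (\<lambda>x. complex_of_real (?c n x))"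
        by (rule smooth_bounded_linear[OF bounded_linear_of_real])
      let ?K = "{x. 1 \<le> real n * (\<sigma> x - \<alpha>)} \<inter> {x. 1 \<le> real n * (\<beta> - \<sigma> x)} \<inter>
          {x. 1 \<le> real n * \<tau> x} \<inter> {x. 1 \<le> real n * (1 - \<tau> x)}"
      have pos: "1 \<le> real n * z \<Longrightarrow> 0 < z" for z
        by (smt (verit) mult_nonneg_nonpos of_nat_0_le_iff)
      show KS: "?K \<subseteq> ?S"
        using assms by (auto simp: mem_R_iff dest!: pos)
      show "compact ?K"
        unfolding compact_eq_bounded_closed
      proof
        show "bounded ?K" using bdd KS by (rule bounded_subset)
        show "closed ?K"
          by (intro closed_Int closed_Collect_le continuous_intros continuous_on_coord)
      qed
      show "complex_of_real (?c n x) = 0" if "x \<notin> ?K" for x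
        using that by (auto simp: cutoff_eq)
    qed
  qed
  then show ?thesis by blast
qed

lemma parallel_sidesI:
  "0 \<le> \<sigma> x \<Longrightarrow> \<sigma> x \<le> 1 \<Longrightarrow> \<tau> x = 0 \<or> \<tau> x = 1 \<Longrightarrow> x \<in> parallel_sides p a b"
  "0 \<le> \<tau> x \<Longrightarrow> \<tau> x \<le> 1 \<Longrightarrow> \<sigma> x = 0 \<or> \<sigma> x = 1 \<Longrightarrow> x \<in> parallel_sides p b a"
proof -
  have eq: "x = p + \<sigma> x *\<^sub>R a + \<tau> x *\<^sub>R b" by (rule decomposition)
  have seg: "w = y + c *\<^sub>R v \<Longrightarrow> 0 \<le> c \<Longrightarrow> c \<le> 1 \<Longrightarrow> w \<in> closed_segment y (y + v)" for w y v :: plane and c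
    unfolding in_segment by (auto intro!: exI[of _ c] simp: algebra_simps)
  show "x \<in> parallel_sides p a b" if "0 \<le> \<sigma> x" "\<sigma> x \<le> 1" "\<tau> x = 0 \<or> \<tau> x = 1"
    using that(3) seg[of x p "\<sigma> x" a, OF _ that(1,2)] seg[of x "p + b" "\<sigma> x" a, OF _ that(1,2)] eq
    unfolding parallel_sides_def by (auto simp: add.assoc add.commute)
  show "x \<in> parallel_sides p b a" if "0 \<le> \<tau> x" "\<tau> x \<le> 1" "\<sigma> x = 0 \<or> \<sigma> x = 1"
    using that(3) seg[of x p "\<tau> x" b, OF _ that(1,2)] seg[of x "p + a" "\<tau> x" b, OF _ that(1,2)] eq
    unfolding parallel_sides_def by (auto simp: add.assoc add.commute)
qed

text \<open>A test function on \<open>\<Omega>\<close> vanishes near the sides of the rectangle which lie on the boundary,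
  so it stays smooth when it is cut off sharply there.\<close>

lemma test_function_cutoff:
  assumes \<theta>: "test_function \<Omega> \<theta>" and \<Omega>: "parallel_sides p a b \<inter> \<Omega> = {}"
    and \<phi>: "smooth \<phi>" "\<And>s. s < \<alpha> \<or> \<beta> < s \<Longrightarrow> \<phi> s = 0" and "0 < \<alpha>" "\<beta> < 1"
  shows "test_function (strip \<alpha> \<beta>) (\<lambda>x. if x \<in> R then \<phi> (\<sigma> x) *\<^sub>R \<theta> x else 0)"
proof -
  let ?f = "\<lambda>x. if x \<in> R then \<phi> (\<sigma> x) *\<^sub>R \<theta> x else 0"
  obtain K where K: "smooth \<theta>" "compact K" "K \<subseteq> \<Omega>" "\<And>x. x \<notin> K \<Longrightarrow> \<theta> x = 0"
    using \<theta> test_functionE by blast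
  \<comment> \<open>The closed conditions on \<tau> make \<open>K'\<close> compact. Points where
    \<tau> is 0 or 1 would lie on the sides missed by \<Omega>, so \<open>K'\<close> nevertheless
    sits in the open rectangle.\<close>
  define K' where "K' = K \<inter> ({x. \<alpha> \<le> \<sigma> x} \<inter> {x. \<sigma> x \<le> \<beta>} \<inter> {x. 0 \<le> \<tau> x} \<inter> {x. \<tau> x \<le> 1})"
  have "closed ({x. \<alpha> \<le> \<sigma> x} \<inter> {x. \<sigma> x \<le> \<beta>} \<inter> {x. 0 \<le> \<tau> x} \<inter> {x. \<tau> x \<le> 1})"
    by (intro closed_Int closed_Collect_le continuous_intros continuous_on_coord)
  then have "compact K'"
    unfolding K'_def by (rule compact_Int_closed[OF K(2)])
  have K'_sub: "K' \<subseteq> strip \<alpha> \<beta>"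
  proof
    fix x assume x: "x \<in> K'"
    then have "x \<notin> parallel_sides p a b"
      using K(3) \<Omega> by (auto simp: K'_def)
    then have "\<tau> x \<noteq> 0" "\<tau> x \<noteq> 1"
      using parallel_sidesI(1)[of x] x \<open>0 < \<alpha>\<close> \<open>\<beta> < 1\<close> by (auto simp: K'_def)
    then show "x \<in> strip \<alpha> \<beta>"
      using x \<open>0 < \<alpha>\<close> \<open>\<beta> < 1\<close> by (auto simp: K'_def strip_def mem_R_iff)
  qed
  have zero: "?f x = 0" if "x \<notin> K'" for x
  proof (cases "x \<in> R \<and> x \<in> K")
    case True
    then have "\<sigma> x < \<alpha> \<or> \<beta> < \<sigma> x"
      using that by (auto simp: K'_def mem_R_iff)
    then show ?thesis by (simp add: \<phi>(2))
  qed (use K(4) in auto)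
  have "smooth ?f"
  proof (rule smooth_local)
    fix x
    show "\<exists>g S. open S \<and> x \<in> S \<and> smooth g \<and> (\<forall>y\<in>S. ?f y = g y)"
    proof (cases "x \<in> R")
      case True
      then show ?thesis
        using open_R smooth_scaleR[OF smooth_compose_coord[OF \<phi>(1)] K(1)]
        by (intro exI[of _ "\<lambda>x. \<phi> (\<sigma> x) *\<^sub>R \<theta> x"] exI[of _ R]) auto
    next
      case False
      then have "x \<in> - K'" using K'_sub by (auto simp: strip_def)
      moreover have "open (- K')"
        using \<open>compact K'\<close> by (simp add: compact_imp_closed open_Compl)
      ultimately show ?thesis
        using zero smooth_const by (intro exI[of _ "\<lambda>x. 0"] exI[of _ "- K'"]) auto
    qed
  qed
  then show ?thesis
    using \<open>compact K'\<close> K'_sub zero by (rule test_functionI)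
qed

lemma frechet_derivative_coord_mult:
  assumes \<phi>: "\<And>s. (\<phi> has_real_derivative \<phi>' s) (at s)" and \<theta>: "smooth \<theta>"
  shows "((\<lambda>x. \<phi> (coord p a x + c) *\<^sub>R \<theta> (x + w)) has_derivative
    (\<lambda>e. \<phi> (coord p a x + c) *\<^sub>R frechet_derivative \<theta> (at (x + w)) e
       + (\<phi>' (coord p a x + c) * ((e \<bullet> a) / (a \<bullet> a))) *\<^sub>R \<theta> (x + w))) (at x)"
proof -
  have "((\<lambda>x. \<phi> (coord p a x + c)) has_derivative
      (\<lambda>e. \<phi>' (coord p a x + c) * ((e \<bullet> a) / (a \<bullet> a)))) (at x)"
    using has_derivative_compose[OF has_derivative_add[OF coord_has_derivative has_derivative_const]
        \<phi>[THEN has_field_derivative_imp_has_derivative]] by simp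
  moreover have "((\<lambda>x. \<theta> (x + w)) has_derivative frechet_derivative \<theta> (at (x + w))) (at x)"
    using has_derivative_compose[OF has_derivative_add[OF has_derivative_ident has_derivative_const]
        smooth_has_derivative[OF \<theta>]] by simp
  ultimately show ?thesis
    by (rule has_derivative_scaleR)
qed

end

section \<open>Cutoffs and translates in the form domain\<close>

text \<open>The derivative is part of the data because it is what the application prescribes: it
  becomes the weight of the correlation. Smoothness is demanded of the derivative, and that of the
  function follows.\<close>

definition profile :: "(real \<Rightarrow> real) \<Rightarrow> (real \<Rightarrow> real) \<Rightarrow> real \<Rightarrow> real \<Rightarrow> bool" where
  "profile \<phi> \<phi>' \<alpha> \<beta> \<longleftrightarrow> (\<forall>s. (\<phi> has_real_derivative \<phi>' s) (at s)) \<and> smooth \<phi>' \<and>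
     (\<forall>s. s < \<alpha> \<or> \<beta> < s \<longrightarrow> \<phi> s = 0)"

lemma profile_DERIV: "profile \<phi> \<phi>' \<alpha> \<beta> \<Longrightarrow> (\<phi> has_real_derivative \<phi>' s) (at s)"
  and profile_eq_0: "profile \<phi> \<phi>' \<alpha> \<beta> \<Longrightarrow> s < \<alpha> \<or> \<beta> < s \<Longrightarrow> \<phi> s = 0"
  and profile_smooth': "profile \<phi> \<phi>' \<alpha> \<beta> \<Longrightarrow> smooth \<phi>'"
  by (auto simp: profile_def)

lemma profile_smooth: "profile \<phi> \<phi>' \<alpha> \<beta> \<Longrightarrow> smooth \<phi>"
  using smooth_antiderivative[of \<phi> \<phi>']
  by (auto simp: profile_def has_real_derivative_iff_has_vector_derivative)

text \<open>The strict inequalities describe an open set on which the function vanishes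
  identically.\<close>

lemma profile_derivative_eq_0:
  assumes "profile \<phi> \<phi>' \<alpha> \<beta>" "s < \<alpha> \<or> \<beta> < s"
  shows "\<phi>' s = 0"
proof -
  have "((\<lambda>s. 0) has_real_derivative 0) (at s)" by simp
  then have "(\<phi> has_real_derivative 0) (at s)"
    by (rule has_field_derivative_transform_within_open[of _ _ _ "{..<\<alpha>} \<union> {\<beta><..}"])
      (use assms(2) profile_eq_0[OF assms(1)] in auto)
  then show ?thesis
    using DERIV_unique profile_DERIV[OF assms(1)] by blast
qed

lemma continuous_compact_support_bounded:
  fixes f :: "real \<Rightarrow> real"
  assumes "continuous_on UNIV f" "\<And>s. s < \<alpha> \<or> \<beta> < s \<Longrightarrow> f s = 0"
  shows "\<exists>B. \<forall>s. \<bar>f s\<bar> \<le> B"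
proof -
  have "bounded (f ` {\<alpha>..\<beta>})"
    by (intro compact_imp_bounded compact_continuous_image continuous_on_subset[OF assms(1)]) auto
  then obtain B where B: "\<And>s. s \<in> {\<alpha>..\<beta>} \<Longrightarrow> \<bar>f s\<bar> \<le> B"
    unfolding bounded_iff by (metis imageI real_norm_def)
  have "\<bar>f s\<bar> \<le> max B 0" for s
    using B[of s] assms(2)[of s] by (cases "s \<in> {\<alpha>..\<beta>}") auto
  then show ?thesis by blast
qed

lemma profile_bounded:
  assumes "profile \<phi> \<phi>' \<alpha> \<beta>"
  obtains B where "\<And>s. \<bar>\<phi> s\<bar> \<le> B" "\<And>s. \<bar>\<phi>' s\<bar> \<le> B"
proof -
  obtain B B' where "\<And>s. \<bar>\<phi> s\<bar> \<le> B" "\<And>s. \<bar>\<phi>' s\<bar> \<le> B'"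
    using continuous_compact_support_bounded[OF smooth_continuous[OF profile_smooth[OF assms]] profile_eq_0[OF assms]]
      continuous_compact_support_bounded[OF smooth_continuous[OF profile_smooth'[OF assms]] profile_derivative_eq_0[OF assms]]
    by blast
  then show ?thesis
    using that[of "max B B'"] by (simp add: max.coboundedI1 max.coboundedI2)
qed

lemma profile_shift:
  assumes "profile \<phi> \<phi>' \<alpha> \<beta>"
  shows "profile (\<lambda>s. \<phi> (s - d)) (\<lambda>s. \<phi>' (s - d)) (\<alpha> + d) (\<beta> + d)"
  unfolding profile_def
proof (intro conjI allI impI)
  show "((\<lambda>s. \<phi> (s - d)) has_real_derivative \<phi>' (s - d)) (at s)" for s
    using DERIV_shift[of \<phi> "\<phi>' (s - d)" s "- d"] profile_DERIV[OF assms, of "s - d"] by simp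
  show "smooth (\<lambda>s. \<phi>' (s - d))"
    using smooth_compose_affine[OF bounded_linear_ident profile_smooth'[OF assms], of "- d"] by simp
  show "\<phi> (s - d) = 0" if "s < \<alpha> + d \<or> \<beta> + d < s" for s
    using profile_eq_0[OF assms, of "s - d"] that by auto
qed

lemma square_integrable_scaleR_bounded:
  fixes f :: "plane \<Rightarrow> complex"
  assumes "square_integrable lebesgue f" "continuous_on UNIV m" "\<And>x. \<bar>m x\<bar> \<le> B"
  shows "square_integrable lebesgue (\<lambda>x. m x *\<^sub>R f x)"
    and "(LINT x|lebesgue. (cmod (m x *\<^sub>R f x))\<^sup>2) \<le> B\<^sup>2 * (LINT x|lebesgue. (cmod (f x))\<^sup>2)"
proof -
  have "(\<lambda>x. complex_of_real (m x)) \<in> borel_measurable lebesgue"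
    by (rule measurable_completion)
      (simp add: borel_measurable_continuous_onI[OF continuous_on_of_real[OF assms(2)]])
  then show "square_integrable lebesgue (\<lambda>x. m x *\<^sub>R f x)"
    "(LINT x|lebesgue. (cmod (m x *\<^sub>R f x))\<^sup>2) \<le> B\<^sup>2 * (LINT x|lebesgue. (cmod (f x))\<^sup>2)"
    using square_integrable_mult_bounded[OF assms(1), of "\<lambda>x. of_real (m x)" B]
      integral_mult_bounded_power2_le[OF assms(1), of "\<lambda>x. of_real (m x)" B] assms(3)
    by (simp_all add: scaleR_conv_of_real)
qed

lemma square_integrable_lebesgue_on:
  assumes "square_integrable lebesgue f" "S \<in> sets lebesgue"
  shows "square_integrable (lebesgue_on S) f"
  using square_integrable_restrict[of UNIV f S] assms
    square_integrable_lebesgue_on_iff[of S f "\<lambda>x. if x \<in> S then f x else 0"]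
  by (simp add: lebesgue_on_UNIV_eq)

text \<open>For an open \<Omega> that contains the rectangle, the sides parallel to \<open>a\<close>
  lie on the frontier exactly if they miss \<Omega>; the latter is the form in which the condition
  is used.\<close>

locale rectangular_part = rectangular_frame +
  fixes \<Omega> :: "plane set"
  assumes open_\<Omega>: "open \<Omega>" and R_subset: "rectangle p a b \<subseteq> \<Omega>"
    and sides_disjoint: "parallel_sides p a b \<inter> \<Omega> = {}"
begin

lemma \<Omega>_sets: "\<Omega> \<in> sets lebesgue"
  using open_\<Omega> by (simp add: borel_open)

text \<open>Makes translates total functions on the plane. A translate leaving the rectangle takes
  the value 0, not a value of \<open>f\<close> elsewhere in \<Omega>.\<close>

definition ext :: "(plane \<Rightarrow> complex) \<Rightarrow> plane \<Rightarrow> complex" where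
  "ext f x = (if x \<in> R then f x else 0)"

text \<open>The weight is evaluated at the original point and \<open>f\<close> at the translated
  one. Because of this order the adjoint has a shifted weight.\<close>

definition shift_cutoff :: "(real \<Rightarrow> real) \<Rightarrow> real \<Rightarrow> (plane \<Rightarrow> complex) \<Rightarrow> plane \<Rightarrow> complex" where
  "shift_cutoff \<phi> d f x = \<phi> (\<sigma> x) *\<^sub>R ext f (x + d *\<^sub>R a)"

text \<open>The cutoff and its translate both stay away from the sides \<open>\<sigma> = 0\<close> and \<open>\<sigma> = 1\<close>.\<close>

definition admissible :: "real \<Rightarrow> real \<Rightarrow> real \<Rightarrow> bool" where
  "admissible \<alpha> \<beta> d \<longleftrightarrow> 0 < \<alpha> \<and> \<beta> < 1 \<and> 0 < \<alpha> + d \<and> \<beta> + d < 1"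

lemma admissible_uminus: "admissible \<alpha> \<beta> d \<Longrightarrow> admissible (\<alpha> + d) (\<beta> + d) (- d)"
  by (auto simp: admissible_def)

lemma admissible_mem_R:
  "admissible \<alpha> \<beta> d \<Longrightarrow> \<alpha> \<le> \<sigma> x \<Longrightarrow> \<sigma> x \<le> \<beta> \<Longrightarrow> x + d *\<^sub>R a \<in> R \<longleftrightarrow> x \<in> R"
  by (auto simp: admissible_def mem_R_iff)

text \<open>Where the weight is nonzero, translation keeps \<sigma> inside the open unit interval,
  and it never changes \<tau>. So \<open>x\<close> and its translate lie in the rectangle
  together.\<close>

lemma shift_cutoff_eq_0:
  assumes "admissible \<alpha> \<beta> d" "\<And>s. s < \<alpha> \<or> \<beta> < s \<Longrightarrow> \<phi> s = 0" "x \<notin> R"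
  shows "shift_cutoff \<phi> d f x = 0"
  using admissible_mem_R[OF assms(1), of x] assms(2)[of "\<sigma> x"] assms(3)
  by (cases "\<alpha> \<le> \<sigma> x \<and> \<sigma> x \<le> \<beta>") (auto simp: shift_cutoff_def ext_def)

lemma shift_cutoff_eq:
  assumes "admissible \<alpha> \<beta> d" "\<And>s. s < \<alpha> \<or> \<beta> < s \<Longrightarrow> \<phi> s = 0" "x \<in> R"
  shows "shift_cutoff \<phi> d f x = \<phi> (\<sigma> x) *\<^sub>R f (x + d *\<^sub>R a)"
  using admissible_mem_R[OF assms(1), of x] assms(2)[of "\<sigma> x"] assms(3)
  by (cases "\<alpha> \<le> \<sigma> x \<and> \<sigma> x \<le> \<beta>") (auto simp: shift_cutoff_def ext_def)

lemma ext_square_integrable: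
  assumes "square_integrable (lebesgue_on \<Omega>) f"
  shows "square_integrable lebesgue (ext f)"
  unfolding ext_def[abs_def]
  by (rule square_integrable_restrict[OF assms R_subset \<Omega>_sets R_sets])

lemma integral_ext_power2_le:
  assumes "square_integrable (lebesgue_on \<Omega>) f"
  shows "(LINT x|lebesgue. (cmod (ext f x))\<^sup>2) \<le> (LINT x|lebesgue_on \<Omega>. (cmod (f x))\<^sup>2)"
proof -
  let ?g = "\<lambda>x. if x \<in> \<Omega> then f x else 0"
  have g: "square_integrable lebesgue ?g"
    by (rule square_integrable_restrict[OF assms subset_refl \<Omega>_sets \<Omega>_sets])
  have "(LINT x|lebesgue. (cmod (ext f x))\<^sup>2) \<le> (LINT x|lebesgue. (cmod (?g x))\<^sup>2)"
    using ext_square_integrable[OF assms] g R_subset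
    by (intro integral_mono) (auto simp: square_integrable_def ext_def)
  also have "\<dots> = (LINT x|lebesgue_on \<Omega>. (cmod (f x))\<^sup>2)"
    using \<Omega>_sets by (intro integral_lebesgue_on_eq[symmetric]) auto
  finally show ?thesis .
qed

lemma shift_cutoff_square_integrable:
  assumes f: "square_integrable (lebesgue_on \<Omega>) f" and \<phi>: "smooth \<phi>" "\<And>s. \<bar>\<phi> s\<bar> \<le> B"
  shows "square_integrable lebesgue (shift_cutoff \<phi> d f)"
    and "(LINT x|lebesgue. (cmod (shift_cutoff \<phi> d f x))\<^sup>2) \<le> B\<^sup>2 * (LINT x|lebesgue_on \<Omega>. (cmod (f x))\<^sup>2)"
proof -
  have sq: "square_integrable lebesgue (\<lambda>x. ext f (x + d *\<^sub>R a))"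
    by (rule square_integrable_translation[OF ext_square_integrable[OF f]])
  have cont: "continuous_on UNIV (\<lambda>x. \<phi> (\<sigma> x))"
    using smooth_continuous[OF smooth_compose_coord[OF \<phi>(1)]] .
  show "square_integrable lebesgue (shift_cutoff \<phi> d f)"
    unfolding shift_cutoff_def[abs_def]
    by (rule square_integrable_scaleR_bounded(1)[OF sq cont \<phi>(2)])
  have "(LINT x|lebesgue. (cmod (shift_cutoff \<phi> d f x))\<^sup>2)
      \<le> B\<^sup>2 * (LINT x|lebesgue. (cmod (ext f (x + d *\<^sub>R a)))\<^sup>2)"
    unfolding shift_cutoff_def
    by (rule square_integrable_scaleR_bounded(2)[OF sq cont \<phi>(2)])
  also have "(LINT x|lebesgue. (cmod (ext f (x + d *\<^sub>R a)))\<^sup>2) = (LINT x|lebesgue. (cmod (ext f x))\<^sup>2)"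
    using ext_square_integrable[OF f]
    by (intro integral_lebesgue_translation[of "\<lambda>x. (cmod (ext f x))\<^sup>2"])
      (auto simp: square_integrable_def)
  also have "B\<^sup>2 * \<dots> \<le> B\<^sup>2 * (LINT x|lebesgue_on \<Omega>. (cmod (f x))\<^sup>2)"
    by (intro mult_left_mono integral_ext_power2_le f) simp
  finally show "(LINT x|lebesgue. (cmod (shift_cutoff \<phi> d f x))\<^sup>2) \<le> B\<^sup>2 * (LINT x|lebesgue_on \<Omega>. (cmod (f x))\<^sup>2)" .
qed

text \<open>The adjoint of a cutoff translation is again one, translating backwards with the weight
  moved along; this is a change of variables by \<open>d *\<^sub>R a\<close>. Both
  \<open>\<phi>\<close> and \<open>\<phi>'\<close> are covered because the product rule for the
  gradient produces one term with each.\<close>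

lemma integral_shift_cutoff:
  assumes adm: "admissible \<alpha> \<beta> d" and \<phi>: "profile \<phi> \<phi>' \<alpha> \<beta>" and \<psi>: "\<psi> = \<phi> \<or> \<psi> = \<phi>'"
    and f: "square_integrable (lebesgue_on \<Omega>) f" and h: "square_integrable (lebesgue_on \<Omega>) h"
  shows "(LINT x|lebesgue_on \<Omega>. f x * shift_cutoff (\<lambda>s. \<psi> (s - d)) (- d) h x)
    = (LINT x|lebesgue_on \<Omega>. shift_cutoff \<psi> d f x * h x)"
proof -
  have zero: "\<psi> s = 0" if "s < \<alpha> \<or> \<beta> < s" for s
    using that \<psi> profile_eq_0[OF \<phi>] profile_derivative_eq_0[OF \<phi>] by auto
  have sm: "smooth \<psi>"
    using \<psi> profile_smooth[OF \<phi>] profile_smooth'[OF \<phi>] by auto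
  obtain B where B: "\<And>s. \<bar>\<psi> s\<bar> \<le> B"
    using profile_bounded[OF \<phi>] \<psi> by metis
  let ?g = "\<lambda>x. shift_cutoff \<psi> d f x * ext h x"
  have "integrable lebesgue ?g"
    by (intro integrable_mult_square_integrable shift_cutoff_square_integrable(1)[OF f sm B]
        ext_square_integrable[OF h])
  then have meas: "?g \<in> borel_measurable lebesgue" by simp
  have "(LINT x|lebesgue_on \<Omega>. f x * shift_cutoff (\<lambda>s. \<psi> (s - d)) (- d) h x)
      = (LINT x|lebesgue. ?g (x + (- d) *\<^sub>R a))"
  proof (rule integral_lebesgue_on_eq[OF \<Omega>_sets])
    fix x
    have "f x * shift_cutoff (\<lambda>s. \<psi> (s - d)) (- d) h x = ?g (x + (- d) *\<^sub>R a)" if "x \<in> R"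
      using that by (simp add: shift_cutoff_def ext_def)
    moreover have "shift_cutoff (\<lambda>s. \<psi> (s - d)) (- d) h x = 0" if "x \<notin> R"
      using zero by (intro shift_cutoff_eq_0[OF admissible_uminus[OF adm]] that) auto
    moreover have 0: "?g (x + (- d) *\<^sub>R a) = 0" if "x \<notin> R"
      using that by (simp add: shift_cutoff_def ext_def)
    ultimately show "f x * shift_cutoff (\<lambda>s. \<psi> (s - d)) (- d) h x = ?g (x + (- d) *\<^sub>R a)"
      by (cases "x \<in> R") auto
    show "?g (x + (- d) *\<^sub>R a) = 0" if "x \<notin> \<Omega>"
      using 0 that R_subset by blast
  qed
  also have "\<dots> = (LINT x|lebesgue. ?g x)"
    by (rule integral_lebesgue_translation[OF meas])
  also have "\<dots> = (LINT x|lebesgue_on \<Omega>. shift_cutoff \<psi> d f x * h x)"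
  proof (rule integral_lebesgue_on_eq[symmetric, OF \<Omega>_sets])
    fix x
    have "shift_cutoff \<psi> d f x = 0" if "x \<notin> R"
      by (rule shift_cutoff_eq_0[OF adm zero that])
    then show "shift_cutoff \<psi> d f x * h x = ?g x"
      by (cases "x \<in> R") (auto simp: ext_def)
    show "?g x = 0" if "x \<notin> \<Omega>"
      using that R_subset by (auto simp: ext_def)
  qed
  finally show ?thesis .
qed

text \<open>Cutting off at the target position first and translating back afterwards reduces
  smoothness to the untranslated case, where \<theta> vanishes near the sides on the boundary. The
  derivative is the product rule inside the rectangle and 0 outside.\<close>

lemma test_function_shift_cutoff:
  assumes adm: "admissible \<alpha> \<beta> d" and \<phi>: "profile \<phi> \<phi>' \<alpha> \<beta>" and \<theta>: "test_function \<Omega> \<theta>"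
  shows "test_function (strip \<alpha> \<beta>) (shift_cutoff \<phi> d \<theta>)"
    and "frechet_derivative (shift_cutoff \<phi> d \<theta>) (at x) e
      = shift_cutoff \<phi> d (\<lambda>y. frechet_derivative \<theta> (at y) e) x + ((e \<bullet> a) / (a \<bullet> a)) *\<^sub>R shift_cutoff \<phi>' d \<theta> x"
proof -
  note \<phi>d = profile_shift[OF \<phi>, of d]
  have "test_function (strip (\<alpha> + d) (\<beta> + d)) (\<lambda>x. if x \<in> R then \<phi> (\<sigma> x - d) *\<^sub>R \<theta> x else 0)"
    using adm by (intro test_function_cutoff[OF \<theta> sides_disjoint profile_smooth[OF \<phi>d] profile_eq_0[OF \<phi>d]])
      (auto simp: admissible_def)
  then have "test_function (strip \<alpha> \<beta>)
      (\<lambda>x. if x + d *\<^sub>R a \<in> R then \<phi> (\<sigma> (x + d *\<^sub>R a) - d) *\<^sub>R \<theta> (x + d *\<^sub>R a) else 0)"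
    using adm by (elim test_function_translation) (auto simp: strip_def mem_R_iff admissible_def)
  moreover have "(\<lambda>x. if x + d *\<^sub>R a \<in> R then \<phi> (\<sigma> (x + d *\<^sub>R a) - d) *\<^sub>R \<theta> (x + d *\<^sub>R a) else 0) = shift_cutoff \<phi> d \<theta>"
    by (auto simp: shift_cutoff_def ext_def fun_eq_iff)
  ultimately show test: "test_function (strip \<alpha> \<beta>) (shift_cutoff \<phi> d \<theta>)" by simp
  show "frechet_derivative (shift_cutoff \<phi> d \<theta>) (at x) e
      = shift_cutoff \<phi> d (\<lambda>y. frechet_derivative \<theta> (at y) e) x + ((e \<bullet> a) / (a \<bullet> a)) *\<^sub>R shift_cutoff \<phi>' d \<theta> x"
  proof (cases "x \<in> R")
    case True
    have "((\<lambda>x. \<phi> (\<sigma> x + 0) *\<^sub>R \<theta> (x + d *\<^sub>R a)) has_derivative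
        (\<lambda>e. \<phi> (\<sigma> x + 0) *\<^sub>R frechet_derivative \<theta> (at (x + d *\<^sub>R a)) e
           + (\<phi>' (\<sigma> x + 0) * ((e \<bullet> a) / (a \<bullet> a))) *\<^sub>R \<theta> (x + d *\<^sub>R a))) (at x)"
      by (rule frechet_derivative_coord_mult[OF profile_DERIV[OF \<phi>] test_function_smooth[OF \<theta>]])
    then have "(shift_cutoff \<phi> d \<theta> has_derivative
        (\<lambda>e. \<phi> (\<sigma> x + 0) *\<^sub>R frechet_derivative \<theta> (at (x + d *\<^sub>R a)) e
           + (\<phi>' (\<sigma> x + 0) * ((e \<bullet> a) / (a \<bullet> a))) *\<^sub>R \<theta> (x + d *\<^sub>R a))) (at x)"
      by (rule has_derivative_transform_within_open[OF _ open_R True])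
        (simp add: shift_cutoff_eq[OF adm profile_eq_0[OF \<phi>]])
    then show ?thesis
      using True by (simp add: frechet_derivative_at[symmetric] shift_cutoff_eq[OF adm profile_eq_0[OF \<phi>]]
          shift_cutoff_eq[OF adm profile_derivative_eq_0[OF \<phi>]] mult.commute)
  next
    case False
    then have "x \<notin> strip \<alpha> \<beta>" using strip_subset_R by blast
    then have "frechet_derivative (shift_cutoff \<phi> d \<theta>) (at x) e = 0"
      by (rule test_function_eq_0[OF test_function_frechet_derivative[OF test]])
    then show ?thesis
      using False by (simp add: shift_cutoff_eq_0[OF adm profile_eq_0[OF \<phi>]]
          shift_cutoff_eq_0[OF adm profile_derivative_eq_0[OF \<phi>]])
  qed
qed

text \<open>The gradient predicted by the product rule:
  \<open>(e \<bullet> a) / (a \<bullet> a)\<close> is the derivative of \<sigma> in direction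
  \<open>e\<close>.\<close>

definition shift_cutoff_gradient ::
    "(real \<Rightarrow> real) \<Rightarrow> (real \<Rightarrow> real) \<Rightarrow> real \<Rightarrow> (plane \<Rightarrow> complex) \<Rightarrow> (plane \<Rightarrow> plane \<Rightarrow> complex)
      \<Rightarrow> plane \<Rightarrow> plane \<Rightarrow> complex" where
  "shift_cutoff_gradient \<phi> \<phi>' d u G e x =
     shift_cutoff \<phi> d (G e) x + ((e \<bullet> a) / (a \<bullet> a)) *\<^sub>R shift_cutoff \<phi>' d u x"

text \<open>Duality moves the operation onto the test function, which stays a test function on
  \<Omega> because it vanishes near the sides on the boundary. Thus \<open>u\<close> itself may be
  nonzero along these sides, as the Neumann case requires.\<close>

lemma H1_shift_cutoff:
  assumes adm: "admissible \<alpha> \<beta> d" and \<phi>: "profile \<phi> \<phi>' \<alpha> \<beta>" and u: "H1 \<Omega> u G"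
  shows "H1 \<Omega> (shift_cutoff \<phi> d u) (shift_cutoff_gradient \<phi> \<phi>' d u G)"
proof -
  obtain B where B: "\<And>s. \<bar>\<phi> s\<bar> \<le> B" "\<And>s. \<bar>\<phi>' s\<bar> \<le> B"
    using profile_bounded[OF \<phi>] by metis
  note sm = profile_smooth[OF \<phi>] profile_smooth'[OF \<phi>]
  note \<phi>d = profile_shift[OF \<phi>, of d]
  have Bd: "\<bar>\<phi> (s - d)\<bar> \<le> B" "\<bar>\<phi>' (s - d)\<bar> \<le> B" for s using B by auto
  note smd = profile_smooth[OF \<phi>d] profile_smooth'[OF \<phi>d]
  have squ: "square_integrable (lebesgue_on \<Omega>) u"
    using u by (simp add: H1_def L2_eq_square_integrable)
  note sqv = square_integrable_lebesgue_on[OF shift_cutoff_square_integrable(1) \<Omega>_sets]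
  have "L2 \<Omega> (shift_cutoff \<phi> d u)"
    unfolding L2_eq_square_integrable by (rule sqv[OF squ sm(1) B(1)])
  moreover have "L2 \<Omega> (shift_cutoff_gradient \<phi> \<phi>' d u G e) \<and>
      weak_partial \<Omega> e (shift_cutoff \<phi> d u) (shift_cutoff_gradient \<phi> \<phi>' d u G e)" if "e \<in> Basis" for e
  proof
    have sqG: "square_integrable (lebesgue_on \<Omega>) (G e)" and weak: "weak_partial \<Omega> e u (G e)"
      using u that by (auto simp: H1_def L2_eq_square_integrable)
    define c where "c = complex_of_real ((e \<bullet> a) / (a \<bullet> a))"
    have grad: "shift_cutoff_gradient \<phi> \<phi>' d u G e = (\<lambda>x. shift_cutoff \<phi> d (G e) x + c * shift_cutoff \<phi>' d u x)"
      by (simp add: shift_cutoff_gradient_def fun_eq_iff c_def scaleR_conv_of_real)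
    show "L2 \<Omega> (shift_cutoff_gradient \<phi> \<phi>' d u G e)"
      unfolding L2_eq_square_integrable grad
      by (intro square_integrable_add square_integrable_cmult sqv[OF sqG sm(1) B(1)] sqv[OF squ sm(2) B(2)])
    show "weak_partial \<Omega> e (shift_cutoff \<phi> d u) (shift_cutoff_gradient \<phi> \<phi>' d u G e)"
      unfolding weak_partial_def
    proof (intro allI impI)
      fix \<theta> assume \<theta>: "test_function \<Omega> \<theta>"
      define \<theta>' where "\<theta>' = (\<lambda>x. frechet_derivative \<theta> (at x) e)"
      have sq\<theta>: "square_integrable (lebesgue_on \<Omega>) \<theta>" "square_integrable (lebesgue_on \<Omega>) \<theta>'"
        unfolding \<theta>'_def
        by (intro square_integrable_lebesgue_on \<Omega>_sets test_function_square_integrable[of \<Omega>]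
            test_function_frechet_derivative \<theta>)+
      \<comment> \<open>The image of \<theta> under the adjoint operation; the weak derivative of
        \<open>u\<close> is tested with it.\<close>
      let ?q = "shift_cutoff (\<lambda>s. \<phi> (s - d)) (- d) \<theta>"
      have q: "test_function (strip (\<alpha> + d) (\<beta> + d)) ?q"
        and q': "frechet_derivative ?q (at x) e = shift_cutoff (\<lambda>s. \<phi> (s - d)) (- d) \<theta>' x
          + c * shift_cutoff (\<lambda>s. \<phi>' (s - d)) (- d) \<theta> x" for x
        using test_function_shift_cutoff[OF admissible_uminus[OF adm] \<phi>d \<theta>]
        by (simp_all add: \<theta>'_def c_def scaleR_conv_of_real)
      have "test_function \<Omega> ?q"
        using q by (rule test_function_mono) (use strip_subset_R R_subset in blast)
      then have "(LINT x|lebesgue_on \<Omega>. u x * frechet_derivative ?q (at x) e)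
          = - (LINT x|lebesgue_on \<Omega>. G e x * ?q x)"
        using weak unfolding weak_partial_def by blast
      moreover have "(LINT x|lebesgue_on \<Omega>. u x * frechet_derivative ?q (at x) e)
          = (LINT x|lebesgue_on \<Omega>. u x * shift_cutoff (\<lambda>s. \<phi> (s - d)) (- d) \<theta>' x)
            + c * (LINT x|lebesgue_on \<Omega>. u x * shift_cutoff (\<lambda>s. \<phi>' (s - d)) (- d) \<theta> x)"
        using integrable_mult_square_integrable[OF squ sqv[OF sq\<theta>(2) smd(1) Bd(1)]]
          integrable_mult_square_integrable[OF squ sqv[OF sq\<theta>(1) smd(2) Bd(2)]]
        by (simp add: q' distrib_left mult.left_commute[of _ c])
      moreover have "(LINT x|lebesgue_on \<Omega>. shift_cutoff_gradient \<phi> \<phi>' d u G e x * \<theta> x)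
          = (LINT x|lebesgue_on \<Omega>. shift_cutoff \<phi> d (G e) x * \<theta> x)
            + c * (LINT x|lebesgue_on \<Omega>. shift_cutoff \<phi>' d u x * \<theta> x)"
        using integrable_mult_square_integrable[OF sqv[OF sqG sm(1) B(1)] sq\<theta>(1)]
          integrable_mult_square_integrable[OF sqv[OF squ sm(2) B(2)] sq\<theta>(1)]
        by (simp add: grad distrib_right mult.assoc)
      ultimately show "(LINT x|lebesgue_on \<Omega>. shift_cutoff \<phi> d u x * frechet_derivative \<theta> (at x) e)
          = - (LINT x|lebesgue_on \<Omega>. shift_cutoff_gradient \<phi> \<phi>' d u G e x * \<theta> x)"
        unfolding integral_shift_cutoff[OF adm \<phi> disjI1[OF refl] squ sq\<theta>(2)]
          integral_shift_cutoff[OF adm \<phi> disjI2[OF refl] squ sq\<theta>(1)]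
          integral_shift_cutoff[OF adm \<phi> disjI1[OF refl] sqG sq\<theta>(1)]
        by (simp add: \<theta>'_def algebra_simps)
    qed
  qed
  ultimately show ?thesis by (simp add: H1_def)
qed

lemma integral_shift_cutoff_power2_tendsto:
  assumes \<phi>: "smooth \<phi>" "\<And>s. \<bar>\<phi> s\<bar> \<le> B" and f: "\<And>n. square_integrable (lebesgue_on \<Omega>) (f n)"
    and lim: "(\<lambda>n. LINT x|lebesgue_on \<Omega>. (cmod (f n x))\<^sup>2) \<longlonglongrightarrow> 0"
  shows "(\<lambda>n. LINT x|lebesgue. (cmod (shift_cutoff \<phi> d (f n) x))\<^sup>2) \<longlonglongrightarrow> 0"
proof (rule tendsto_sandwich[OF _ _ tendsto_const])
  show "(\<lambda>n. B\<^sup>2 * (LINT x|lebesgue_on \<Omega>. (cmod (f n x))\<^sup>2)) \<longlonglongrightarrow> 0"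
    using tendsto_mult_left[OF lim, of "B\<^sup>2"] by simp
qed (use shift_cutoff_square_integrable(2)[OF f \<phi>] in auto)

lemma shift_cutoff_diff: "shift_cutoff \<phi> d (\<lambda>x. f x - g x) x = shift_cutoff \<phi> d f x - shift_cutoff \<phi> d g x"
  by (simp add: shift_cutoff_def ext_def scaleR_right_diff_distrib)

text \<open>Applied to the approximating test functions, the operation gives test functions again.
  It is bounded in L2, and its gradient involves only the values and the gradient of the argument,
  so convergence is preserved.\<close>

lemma H10_shift_cutoff:
  assumes adm: "admissible \<alpha> \<beta> d" and \<phi>: "profile \<phi> \<phi>' \<alpha> \<beta>" and u: "H10 \<Omega> u G"
  shows "H10 \<Omega> (shift_cutoff \<phi> d u) (shift_cutoff_gradient \<phi> \<phi>' d u G)"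
proof -
  obtain B where B: "\<And>s. \<bar>\<phi> s\<bar> \<le> B" "\<And>s. \<bar>\<phi>' s\<bar> \<le> B"
    using profile_bounded[OF \<phi>] by metis
  note sm = profile_smooth[OF \<phi>] profile_smooth'[OF \<phi>]
  have H1: "H1 \<Omega> u G" using u by (simp add: H10_def)
  then have squ: "square_integrable (lebesgue_on \<Omega>) u"
    and sqG: "\<And>e. e \<in> Basis \<Longrightarrow> square_integrable (lebesgue_on \<Omega>) (G e)"
    by (auto simp: H1_def L2_eq_square_integrable)
  obtain \<theta> where \<theta>: "\<And>n. test_function \<Omega> (\<theta> n)"
    and lim: "(\<lambda>n. LINT x|lebesgue_on \<Omega>. (cmod (u x - \<theta> n x))\<^sup>2) \<longlonglongrightarrow> 0"
    and lim': "\<And>e. e \<in> Basis \<Longrightarrow>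
      (\<lambda>n. LINT x|lebesgue_on \<Omega>. (cmod (G e x - frechet_derivative (\<theta> n) (at x) e))\<^sup>2) \<longlonglongrightarrow> 0"
    using u unfolding H10_def by blast
  have sq\<theta>: "square_integrable (lebesgue_on \<Omega>) (\<theta> n)"
    "square_integrable (lebesgue_on \<Omega>) (\<lambda>x. frechet_derivative (\<theta> n) (at x) e)" for n e
    by (intro square_integrable_lebesgue_on \<Omega>_sets test_function_square_integrable[of \<Omega>]
        test_function_frechet_derivative \<theta>)+
  have on_\<Omega>: "(LINT x|lebesgue_on \<Omega>. (cmod (g x))\<^sup>2) = (LINT x|lebesgue. (cmod (g x))\<^sup>2)"
    if "\<And>x. x \<notin> R \<Longrightarrow> g x = 0" for g
    using that R_subset by (intro integral_lebesgue_on_eq \<Omega>_sets) auto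
  note zero = shift_cutoff_eq_0[OF adm profile_eq_0[OF \<phi>]] shift_cutoff_eq_0[OF adm profile_derivative_eq_0[OF \<phi>]]
  have L: "(\<lambda>n. LINT x|lebesgue. (cmod (shift_cutoff \<phi> d (\<lambda>x. u x - \<theta> n x) x))\<^sup>2) \<longlonglongrightarrow> 0"
    by (rule integral_shift_cutoff_power2_tendsto[OF sm(1) B(1) square_integrable_diff[OF squ sq\<theta>(1)] lim])
  have L': "(\<lambda>n. LINT x|lebesgue. (cmod (shift_cutoff \<phi>' d (\<lambda>x. u x - \<theta> n x) x))\<^sup>2) \<longlonglongrightarrow> 0"
    by (rule integral_shift_cutoff_power2_tendsto[OF sm(2) B(2) square_integrable_diff[OF squ sq\<theta>(1)] lim])
  have "test_function \<Omega> (shift_cutoff \<phi> d (\<theta> n))" for n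
    using test_function_shift_cutoff(1)[OF adm \<phi> \<theta>]
    by (rule test_function_mono) (use strip_subset_R R_subset in blast)
  moreover have "(\<lambda>n. LINT x|lebesgue_on \<Omega>. (cmod (shift_cutoff \<phi> d u x - shift_cutoff \<phi> d (\<theta> n) x))\<^sup>2) \<longlonglongrightarrow> 0"
    using L by (subst on_\<Omega>) (simp_all add: zero shift_cutoff_diff)
  moreover have "(\<lambda>n. LINT x|lebesgue_on \<Omega>. (cmod (shift_cutoff_gradient \<phi> \<phi>' d u G e x
      - frechet_derivative (shift_cutoff \<phi> d (\<theta> n)) (at x) e))\<^sup>2) \<longlonglongrightarrow> 0" if e: "e \<in> Basis" for e
  proof -
    define c where "c = complex_of_real ((e \<bullet> a) / (a \<bullet> a))"
    let ?f = "\<lambda>n x. G e x - frechet_derivative (\<theta> n) (at x) e"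
    have diff: "shift_cutoff_gradient \<phi> \<phi>' d u G e x - frechet_derivative (shift_cutoff \<phi> d (\<theta> n)) (at x) e
        = shift_cutoff \<phi> d (?f n) x + c * shift_cutoff \<phi>' d (\<lambda>x. u x - \<theta> n x) x" for n x
      unfolding test_function_shift_cutoff(2)[OF adm \<phi> \<theta>] shift_cutoff_diff shift_cutoff_gradient_def
      by (simp add: c_def scaleR_conv_of_real algebra_simps)
    have sqf: "square_integrable (lebesgue_on \<Omega>) (?f n)" for n
      by (rule square_integrable_diff[OF sqG[OF e] sq\<theta>(2)])
    have Lf: "(\<lambda>n. LINT x|lebesgue. (cmod (shift_cutoff \<phi> d (?f n) x))\<^sup>2) \<longlonglongrightarrow> 0"
      by (rule integral_shift_cutoff_power2_tendsto[OF sm(1) B(1) sqf lim'[OF e]])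
    show ?thesis
      unfolding diff
    proof (subst on_\<Omega>)
      show "shift_cutoff \<phi> d (?f n) x + c * shift_cutoff \<phi>' d (\<lambda>x. u x - \<theta> n x) x = 0" if "x \<notin> R" for n x
        using that by (simp add: zero)
      show "(\<lambda>n. LINT x|lebesgue. (cmod (shift_cutoff \<phi> d (?f n) x + c * shift_cutoff \<phi>' d (\<lambda>x. u x - \<theta> n x) x))\<^sup>2) \<longlonglongrightarrow> 0"
      proof (rule tendsto_sandwich[OF _ _ tendsto_const])
        show "(\<lambda>n. 2 * (LINT x|lebesgue. (cmod (shift_cutoff \<phi> d (?f n) x))\<^sup>2)
            + 2 * ((cmod c)\<^sup>2 * (LINT x|lebesgue. (cmod (shift_cutoff \<phi>' d (\<lambda>x. u x - \<theta> n x) x))\<^sup>2))) \<longlonglongrightarrow> 0"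
          using tendsto_add[OF tendsto_mult_left[OF Lf, of 2] tendsto_mult_left[OF tendsto_mult_left[OF L', of "(cmod c)\<^sup>2"], of 2]]
          by simp
        have "(LINT x|lebesgue. (cmod (shift_cutoff \<phi> d (?f n) x + c * shift_cutoff \<phi>' d (\<lambda>x. u x - \<theta> n x) x))\<^sup>2)
          \<le> 2 * (LINT x|lebesgue. (cmod (shift_cutoff \<phi> d (?f n) x))\<^sup>2)
            + 2 * (LINT x|lebesgue. (cmod (c * shift_cutoff \<phi>' d (\<lambda>x. u x - \<theta> n x) x))\<^sup>2)" for n
          by (intro integral_add_power2_le square_integrable_cmult
              shift_cutoff_square_integrable(1)[OF sqf sm(1) B(1)]
              shift_cutoff_square_integrable(1)[OF square_integrable_diff[OF squ sq\<theta>(1)] sm(2) B(2)])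
        then show "\<forall>\<^sub>F n in sequentially. (LINT x|lebesgue. (cmod (shift_cutoff \<phi> d (?f n) x + c * shift_cutoff \<phi>' d (\<lambda>x. u x - \<theta> n x) x))\<^sup>2)
          \<le> 2 * (LINT x|lebesgue. (cmod (shift_cutoff \<phi> d (?f n) x))\<^sup>2)
            + 2 * ((cmod c)\<^sup>2 * (LINT x|lebesgue. (cmod (shift_cutoff \<phi>' d (\<lambda>x. u x - \<theta> n x) x))\<^sup>2))"
          by (simp add: norm_mult power_mult_distrib)
      qed simp
    qed
  qed
  ultimately show ?thesis
    unfolding H10_def using H1_shift_cutoff[OF adm \<phi> H1]
    by (intro conjI exI[of _ "\<lambda>n. shift_cutoff \<phi> d (\<theta> n)"]) auto
qed

text \<open>From here on both boundary conditions are treated alike: invariance under cutoff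
  translations and inclusion in H1 are the properties of the form domain that the argument
  uses.\<close>

lemma form_domain_shift_cutoff:
  assumes "admissible \<alpha> \<beta> d" "profile \<phi> \<phi>' \<alpha> \<beta>" "form_domain bc \<Omega> u G"
  shows "form_domain bc \<Omega> (shift_cutoff \<phi> d u) (shift_cutoff_gradient \<phi> \<phi>' d u G)"
  using assms H1_shift_cutoff H10_shift_cutoff by (cases bc) auto

end

section \<open>The Wronskian identity\<close>

context rectangular_part
begin

lemma cnj_shift_cutoff: "cnj (shift_cutoff \<phi> d f x) = shift_cutoff \<phi> d (\<lambda>x. cnj (f x)) x"
  by (simp add: shift_cutoff_def ext_def)

text \<open>The sesquilinear form of adjointness: exchanging \<open>f\<close> and \<open>h\<close>
  costs a conjugation.\<close>

lemma integral_cnj_shift_cutoff: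
  assumes adm: "admissible \<alpha> \<beta> d" and \<phi>: "profile \<phi> \<phi>' \<alpha> \<beta>" and \<psi>: "\<psi> = \<phi> \<or> \<psi> = \<phi>'"
    and f: "square_integrable (lebesgue_on \<Omega>) f" and h: "square_integrable (lebesgue_on \<Omega>) h"
  shows "(LINT x|lebesgue_on \<Omega>. f x * cnj (shift_cutoff (\<lambda>s. \<psi> (s - d)) (- d) h x))
    = cnj (LINT x|lebesgue_on \<Omega>. h x * cnj (shift_cutoff \<psi> d f x))"
proof -
  have "(LINT x|lebesgue_on \<Omega>. f x * cnj (shift_cutoff (\<lambda>s. \<psi> (s - d)) (- d) h x))
      = (LINT x|lebesgue_on \<Omega>. shift_cutoff \<psi> d f x * cnj (h x))"
    unfolding cnj_shift_cutoff
    by (rule integral_shift_cutoff[OF adm \<phi> \<psi> f square_integrable_cnj[OF h]])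
  also have "\<dots> = (LINT x|lebesgue_on \<Omega>. cnj (h x * cnj (shift_cutoff \<psi> d f x)))"
    by (simp add: mult.commute)
  also have "\<dots> = cnj (LINT x|lebesgue_on \<Omega>. h x * cnj (shift_cutoff \<psi> d f x))"
    by (rule Bochner_Integration.integral_cnj)
  finally show ?thesis .
qed

text \<open>The gradient paired with \<open>a\<close>. As \<open>a\<close> is one unit of \<sigma>,
  this is the partial derivative with respect to \<sigma>.\<close>

definition along_derivative :: "(plane \<Rightarrow> plane \<Rightarrow> complex) \<Rightarrow> plane \<Rightarrow> complex" where
  "along_derivative G x = (\<Sum>e\<in>Basis. complex_of_real (e \<bullet> a) * G e x)"

lemma along_derivative_square_integrable:
  assumes "H1 \<Omega> u G"
  shows "square_integrable (lebesgue_on \<Omega>) (along_derivative G)"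
  unfolding along_derivative_def[abs_def] using assms
  by (intro square_integrable_sum square_integrable_cmult) (auto simp: H1_def L2_eq_square_integrable)

lemma shift_cutoff_along_derivative:
  "shift_cutoff \<phi> d (along_derivative G) x = (\<Sum>e\<in>Basis. complex_of_real (e \<bullet> a) * shift_cutoff \<phi> d (G e) x)"
  by (simp add: shift_cutoff_def ext_def along_derivative_def scaleR_sum_right mult.left_commute
      scaleR_conv_of_real sum_distrib_left)

text \<open>The parameter is real, which allows the two tested equations to be compared after
  conjugating one of them. The gradient is named so that its derivative along \<open>a\<close> can
  be used.\<close>

definition weak_eigenfunction ::
    "boundary_condition \<Rightarrow> real \<Rightarrow> (plane \<Rightarrow> complex) \<Rightarrow> (plane \<Rightarrow> plane \<Rightarrow> complex) \<Rightarrow> bool" where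
  "weak_eigenfunction bc m u G \<longleftrightarrow> form_domain bc \<Omega> u G \<and>
     (\<forall>v H. form_domain bc \<Omega> v H \<longrightarrow>
        (\<Sum>e\<in>Basis. LINT x|lebesgue_on \<Omega>. G e x * cnj (H e x))
          = (LINT x|lebesgue_on \<Omega>. complex_of_real m * u x * cnj (v x)))"

lemma form_domain_H1: "form_domain bc \<Omega> u G \<Longrightarrow> H1 \<Omega> u G"
  by (cases bc) (auto simp: H10_def)

lemma weak_eigenfunction_H1: "weak_eigenfunction bc m u G \<Longrightarrow> H1 \<Omega> u G"
  by (auto simp: weak_eigenfunction_def intro: form_domain_H1)

text \<open>Testing the equation for \<open>u\<close> with \<open>\<phi>(\<sigma>) u(\<cdot> + d a)\<close> and with the translate of \<open>\<phi>(\<sigma>) u\<close> by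
  \<open>- d a\<close> yields the same terms up to conjugation, except for those with a derivative of the cutoff.\<close>

lemma wronskian:
  assumes adm: "admissible \<alpha> \<beta> d" and \<phi>: "profile \<phi> \<phi>' \<alpha> \<beta>" and u: "weak_eigenfunction bc m u G"
  shows "(LINT x|lebesgue_on \<Omega>. along_derivative G x * cnj (shift_cutoff \<phi>' d u x))
    = (LINT x|lebesgue_on \<Omega>. u x * cnj (shift_cutoff \<phi>' d (along_derivative G) x))"
proof -
  have dom: "form_domain bc \<Omega> u G" and eq: "\<And>v H. form_domain bc \<Omega> v H \<Longrightarrow>
      (\<Sum>e\<in>Basis. LINT x|lebesgue_on \<Omega>. G e x * cnj (H e x))
        = (LINT x|lebesgue_on \<Omega>. complex_of_real m * u x * cnj (v x))"
    using u by (auto simp: weak_eigenfunction_def)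
  obtain B where B: "\<And>s. \<bar>\<phi> s\<bar> \<le> B" "\<And>s. \<bar>\<phi>' s\<bar> \<le> B"
    using profile_bounded[OF \<phi>] by metis
  note sm = profile_smooth[OF \<phi>] profile_smooth'[OF \<phi>]
  note \<phi>d = profile_shift[OF \<phi>, of d]
  have Bd: "\<bar>\<phi> (s - d)\<bar> \<le> B" "\<bar>\<phi>' (s - d)\<bar> \<le> B" for s using B by auto
  note smd = profile_smooth[OF \<phi>d] profile_smooth'[OF \<phi>d]
  note H1 = weak_eigenfunction_H1[OF u]
  then have squ: "square_integrable (lebesgue_on \<Omega>) u"
    and sqG: "\<And>e. e \<in> Basis \<Longrightarrow> square_integrable (lebesgue_on \<Omega>) (G e)"
    by (auto simp: H1_def L2_eq_square_integrable)
  note sqv = square_integrable_cnj[OF square_integrable_lebesgue_on[OF shift_cutoff_square_integrable(1) \<Omega>_sets]]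
  define c where "c e = complex_of_real ((e \<bullet> a) / (a \<bullet> a))" for e
  have c_cnj: "cnj (c e) = c e" for e by (simp add: c_def)
  have grad: "cnj (shift_cutoff_gradient \<psi> \<psi>' d' u G e x)
      = cnj (shift_cutoff \<psi> d' (G e) x) + c e * cnj (shift_cutoff \<psi>' d' u x)" for \<psi> \<psi>' d' e x
    by (simp add: shift_cutoff_gradient_def c_def scaleR_conv_of_real)
  \<comment> \<open>\<open>T\<close> and \<open>N\<close> are the gradient and eigenvalue terms,
    shared by the two equations up to conjugation; \<open>P\<close> and \<open>Q\<close> are what
    the derivative of the cutoff leaves in the first and in the second.\<close>
  define T where "T = (\<Sum>e\<in>Basis. LINT x|lebesgue_on \<Omega>. G e x * cnj (shift_cutoff \<phi> d (G e) x))"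
  define N where "N = (LINT x|lebesgue_on \<Omega>. u x * cnj (shift_cutoff \<phi> d u x))"
  define P where "P e = (LINT x|lebesgue_on \<Omega>. G e x * cnj (shift_cutoff \<phi>' d u x))" for e
  define Q where "Q e = (LINT x|lebesgue_on \<Omega>. u x * cnj (shift_cutoff \<phi>' d (G e) x))" for e
  have "T + (\<Sum>e\<in>Basis. c e * P e) = of_real m * N"
  proof -
    have "(LINT x|lebesgue_on \<Omega>. G e x * cnj (shift_cutoff_gradient \<phi> \<phi>' d u G e x))
        = (LINT x|lebesgue_on \<Omega>. G e x * cnj (shift_cutoff \<phi> d (G e) x)) + c e * P e" if "e \<in> Basis" for e
      using integrable_mult_square_integrable[OF sqG[OF that] sqv[OF sqG[OF that] sm(1) B(1)]]
        integrable_mult_square_integrable[OF sqG[OF that] sqv[OF squ sm(2) B(2)]]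
      by (simp add: grad P_def distrib_left mult.left_commute[of _ "c _"])
    then show ?thesis
      using eq[OF form_domain_shift_cutoff[OF adm \<phi> dom]]
      by (simp add: T_def N_def sum.distrib mult.assoc)
  qed
  moreover have "cnj T + (\<Sum>e\<in>Basis. c e * cnj (Q e)) = of_real m * cnj N"
  proof -
    have "(LINT x|lebesgue_on \<Omega>. G e x *
          cnj (shift_cutoff_gradient (\<lambda>s. \<phi> (s - d)) (\<lambda>s. \<phi>' (s - d)) (- d) u G e x))
        = cnj (LINT x|lebesgue_on \<Omega>. G e x * cnj (shift_cutoff \<phi> d (G e) x)) + c e * cnj (Q e)"
      if "e \<in> Basis" for e
      using integrable_mult_square_integrable[OF sqG[OF that] sqv[OF sqG[OF that] smd(1) Bd(1)]]
        integrable_mult_square_integrable[OF sqG[OF that] sqv[OF squ smd(2) Bd(2)]]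
      by (simp add: grad Q_def distrib_left mult.left_commute[of _ "c _"]
          integral_cnj_shift_cutoff[OF adm \<phi> disjI1[OF refl] sqG[OF that] sqG[OF that]]
          integral_cnj_shift_cutoff[OF adm \<phi> disjI2[OF refl] sqG[OF that] squ])
    then show ?thesis
      using eq[OF form_domain_shift_cutoff[OF admissible_uminus[OF adm] \<phi>d dom]]
      by (simp add: T_def N_def sum.distrib mult.assoc
          integral_cnj_shift_cutoff[OF adm \<phi> disjI1[OF refl] squ squ])
  qed
  \<comment> \<open>Conjugation fixes \<open>m\<close> since it is real; the second equation then
    has the same \<open>T\<close> and \<open>N\<close> as the first.\<close>
  then have "cnj (cnj T + (\<Sum>e\<in>Basis. c e * cnj (Q e))) = cnj (of_real m * cnj N)" by simp
  then have "T + (\<Sum>e\<in>Basis. c e * Q e) = of_real m * N"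
    by (simp add: c_cnj)
  ultimately have "(\<Sum>e\<in>Basis. c e * P e) = (\<Sum>e\<in>Basis. c e * Q e)"
    by (metis add_left_cancel)
  \<comment> \<open>Clearing the denominator contained in \<open>c\<close> turns both sums into
    derivatives along \<open>a\<close>.\<close>
  then have "of_real (a \<bullet> a) * (\<Sum>e\<in>Basis. c e * P e) = of_real (a \<bullet> a) * (\<Sum>e\<in>Basis. c e * Q e)"
    by simp
  then have PQ: "(\<Sum>e\<in>Basis. of_real (e \<bullet> a) * P e) = (\<Sum>e\<in>Basis. of_real (e \<bullet> a) * Q e)"
    using a_nonzero by (simp add: sum_distrib_left c_def)
  have "(LINT x|lebesgue_on \<Omega>. along_derivative G x * cnj (shift_cutoff \<phi>' d u x))
      = (LINT x|lebesgue_on \<Omega>. (\<Sum>e\<in>Basis. of_real (e \<bullet> a) * (G e x * cnj (shift_cutoff \<phi>' d u x))))"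
    by (simp add: along_derivative_def sum_distrib_right mult.assoc)
  also have "\<dots> = (\<Sum>e\<in>Basis. of_real (e \<bullet> a) * P e)"
    unfolding P_def
    by (subst Bochner_Integration.integral_sum)
      (auto intro!: integrable_mult_right integrable_mult_square_integrable[OF sqG sqv[OF squ sm(2) B(2)]])
  also have "\<dots> = (LINT x|lebesgue_on \<Omega>. (\<Sum>e\<in>Basis. of_real (e \<bullet> a) * (u x * cnj (shift_cutoff \<phi>' d (G e) x))))"
    unfolding PQ Q_def
    by (subst Bochner_Integration.integral_sum)
      (auto intro!: integrable_mult_right integrable_mult_square_integrable[OF squ sqv[OF sqG sm(2) B(2)]])
  also have "\<dots> = (LINT x|lebesgue_on \<Omega>. u x * cnj (shift_cutoff \<phi>' d (along_derivative G) x))"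
    by (simp add: shift_cutoff_along_derivative sum_distrib_left mult.left_commute)
  finally show ?thesis .
qed

text \<open>Moving the variable by \<open>e\<close> places the two points symmetrically about the
  weight; this accounts for the translation by \<open>2 * e\<close> and the cutoff moved by
  \<open>- e\<close>. The difference of the two sides is, up to sign, the formal derivative of the
  correlation with respect to \<open>e\<close>.\<close>

lemma wronskian_centered:
  assumes \<phi>: "profile \<phi> \<phi>' \<alpha> \<beta>" and e: "\<bar>e\<bar> < \<alpha>" "\<bar>e\<bar> < 1 - \<beta>" and u: "weak_eigenfunction bc m u G"
  shows "(LINT x|lebesgue. \<phi>' (\<sigma> x) *\<^sub>R (ext (along_derivative G) (x - e *\<^sub>R a) * cnj (ext u (x + e *\<^sub>R a))))
    = (LINT x|lebesgue. \<phi>' (\<sigma> x) *\<^sub>R (ext u (x - e *\<^sub>R a) * cnj (ext (along_derivative G) (x + e *\<^sub>R a))))"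
proof -
  define \<phi>e where "\<phi>e = (\<lambda>s. \<phi> (s - (- e)))"
  define \<phi>e' where "\<phi>e' = (\<lambda>s. \<phi>' (s - (- e)))"
  have \<phi>e: "profile \<phi>e \<phi>e' (\<alpha> + (- e)) (\<beta> + (- e))"
    unfolding \<phi>e_def \<phi>e'_def by (rule profile_shift[OF \<phi>])
  have adm: "admissible (\<alpha> + (- e)) (\<beta> + (- e)) (2 * e)"
    using e by (auto simp: admissible_def)
  obtain B where B: "\<And>s. \<bar>\<phi>e' s\<bar> \<le> B"
    using profile_bounded[OF \<phi>e] by metis
  note H1 = weak_eigenfunction_H1[OF u]
  then have squ: "square_integrable (lebesgue_on \<Omega>) u"
    by (auto simp: H1_def L2_eq_square_integrable)
  note sqg = along_derivative_square_integrable[OF H1]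
  have *: "(LINT x|lebesgue_on \<Omega>. f x * cnj (shift_cutoff \<phi>e' (2 * e) h x))
      = (LINT x|lebesgue. \<phi>' (\<sigma> x) *\<^sub>R (ext f (x - e *\<^sub>R a) * cnj (ext h (x + e *\<^sub>R a))))"
    if f: "square_integrable (lebesgue_on \<Omega>) f" and h: "square_integrable (lebesgue_on \<Omega>) h" for f h
  proof -
    let ?F = "\<lambda>x. ext f x * cnj (shift_cutoff \<phi>e' (2 * e) h x)"
    have "integrable lebesgue ?F"
      by (intro integrable_mult_square_integrable ext_square_integrable f square_integrable_cnj
          shift_cutoff_square_integrable(1)[OF h profile_smooth'[OF \<phi>e] B])
    then have meas: "?F \<in> borel_measurable lebesgue" by simp
    have F1: "(LINT x|lebesgue_on \<Omega>. f x * cnj (shift_cutoff \<phi>e' (2 * e) h x)) = (LINT x|lebesgue. ?F x)"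
    proof (rule integral_lebesgue_on_eq[OF \<Omega>_sets])
      show "f x * cnj (shift_cutoff \<phi>e' (2 * e) h x) = ?F x" for x
        using shift_cutoff_eq_0[OF adm profile_derivative_eq_0[OF \<phi>e]]
        by (cases "x \<in> R") (auto simp: ext_def)
      show "?F x = 0" if "x \<notin> \<Omega>" for x
        using that R_subset by (auto simp: ext_def)
    qed
    have F2: "(LINT x|lebesgue. ?F (x + c)) = (LINT x|lebesgue. ?F x)" for c
      by (rule integral_lebesgue_translation[OF meas])
    have F3: "?F (x + (- e) *\<^sub>R a) = \<phi>' (\<sigma> x) *\<^sub>R (ext f (x - e *\<^sub>R a) * cnj (ext h (x + e *\<^sub>R a)))" for x
    proof -
      have eq: "x + (- e) *\<^sub>R a + (2 * e) *\<^sub>R a = x + e *\<^sub>R a"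
        unfolding mult_2 scaleR_left_distrib by simp
      show ?thesis
        unfolding shift_cutoff_def \<phi>e'_def eq by simp
    qed
    show ?thesis
      by (rule F1[THEN trans, OF F2[of "(- e) *\<^sub>R a", symmetric, unfolded F3]])
  qed
  show ?thesis
    using wronskian[OF adm \<phi>e u] unfolding *[OF sqg squ] *[OF squ sqg] .
qed

end

section \<open>Translations along the rectangle\<close>

definition l2norm :: "'a measure \<Rightarrow> ('a \<Rightarrow> complex) \<Rightarrow> real" where
  "l2norm M f = sqrt (LINT x|M. (cmod (f x))\<^sup>2)"

lemma l2norm_nonneg: "0 \<le> l2norm M f"
  by (simp add: l2norm_def)

lemma l2norm_power2: "(l2norm M f)\<^sup>2 = (LINT x|M. (cmod (f x))\<^sup>2)"
  by (simp add: l2norm_def)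

lemma norm_integral_mult_le_l2norm:
  "square_integrable M f \<Longrightarrow> square_integrable M g \<Longrightarrow> cmod (LINT x|M. f x * g x) \<le> l2norm M f * l2norm M g"
  unfolding l2norm_def by (rule norm_integral_mult_le)

lemma l2norm_uminus: "l2norm M (\<lambda>x. - f x) = l2norm M f"
  and l2norm_cnj: "l2norm M (\<lambda>x. cnj (f x)) = l2norm M f"
  by (simp_all add: l2norm_def)

lemma l2norm_triangle:
  assumes f: "square_integrable M f" and g: "square_integrable M g"
  shows "l2norm M (\<lambda>x. f x + g x) \<le> l2norm M f + l2norm M g"
proof (rule power2_le_imp_le)
  have meas: "f \<in> borel_measurable M" "g \<in> borel_measurable M"
    using f g by (simp_all add: square_integrable_def)
  have int: "integrable M (\<lambda>x. (cmod (f x))\<^sup>2)" "integrable M (\<lambda>x. (cmod (g x))\<^sup>2)"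
    "integrable M (\<lambda>x. (cmod (f x + g x))\<^sup>2)"
    using f g square_integrable_add[OF f g] by (simp_all add: square_integrable_def)
  have intfg: "integrable M (\<lambda>x. cmod (f x) * cmod (g x))"
    using integrable_norm[OF integrable_mult_square_integrable[OF f g]] by (simp add: norm_mult)
  have "square_integrable M (\<lambda>x. complex_of_real (cmod (f x)))" "square_integrable M (\<lambda>x. complex_of_real (cmod (g x)))"
    using int meas by (auto simp: square_integrable_def)
  from norm_integral_mult_le_l2norm[OF this]
  have cs: "(LINT x|M. cmod (f x) * cmod (g x)) \<le> l2norm M f * l2norm M g"
    by (simp add: l2norm_def flip: of_real_mult)
  have "(l2norm M (\<lambda>x. f x + g x))\<^sup>2 = (LINT x|M. (cmod (f x + g x))\<^sup>2)"
    by (rule l2norm_power2)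
  also have "\<dots> \<le> (LINT x|M. (cmod (f x))\<^sup>2 + 2 * (cmod (f x) * cmod (g x)) + (cmod (g x))\<^sup>2)"
  proof (rule integral_mono)
    show "(cmod (f x + g x))\<^sup>2 \<le> (cmod (f x))\<^sup>2 + 2 * (cmod (f x) * cmod (g x)) + (cmod (g x))\<^sup>2" for x
      using power_mono[OF norm_triangle_ineq[of "f x" "g x"] norm_ge_zero, of 2]
      by (simp add: power2_sum algebra_simps)
  qed (use int intfg in auto)
  also have "\<dots> = (l2norm M f)\<^sup>2 + 2 * (LINT x|M. cmod (f x) * cmod (g x)) + (l2norm M g)\<^sup>2"
    using int intfg by (simp add: l2norm_power2)
  also have "\<dots> \<le> (l2norm M f + l2norm M g)\<^sup>2"
    using cs by (simp add: power2_sum)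
  finally show "(l2norm M (\<lambda>x. f x + g x))\<^sup>2 \<le> (l2norm M f + l2norm M g)\<^sup>2" .
qed (simp add: l2norm_nonneg)

lemma l2norm_translation:
  assumes "square_integrable lebesgue f"
  shows "l2norm lebesgue (\<lambda>x. f (x + c)) = l2norm lebesgue f"
  using integral_lebesgue_translation[of "\<lambda>x. (cmod (f x))\<^sup>2" c] assms
  by (simp add: l2norm_def square_integrable_def)

lemma L2_approximable_l2norm:
  assumes "L2_approximable S f" "0 < \<eta>"
  obtains q where "test_function S q" "l2norm lebesgue (\<lambda>x. f x - q x) < \<eta>"
proof -
  have "0 < \<eta>\<^sup>2" using assms(2) by simp
  then obtain q where "test_function S q" "(LINT x|lebesgue. (cmod (f x - q x))\<^sup>2) < \<eta>\<^sup>2"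
    using assms(1) unfolding L2_approximable_def by blast
  then show ?thesis
    using that[of q] assms(2) by (simp add: l2norm_def real_less_lsqrt)
qed

text \<open>Second order errors are what the derivatives below produce, from Taylor's formula for a
  test function and from a product of two Lipschitz differences.\<close>

lemma has_vector_derivative_quadratic_bound:
  fixes f :: "real \<Rightarrow> 'a::real_normed_vector"
  assumes "0 < \<delta>" "\<And>t. \<bar>t - s\<bar> < \<delta> \<Longrightarrow> norm (f t - f s - (t - s) *\<^sub>R D) \<le> C * (t - s)\<^sup>2"
  shows "(f has_vector_derivative D) (at s)"
  unfolding has_vector_derivative_def has_derivative_at_alt
proof (intro conjI allI impI bounded_linear_scaleR_left)
  fix \<epsilon> :: real assume "0 < \<epsilon>"
  have "norm (f t - f s - (t - s) *\<^sub>R D) \<le> \<epsilon> * norm (t - s)"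
    if t: "norm (t - s) < min \<delta> (\<epsilon> / (\<bar>C\<bar> + 1))" for t
  proof -
    have "norm (f t - f s - (t - s) *\<^sub>R D) \<le> C * (t - s)\<^sup>2"
      using t by (intro assms(2)) simp
    also have "\<dots> \<le> (\<bar>C\<bar> + 1) * \<bar>t - s\<bar> * \<bar>t - s\<bar>"
      by (simp add: power2_eq_square mult.assoc mult_right_mono flip: abs_mult)
    also have "\<dots> \<le> \<epsilon> * \<bar>t - s\<bar>"
      using t by (intro mult_right_mono) (auto simp: field_simps)
    finally show ?thesis by simp
  qed
  then show "\<exists>d>0. \<forall>t. norm (t - s) < d \<longrightarrow> norm (f t - f s - (t - s) *\<^sub>R D) \<le> \<epsilon> * norm (t - s)"
    using \<open>0 < \<delta>\<close> \<open>0 < \<epsilon>\<close> by (intro exI[of _ "min \<delta> (\<epsilon> / (\<bar>C\<bar> + 1))"]) auto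
qed

lemma vector_differentiable_bound:
  fixes f :: "real \<Rightarrow> 'a::real_normed_vector"
  assumes "convex S" "\<And>t. t \<in> S \<Longrightarrow> (f has_vector_derivative f' t) (at t within S)"
    "\<And>t. t \<in> S \<Longrightarrow> norm (f' t) \<le> B" "s \<in> S" "t \<in> S"
  shows "norm (f t - f s) \<le> B * \<bar>t - s\<bar>"
proof -
  have "onorm (\<lambda>h. h *\<^sub>R f' r) \<le> B" if "r \<in> S" for r
  proof (rule onorm_le)
    show "norm (h *\<^sub>R f' r) \<le> B * norm h" for h
      using mult_right_mono[OF assms(3)[OF that], of "\<bar>h\<bar>"] by (simp add: mult.commute)
  qed
  then show ?thesis
    using differentiable_bound[OF assms(1) assms(2)[unfolded has_vector_derivative_def] _ assms(5,4)]
    by simp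
qed

text \<open>The mean value inequality applied twice, first to the derivative and then to the
  linearization error; the constant is \<open>B\<close> rather than the optimal
  \<open>B / 2\<close>.\<close>

lemma quadratic_remainder:
  fixes f :: "real \<Rightarrow> 'a::real_normed_vector"
  assumes f: "\<And>t. (f has_vector_derivative f' t) (at t)"
    and f': "\<And>t. (f' has_vector_derivative f'' t) (at t)" and B: "\<And>t. norm (f'' t) \<le> B"
  shows "norm (f t - f s - (t - s) *\<^sub>R f' s) \<le> B * (t - s)\<^sup>2"
proof -
  have "0 \<le> B" using B[of 0] norm_ge_zero order_trans by blast
  have "norm (f' r - f' s) \<le> B * \<bar>t - s\<bar>" if "r \<in> closed_segment s t" for r
  proof -
    have "norm (f' r - f' s) \<le> B * \<bar>r - s\<bar>"
      using vector_differentiable_bound[of UNIV f' f'' B s r] f' B by simp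
    also have "\<dots> \<le> B * \<bar>t - s\<bar>"
      using that \<open>0 \<le> B\<close> by (intro mult_left_mono) (auto simp: closed_segment_eq_real_ivl split: if_splits)
    finally show ?thesis .
  qed
  then have "norm (f t - f s - (t - s) *\<^sub>R f' s) \<le> norm (t - s) * (B * \<bar>t - s\<bar>)"
    using f by (intro vector_differentiable_bound_linearization[where S = "closed_segment s t"])
      (auto intro: has_vector_derivative_at_within)
  then show ?thesis by (simp add: power2_eq_square mult.left_commute flip: abs_mult)
qed

lemma has_vector_derivative_along_line:
  assumes "smooth q"
  shows "((\<lambda>t. q (y - t *\<^sub>R v)) has_vector_derivative - frechet_derivative q (at (y - t *\<^sub>R v)) v) (at t)"
proof -
  have lin: "linear (frechet_derivative q (at (y - t *\<^sub>R v)))"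
    using smooth_has_derivative[OF assms] has_derivative_linear by blast
  have "((\<lambda>t. y - t *\<^sub>R v) has_derivative (\<lambda>h. - (h *\<^sub>R v))) (at t)"
    by (auto intro!: derivative_eq_intros)
  from has_derivative_compose[OF this smooth_has_derivative[OF assms]]
  show ?thesis
    by (simp add: has_vector_derivative_def linear_neg[OF lin] linear_cmul[OF lin])
qed

context rectangular_part
begin

text \<open>Weak derivatives are given along basis vectors; expanding \<open>a\<close> in the basis
  yields integration by parts along \<open>a\<close>.\<close>

lemma integral_ext_frechet_derivative:
  assumes u: "H1 \<Omega> u G" and q: "test_function R q"
  shows "(LINT x|lebesgue. ext u x * frechet_derivative q (at x) a)
    = - (LINT x|lebesgue. ext (along_derivative G) x * q x)"
proof -
  have squ: "square_integrable (lebesgue_on \<Omega>) u"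
    and sqG: "\<And>e. e \<in> Basis \<Longrightarrow> square_integrable (lebesgue_on \<Omega>) (G e)"
    and weak: "\<And>e. e \<in> Basis \<Longrightarrow> weak_partial \<Omega> e u (G e)"
    using u by (auto simp: H1_def L2_eq_square_integrable)
  have q\<Omega>: "test_function \<Omega> q"
    using q R_subset by (rule test_function_mono)
  have sqq: "square_integrable (lebesgue_on \<Omega>) q"
    "square_integrable (lebesgue_on \<Omega>) (\<lambda>x. frechet_derivative q (at x) e)" for e
    by (intro square_integrable_lebesgue_on \<Omega>_sets test_function_square_integrable[of \<Omega>]
        test_function_frechet_derivative q\<Omega>)+
  have q0: "q x = 0" "frechet_derivative q (at x) e = 0" if "x \<notin> R" for x e
    using that test_function_eq_0[OF q] test_function_eq_0[OF test_function_frechet_derivative[OF q]] by auto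
  have decomp: "frechet_derivative q (at x) a = (\<Sum>e\<in>Basis. of_real (e \<bullet> a) * frechet_derivative q (at x) e)" for x
  proof -
    have lin: "linear (frechet_derivative q (at x))"
      using smooth_has_derivative[OF test_function_smooth[OF q]] has_derivative_linear by blast
    have "frechet_derivative q (at x) a = frechet_derivative q (at x) (\<Sum>e\<in>Basis. (a \<bullet> e) *\<^sub>R e)"
      by (simp add: euclidean_representation)
    also have "\<dots> = (\<Sum>e\<in>Basis. of_real (e \<bullet> a) * frechet_derivative q (at x) e)"
      by (simp add: linear_sum[OF lin] linear_cmul[OF lin] scaleR_conv_of_real inner_commute)
    finally show ?thesis .
  qed
  have "(LINT x|lebesgue. ext u x * frechet_derivative q (at x) a)
      = (LINT x|lebesgue_on \<Omega>. u x * frechet_derivative q (at x) a)"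
    using R_subset by (intro integral_lebesgue_on_eq[symmetric] \<Omega>_sets) (auto simp: ext_def q0)
  also have "\<dots> = (LINT x|lebesgue_on \<Omega>. (\<Sum>e\<in>Basis. of_real (e \<bullet> a) * (u x * frechet_derivative q (at x) e)))"
    by (simp add: decomp sum_distrib_left mult.left_commute)
  also have "\<dots> = (\<Sum>e\<in>Basis. of_real (e \<bullet> a) * (LINT x|lebesgue_on \<Omega>. u x * frechet_derivative q (at x) e))"
    by (subst Bochner_Integration.integral_sum)
      (auto intro!: integrable_mult_right integrable_mult_square_integrable[OF squ sqq(2)])
  also have "\<dots> = (\<Sum>e\<in>Basis. of_real (e \<bullet> a) * - (LINT x|lebesgue_on \<Omega>. G e x * q x))"
    using weak q\<Omega> unfolding weak_partial_def by (intro sum.cong) auto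
  also have "\<dots> = - (LINT x|lebesgue_on \<Omega>. (\<Sum>e\<in>Basis. of_real (e \<bullet> a) * (G e x * q x)))"
    by (subst Bochner_Integration.integral_sum)
      (auto intro!: integrable_mult_right integrable_mult_square_integrable[OF sqG sqq(1)] simp: sum_negf)
  also have "(LINT x|lebesgue_on \<Omega>. (\<Sum>e\<in>Basis. of_real (e \<bullet> a) * (G e x * q x)))
      = (LINT x|lebesgue_on \<Omega>. along_derivative G x * q x)"
    by (simp add: along_derivative_def sum_distrib_right mult.assoc)
  also have "\<dots> = (LINT x|lebesgue. ext (along_derivative G) x * q x)"
    using R_subset by (intro integral_lebesgue_on_eq \<Omega>_sets) (auto simp: ext_def q0)
  finally show ?thesis .
qed

text \<open>Moves the translation from the rough factor to \<open>q\<close>, which can be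
  differentiated classically when it is a test function.\<close>

lemma integral_mult_ext_translation:
  assumes "square_integrable lebesgue q" "square_integrable (lebesgue_on \<Omega>) f"
  shows "(LINT x|lebesgue. q x * ext f (x + t *\<^sub>R a)) = (LINT x|lebesgue. q (x - t *\<^sub>R a) * ext f x)"
proof -
  have "square_integrable lebesgue (\<lambda>x. q (x - t *\<^sub>R a))"
    using square_integrable_translation[OF assms(1), of "- t *\<^sub>R a"] by simp
  then have "integrable lebesgue (\<lambda>x. q (x - t *\<^sub>R a) * ext f x)"
    by (intro integrable_mult_square_integrable ext_square_integrable assms)
  then have "(\<lambda>x. q (x - t *\<^sub>R a) * ext f x) \<in> borel_measurable lebesgue" by simp
  from integral_lebesgue_translation[OF this, of "t *\<^sub>R a"] show ?thesis by simp
qed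

lemma integrable_ext:
  assumes "square_integrable (lebesgue_on \<Omega>) f"
  shows "integrable lebesgue (ext f)"
proof -
  have "R \<in> fmeasurable lebesgue"
    by (rule lmeasurable_open[OF bounded_subset[OF bounded_coords R_subset_coords] open_R])
  then have "integrable lebesgue (indicator R :: plane \<Rightarrow> real)"
    by (rule integrable_indicator_fmeasurable)
  moreover have "(\<lambda>x. (cmod (indicator R x))\<^sup>2) = (indicator R :: plane \<Rightarrow> real)"
    by (auto simp: fun_eq_iff indicator_def)
  ultimately have "square_integrable lebesgue (indicator R)"
    using R_sets by (simp add: square_integrable_def)
  from integrable_mult_square_integrable[OF this ext_square_integrable[OF assms]]
  have "integrable lebesgue (\<lambda>x. indicator R x * ext f x)" .
  moreover have "(\<lambda>x. indicator R x * ext f x) = ext f"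
    by (auto simp: fun_eq_iff ext_def indicator_def)
  ultimately show ?thesis by simp
qed

text \<open>With the translation moved onto \<open>q\<close>, Taylor's formula for \<open>q\<close>
  gives a derivative in which \<open>q\<close> is differentiated; integration by parts returns it to
  \<open>u\<close>.\<close>

lemma has_vector_derivative_translation_test_function:
  assumes u: "H1 \<Omega> u G" and q: "test_function {x \<in> R. \<alpha> < \<sigma> x \<and> \<sigma> x < \<beta>} q"
    and s: "- \<alpha> \<le> s" "s \<le> 1 - \<beta>"
  shows "((\<lambda>t. LINT x|lebesgue. q x * ext u (x + t *\<^sub>R a)) has_vector_derivative
    (LINT x|lebesgue. q x * ext (along_derivative G) (x + s *\<^sub>R a))) (at s)"
proof -
  let ?S = "{x \<in> R. \<alpha> < \<sigma> x \<and> \<sigma> x < \<beta>}"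
  have squ: "square_integrable (lebesgue_on \<Omega>) u"
    using u by (auto simp: H1_def L2_eq_square_integrable)
  note sqg = along_derivative_square_integrable[OF u]
  define q' where "q' = (\<lambda>x. frechet_derivative q (at x) a)"
  define q'' where "q'' = (\<lambda>x. frechet_derivative q' (at x) a)"
  have q': "test_function ?S q'" unfolding q'_def by (rule test_function_frechet_derivative[OF q])
  have q'': "test_function ?S q''" unfolding q''_def by (rule test_function_frechet_derivative[OF q'])
  obtain B where B: "\<And>x. cmod (q'' x) \<le> B" using test_function_bounded[OF q''] by blast
  note sqq = test_function_square_integrable[OF q] and sqq' = test_function_square_integrable[OF q']
  have tr: "square_integrable lebesgue (\<lambda>x. f (x - t *\<^sub>R a))" if "square_integrable lebesgue f" for f t
    using square_integrable_translation[OF that, of "- t *\<^sub>R a"] by simp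
  note intu = integrable_mult_square_integrable[OF tr ext_square_integrable[OF squ]]
  let ?J = "\<lambda>t. LINT x|lebesgue. q x * ext u (x + t *\<^sub>R a)"
  \<comment> \<open>Translated points have \<sigma> in the open interval from
    \<open>\<alpha> + s\<close> to \<open>\<beta> + s\<close>. It lies in the unit interval even at
    the end points of the range of \<open>s\<close>.\<close>
  have "test_function R (\<lambda>x. q (x + (- s) *\<^sub>R a))"
    using s by (intro test_function_translation[OF q]) (auto simp: mem_R_iff)
  then have test: "test_function R (\<lambda>x. q (x - s *\<^sub>R a))" by simp
  have J': "(LINT x|lebesgue. q x * ext (along_derivative G) (x + s *\<^sub>R a))
      = - (LINT x|lebesgue. q' (x - s *\<^sub>R a) * ext u x)"
  proof -
    have "((\<lambda>x. q (x - s *\<^sub>R a)) has_derivative frechet_derivative q (at (x - s *\<^sub>R a))) (at x)" for x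
      using has_derivative_compose[OF has_derivative_diff[OF has_derivative_ident has_derivative_const]
          smooth_has_derivative[OF test_function_smooth[OF q]]] by simp
    then have "frechet_derivative (\<lambda>x. q (x - s *\<^sub>R a)) (at x) = frechet_derivative q (at (x - s *\<^sub>R a))" for x
      using frechet_derivative_at by metis
    then show ?thesis
      using integral_ext_frechet_derivative[OF u test]
      by (simp add: integral_mult_ext_translation[OF sqq sqg] q'_def mult.commute)
  qed
  have "cmod (?J t - ?J s - (t - s) *\<^sub>R - (LINT x|lebesgue. q' (x - s *\<^sub>R a) * ext u x))
      \<le> (B * (LINT x|lebesgue. cmod (ext u x))) * (t - s)\<^sup>2" for t
  proof -
    have rem: "cmod (q (x - t *\<^sub>R a) - q (x - s *\<^sub>R a) - (t - s) *\<^sub>R - q' (x - s *\<^sub>R a)) \<le> B * (t - s)\<^sup>2" for x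
    proof (rule quadratic_remainder)
      show "((\<lambda>t. q (x - t *\<^sub>R a)) has_vector_derivative - q' (x - t *\<^sub>R a)) (at t)" for t
        unfolding q'_def by (rule has_vector_derivative_along_line[OF test_function_smooth[OF q]])
      show "((\<lambda>t. - q' (x - t *\<^sub>R a)) has_vector_derivative q'' (x - t *\<^sub>R a)) (at t)" for t
        using has_vector_derivative_minus[OF has_vector_derivative_along_line[OF test_function_smooth[OF q']]]
        unfolding q''_def by simp
      show "cmod (q'' (x - t *\<^sub>R a)) \<le> B" for t by (rule B)
    qed
    have factor: "A * U - B * U + c *\<^sub>R (C * U) = (A - B - c *\<^sub>R - C) * U" for A B C U :: complex and c
      by (simp add: left_diff_distrib distrib_right)
    let ?r = "\<lambda>x. q (x - t *\<^sub>R a) - q (x - s *\<^sub>R a) - (t - s) *\<^sub>R - q' (x - s *\<^sub>R a)"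
    have "?J t - ?J s - (t - s) *\<^sub>R - (LINT x|lebesgue. q' (x - s *\<^sub>R a) * ext u x)
        = (LINT x|lebesgue. q (x - t *\<^sub>R a) * ext u x - q (x - s *\<^sub>R a) * ext u x
            + (t - s) *\<^sub>R (q' (x - s *\<^sub>R a) * ext u x))"
      unfolding integral_mult_ext_translation[OF sqq squ]
      using intu[OF sqq] intu[OF sqq'] by simp
    then have "?J t - ?J s - (t - s) *\<^sub>R - (LINT x|lebesgue. q' (x - s *\<^sub>R a) * ext u x)
        = (LINT x|lebesgue. ?r x * ext u x)"
      unfolding factor .
    then have "cmod (?J t - ?J s - (t - s) *\<^sub>R - (LINT x|lebesgue. q' (x - s *\<^sub>R a) * ext u x))
        \<le> (LINT x|lebesgue. cmod (?r x * ext u x))"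
      using integral_norm_bound[of lebesgue "\<lambda>x. ?r x * ext u x"] by (simp only:)
    also have "\<dots> \<le> (LINT x|lebesgue. B * (t - s)\<^sup>2 * cmod (ext u x))"
    proof (rule integral_mono)
      have "integrable lebesgue (\<lambda>x. ?r x * ext u x)"
        using Bochner_Integration.integrable_add[OF Bochner_Integration.integrable_diff[OF intu[OF sqq, of t] intu[OF sqq, of s]]
            integrable_scaleR_right[OF intu[OF sqq', of s], of "t - s"]]
        unfolding factor .
      then show "integrable lebesgue (\<lambda>x. cmod (?r x * ext u x))" by (rule integrable_norm)
      show "integrable lebesgue (\<lambda>x. B * (t - s)\<^sup>2 * cmod (ext u x))"
        using integrable_ext[OF squ] by simp
      show "cmod (?r x * ext u x) \<le> B * (t - s)\<^sup>2 * cmod (ext u x)" for x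
        unfolding norm_mult by (rule mult_right_mono[OF rem norm_ge_zero])
    qed
    also have "\<dots> = (B * (LINT x|lebesgue. cmod (ext u x))) * (t - s)\<^sup>2"
      by simp
    finally show ?thesis .
  qed
  then show ?thesis
    unfolding J' by (intro has_vector_derivative_quadratic_bound[of 1]) auto
qed

lemma l2norm_ext_translation:
  assumes "square_integrable (lebesgue_on \<Omega>) f"
  shows "l2norm lebesgue (\<lambda>x. ext f (x + c)) = l2norm lebesgue (ext f)"
  using l2norm_translation[OF ext_square_integrable[OF assms]] .

text \<open>Only the L2 norm of \<open>q\<close> enters the constant, and not its derivatives; this
  lets the bound survive an approximation by test functions.\<close>

lemma translation_Lipschitz_test_function:
  assumes u: "H1 \<Omega> u G" and q: "test_function {x \<in> R. \<alpha> < \<sigma> x \<and> \<sigma> x < \<beta>} q"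
    and st: "s \<in> {- \<alpha>..1 - \<beta>}" "t \<in> {- \<alpha>..1 - \<beta>}"
  shows "cmod ((LINT x|lebesgue. q x * ext u (x + t *\<^sub>R a)) - (LINT x|lebesgue. q x * ext u (x + s *\<^sub>R a)))
    \<le> l2norm lebesgue q * l2norm lebesgue (ext (along_derivative G)) * \<bar>t - s\<bar>"
proof (rule vector_differentiable_bound[where f = "\<lambda>t. LINT x|lebesgue. q x * ext u (x + t *\<^sub>R a)"
      and f' = "\<lambda>r. LINT x|lebesgue. q x * ext (along_derivative G) (x + r *\<^sub>R a)", OF _ _ _ st])
  show "((\<lambda>t. LINT x|lebesgue. q x * ext u (x + t *\<^sub>R a)) has_vector_derivative
      (LINT x|lebesgue. q x * ext (along_derivative G) (x + r *\<^sub>R a))) (at r within {- \<alpha>..1 - \<beta>})"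
    if "r \<in> {- \<alpha>..1 - \<beta>}" for r
    by (rule has_vector_derivative_at_within[OF has_vector_derivative_translation_test_function[OF u q]])
      (use that in auto)
  note sqg = along_derivative_square_integrable[OF u]
  show "cmod (LINT x|lebesgue. q x * ext (along_derivative G) (x + r *\<^sub>R a))
      \<le> l2norm lebesgue q * l2norm lebesgue (ext (along_derivative G))" for r
    using norm_integral_mult_le_l2norm[OF test_function_square_integrable[OF q]
        square_integrable_translation[OF ext_square_integrable[OF sqg]], of "r *\<^sub>R a"]
    by (simp add: l2norm_ext_translation[OF sqg])
qed simp

lemma square_integrable_if:
  assumes "square_integrable lebesgue f" "S \<in> sets lebesgue"
  shows "square_integrable lebesgue (\<lambda>x. if x \<in> S then f x else 0)"
  using square_integrable_restrict[of UNIV f S] assms by (simp add: lebesgue_on_UNIV_eq)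

text \<open>By duality: pairing the difference \<open>w\<close> with a test function close to its
  conjugate turns the bound for pairings into a bound for the norm.\<close>

lemma translation_Lipschitz:
  assumes u: "H1 \<Omega> u G" and \<alpha>\<beta>: "0 \<le> \<alpha>" "\<beta> \<le> 1"
    and st: "s \<in> {- \<alpha>..1 - \<beta>}" "t \<in> {- \<alpha>..1 - \<beta>}"
  shows "l2norm lebesgue (\<lambda>x. if x \<in> {x \<in> R. \<alpha> < \<sigma> x \<and> \<sigma> x < \<beta>} then ext u (x + t *\<^sub>R a) - ext u (x + s *\<^sub>R a) else 0)
    \<le> l2norm lebesgue (ext (along_derivative G)) * \<bar>t - s\<bar>"
proof -
  let ?S = "{x \<in> R. \<alpha> < \<sigma> x \<and> \<sigma> x < \<beta>}"
  define w where "w = (\<lambda>x. if x \<in> ?S then ext u (x + t *\<^sub>R a) - ext u (x + s *\<^sub>R a) else 0)"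
  define D where "D = l2norm lebesgue (ext (along_derivative G)) * \<bar>t - s\<bar>"
  obtain r where r: "exhausting_cutoffs ?S r"
    using exhausting_cutoffs_inner_rectangle[OF \<alpha>\<beta>] by blast
  have squ: "square_integrable (lebesgue_on \<Omega>) u"
    using u by (auto simp: H1_def L2_eq_square_integrable)
  note sqt = square_integrable_translation[OF ext_square_integrable[OF squ]]
  have sqw: "square_integrable lebesgue w"
    unfolding w_def
    by (intro square_integrable_if square_integrable_diff sqt exhausting_cutoffs.S_sets[OF r])
  have app: "L2_approximable ?S (\<lambda>x. cnj (w x))"
    by (rule exhausting_cutoffs.dense[OF r square_integrable_cnj[OF sqw]]) (auto simp: w_def)
  have D0: "0 \<le> D" by (simp add: D_def l2norm_nonneg)
  have W0: "0 \<le> l2norm lebesgue w" by (rule l2norm_nonneg)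
  have bound: "(l2norm lebesgue w)\<^sup>2 \<le> D * l2norm lebesgue w + \<eta> * (D + l2norm lebesgue w)" if \<eta>: "0 < \<eta>" for \<eta>
  proof -
    obtain q where q: "test_function ?S q" and close: "l2norm lebesgue (\<lambda>x. cnj (w x) - q x) < \<eta>"
      using L2_approximable_l2norm[OF app \<eta>] by blast
    note sqq = test_function_square_integrable[OF q]
    have sqd: "square_integrable lebesgue (\<lambda>x. cnj (w x) - q x)"
      by (intro square_integrable_diff square_integrable_cnj sqw sqq)
    have "l2norm lebesgue q = l2norm lebesgue (\<lambda>x. cnj (w x) + - (cnj (w x) - q x))" by simp
    also have "\<dots> \<le> l2norm lebesgue (\<lambda>x. cnj (w x)) + l2norm lebesgue (\<lambda>x. - (cnj (w x) - q x))"
      by (rule l2norm_triangle[OF square_integrable_cnj[OF sqw] square_integrable_uminus[OF sqd]])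
    finally have q_le: "l2norm lebesgue q \<le> l2norm lebesgue w + \<eta>"
      using close unfolding l2norm_uminus l2norm_cnj by linarith
    have qw: "(LINT x|lebesgue. q x * w x)
        = (LINT x|lebesgue. q x * ext u (x + t *\<^sub>R a)) - (LINT x|lebesgue. q x * ext u (x + s *\<^sub>R a))"
    proof -
      have "(LINT x|lebesgue. q x * w x) = (LINT x|lebesgue. q x * ext u (x + t *\<^sub>R a) - q x * ext u (x + s *\<^sub>R a))"
        using test_function_eq_0[OF q]
        by (intro Bochner_Integration.integral_cong) (auto simp: w_def right_diff_distrib)
      then show ?thesis
        using integrable_mult_square_integrable[OF sqq sqt] by simp
    qed
    have "complex_of_real ((l2norm lebesgue w)\<^sup>2) = (LINT x|lebesgue. complex_of_real ((cmod (w x))\<^sup>2))"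
      by (simp only: l2norm_power2 integral_complex_of_real)
    also have "\<dots> = (LINT x|lebesgue. q x * w x + (cnj (w x) - q x) * w x)"
      by (intro Bochner_Integration.integral_cong refl) (simp add: complex_norm_square algebra_simps del: of_real_power)
    also have "\<dots> = (LINT x|lebesgue. q x * w x) + (LINT x|lebesgue. (cnj (w x) - q x) * w x)"
      by (intro Bochner_Integration.integral_add integrable_mult_square_integrable sqq sqw sqd)
    finally have "cmod (complex_of_real ((l2norm lebesgue w)\<^sup>2))
        \<le> cmod (LINT x|lebesgue. q x * w x) + cmod (LINT x|lebesgue. (cnj (w x) - q x) * w x)"
      by (simp only: norm_triangle_ineq)
    also have "\<dots> \<le> l2norm lebesgue q * D + \<eta> * l2norm lebesgue w"
    proof (rule add_mono)
      show "cmod (LINT x|lebesgue. q x * w x) \<le> l2norm lebesgue q * D"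
        using translation_Lipschitz_test_function[OF u q st] by (simp add: qw D_def mult.assoc)
      show "cmod (LINT x|lebesgue. (cnj (w x) - q x) * w x) \<le> \<eta> * l2norm lebesgue w"
        using norm_integral_mult_le_l2norm[OF sqd sqw] mult_right_mono[OF less_imp_le[OF close] W0]
        by linarith
    qed
    also have "\<dots> \<le> (l2norm lebesgue w + \<eta>) * D + \<eta> * l2norm lebesgue w"
      by (intro add_right_mono mult_right_mono q_le D0)
    finally show ?thesis by (simp add: algebra_simps norm_of_real del: of_real_power)
  qed
  \<comment> \<open>The error \<eta> is arbitrary and disappears; dividing by the norm of
    \<open>w\<close> then gives the claim.\<close>
  have "(l2norm lebesgue w)\<^sup>2 \<le> D * l2norm lebesgue w"
  proof (rule field_le_epsilon)
    fix \<epsilon> :: real assume "0 < \<epsilon>"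
    let ?\<eta> = "\<epsilon> / (D + l2norm lebesgue w + 1)"
    have "?\<eta> * (D + l2norm lebesgue w) \<le> \<epsilon>"
      using \<open>0 < \<epsilon>\<close> D0 W0 by (simp add: field_simps)
    then show "(l2norm lebesgue w)\<^sup>2 \<le> D * l2norm lebesgue w + \<epsilon>"
      using bound[of ?\<eta>] \<open>0 < \<epsilon>\<close> D0 W0 by simp
  qed
  then have "l2norm lebesgue w \<le> D"
    using W0 D0 by (cases "l2norm lebesgue w = 0") (auto simp: power2_eq_square)
  then show ?thesis
    by (simp add: w_def D_def)
qed

text \<open>Density extends the derivative formula from test functions to square integrable
  \<open>k\<close>. The Lipschitz estimate makes the error of the difference quotient uniform in
  \<open>t\<close>, so the approximation \<open>q\<close> can be fixed before \<open>t\<close> tends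
  to \<open>s\<close>.\<close>

lemma has_vector_derivative_translation:
  assumes u: "H1 \<Omega> u G" and \<alpha>\<beta>: "0 \<le> \<alpha>" "\<beta> \<le> 1" and s: "- \<alpha> < s" "s < 1 - \<beta>"
    and k: "square_integrable lebesgue k" "\<And>x. x \<notin> {x \<in> R. \<alpha> < \<sigma> x \<and> \<sigma> x < \<beta>} \<Longrightarrow> k x = 0"
  shows "((\<lambda>t. LINT x|lebesgue. k x * ext u (x + t *\<^sub>R a)) has_vector_derivative
    (LINT x|lebesgue. k x * ext (along_derivative G) (x + s *\<^sub>R a))) (at s)"
  unfolding has_vector_derivative_def has_derivative_at_alt
proof (intro conjI allI impI bounded_linear_scaleR_left)
  let ?S = "{x \<in> R. \<alpha> < \<sigma> x \<and> \<sigma> x < \<beta>}"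
  let ?g = "along_derivative G"
  let ?J = "\<lambda>k t. LINT x|lebesgue. k x * ext u (x + t *\<^sub>R a)"
  let ?J' = "\<lambda>k. LINT x|lebesgue. k x * ext ?g (x + s *\<^sub>R a)"
  define D where "D = l2norm lebesgue (ext ?g)"
  have D0: "0 \<le> D" by (simp add: D_def l2norm_nonneg)
  fix \<epsilon> :: real assume "0 < \<epsilon>"
  \<comment> \<open>Two errors of relative size \<open>\<eta> * D\<close> occur, in the difference
    quotient and in the derivative, and share \<epsilon> / 2. The summand 1 covers
    \<open>D = 0\<close>.\<close>
  define \<eta> where "\<eta> = \<epsilon> / (4 * (D + 1))"
  have \<eta>: "0 < \<eta>" "2 * (\<eta> * D) \<le> \<epsilon> / 2"
    using \<open>0 < \<epsilon>\<close> D0 by (simp_all add: \<eta>_def field_simps)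
  obtain r where r: "exhausting_cutoffs ?S r"
    using exhausting_cutoffs_inner_rectangle[OF \<alpha>\<beta>] by blast
  have squ: "square_integrable (lebesgue_on \<Omega>) u"
    using u by (auto simp: H1_def L2_eq_square_integrable)
  note sqg = along_derivative_square_integrable[OF u]
  note sqt = square_integrable_translation[OF ext_square_integrable[OF squ]]
  note sqgt = square_integrable_translation[OF ext_square_integrable[OF sqg]]
  obtain q where q: "test_function ?S q" and close: "l2norm lebesgue (\<lambda>x. k x - q x) < \<eta>"
    using L2_approximable_l2norm[OF exhausting_cutoffs.dense[OF r k] \<eta>(1)] by blast
  note sqq = test_function_square_integrable[OF q]
  have sqd: "square_integrable lebesgue (\<lambda>x. k x - q x)"
    by (intro square_integrable_diff k sqq)
  obtain d where d: "0 < d" "\<And>t. norm (t - s) < d \<Longrightarrow> cmod (?J q t - ?J q s - (t - s) *\<^sub>R ?J' q) \<le> \<epsilon> / 2 * norm (t - s)"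
    using has_vector_derivative_translation_test_function[OF u q] s \<open>0 < \<epsilon>\<close>
    unfolding has_vector_derivative_def has_derivative_at_alt by (meson half_gt_zero less_imp_le)
  have "cmod (?J k t - ?J k s - (t - s) *\<^sub>R ?J' k) \<le> \<epsilon> * norm (t - s)"
    if t: "norm (t - s) < min d (min (s + \<alpha>) (1 - \<beta> - s))" for t
  proof -
    define w where "w = (\<lambda>x. if x \<in> ?S then ext u (x + t *\<^sub>R a) - ext u (x + s *\<^sub>R a) else 0)"
    have sqw: "square_integrable lebesgue w"
      unfolding w_def
      by (intro square_integrable_if square_integrable_diff sqt exhausting_cutoffs.S_sets[OF r])
    have w: "l2norm lebesgue w \<le> D * \<bar>t - s\<bar>"
      unfolding w_def D_def using t s by (intro translation_Lipschitz[OF u \<alpha>\<beta>]) auto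
    have "?J k t - ?J k s - (?J q t - ?J q s) = (LINT x|lebesgue. (k x * ext u (x + t *\<^sub>R a) - k x * ext u (x + s *\<^sub>R a))
        - (q x * ext u (x + t *\<^sub>R a) - q x * ext u (x + s *\<^sub>R a)))"
      using integrable_mult_square_integrable[OF sqq sqt] integrable_mult_square_integrable[OF k(1) sqt] by simp
    also have "\<dots> = (LINT x|lebesgue. (k x - q x) * w x)"
      using test_function_eq_0[OF q] k(2)
      by (intro Bochner_Integration.integral_cong) (auto simp: w_def left_diff_distrib right_diff_distrib)
    finally have eq: "?J k t - ?J k s - (?J q t - ?J q s) = (LINT x|lebesgue. (k x - q x) * w x)" .
    have 1: "cmod (?J k t - ?J k s - (?J q t - ?J q s)) \<le> \<eta> * (D * \<bar>t - s\<bar>)"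
      unfolding eq
      by (rule order_trans[OF norm_integral_mult_le_l2norm[OF sqd sqw]
            mult_mono[OF less_imp_le[OF close] w less_imp_le[OF \<eta>(1)] l2norm_nonneg]])
    have "?J' k - ?J' q = (LINT x|lebesgue. (k x - q x) * ext ?g (x + s *\<^sub>R a))"
      using integrable_mult_square_integrable[OF sqq sqgt] integrable_mult_square_integrable[OF k(1) sqgt]
      by (simp add: left_diff_distrib)
    then have "cmod (?J' k - ?J' q) \<le> \<eta> * D"
      using norm_integral_mult_le_l2norm[OF sqd sqgt, of "s *\<^sub>R a"] l2norm_ext_translation[OF sqg, of "s *\<^sub>R a"]
        mult_right_mono[OF less_imp_le[OF close] D0] by (simp add: D_def)
    then have 2: "cmod ((t - s) *\<^sub>R (?J' k - ?J' q)) \<le> \<bar>t - s\<bar> * (\<eta> * D)"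
      by (simp add: mult_left_mono)
    have tri: "cmod (A + B - C) \<le> cmod A + cmod B + cmod C" for A B C
      using norm_triangle_ineq4[of "A + B" C] norm_triangle_ineq[of A B] by linarith
    have "?J k t - ?J k s - (t - s) *\<^sub>R ?J' k = (?J q t - ?J q s - (t - s) *\<^sub>R ?J' q)
        + (?J k t - ?J k s - (?J q t - ?J q s)) - (t - s) *\<^sub>R (?J' k - ?J' q)"
      by (simp add: scaleR_right_diff_distrib)
    then have "cmod (?J k t - ?J k s - (t - s) *\<^sub>R ?J' k)
        \<le> cmod (?J q t - ?J q s - (t - s) *\<^sub>R ?J' q) + cmod (?J k t - ?J k s - (?J q t - ?J q s))
          + cmod ((t - s) *\<^sub>R (?J' k - ?J' q))"
      by (simp only: tri)
    also have "\<dots> \<le> \<epsilon> / 2 * \<bar>t - s\<bar> + \<eta> * (D * \<bar>t - s\<bar>) + \<bar>t - s\<bar> * (\<eta> * D)"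
      using d(2)[of t] t 1 2 by (intro add_mono) auto
    also have "\<dots> = (\<epsilon> / 2 + 2 * (\<eta> * D)) * \<bar>t - s\<bar>"
      by (simp add: algebra_simps)
    also have "\<dots> \<le> \<epsilon> * \<bar>t - s\<bar>"
      using \<eta>(2) by (intro mult_right_mono) auto
    finally show ?thesis by simp
  qed
  then show "\<exists>d>0. \<forall>t. norm (t - s) < d \<longrightarrow> cmod (?J k t - ?J k s - (t - s) *\<^sub>R ?J' k) \<le> \<epsilon> * norm (t - s)"
    using d(1) s by (intro exI[of _ "min d (min (s + \<alpha>) (1 - \<beta> - s))"]) auto
qed

end

section \<open>Correlations\<close>

lemma l2norm_scaleR_le:
  fixes f :: "plane \<Rightarrow> complex"
  assumes "square_integrable lebesgue f" "continuous_on UNIV m" "\<And>x. \<bar>m x\<bar> \<le> B"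
  shows "l2norm lebesgue (\<lambda>x. m x *\<^sub>R f x) \<le> B * l2norm lebesgue f"
proof -
  have "0 \<le> B" using assms(3) abs_ge_zero order_trans by blast
  then show ?thesis
    using real_sqrt_le_mono[OF square_integrable_scaleR_bounded(2)[OF assms]]
    by (simp add: l2norm_def real_sqrt_mult)
qed

context rectangular_part
begin

text \<open>Both factors move with \<open>t\<close>, while differentiation is available only against
  a fixed square integrable function. Hence one factor is frozen at \<open>e\<close> at a time:
  \<open>F1\<close> and \<open>F2\<close> carry the first order terms, and \<open>F3\<close>, the
  integral of a product of two differences, is of second order by the Lipschitz estimate. The first
  order terms cancel by the Wronskian identity.\<close>

lemma correlation_has_vector_derivative_0:
  assumes \<phi>: "profile \<phi> \<phi>' \<alpha> \<beta>" and h: "0 \<le> h" "h < \<alpha>" "h < 1 - \<beta>" and e: "\<bar>e\<bar> \<le> h"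
    and u: "weak_eigenfunction bc m u G"
  shows "((\<lambda>t. LINT x|lebesgue. \<phi>' (\<sigma> x) *\<^sub>R (ext u (x - t *\<^sub>R a) * cnj (ext u (x + t *\<^sub>R a))))
    has_vector_derivative 0) (at e)"
proof -
  let ?g = "along_derivative G"
  note H1 = weak_eigenfunction_H1[OF u]
  then have squ: "square_integrable (lebesgue_on \<Omega>) u"
    by (auto simp: H1_def L2_eq_square_integrable)
  note sqt = square_integrable_translation[OF ext_square_integrable[OF squ]]
  have sqt': "square_integrable lebesgue (\<lambda>x. ext u (x - t *\<^sub>R a))" for t
    using sqt[of "- t *\<^sub>R a"] by simp
  obtain B where B: "\<And>s. \<bar>\<phi>' s\<bar> \<le> B" using profile_bounded[OF \<phi>] by metis
  have B0: "0 \<le> B" using B abs_ge_zero order_trans by blast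
  have cont: "continuous_on UNIV (\<lambda>x. \<phi>' (\<sigma> x))"
    using smooth_continuous[OF smooth_compose_coord[OF profile_smooth'[OF \<phi>]]] .
  note sqm = square_integrable_scaleR_bounded(1)[OF _ cont B]
  \<comment> \<open>Chosen strictly between \<open>h\<close> and \<alpha>, and
    \<open>\<beta>0\<close> strictly between \<beta> and \<open>1 - h\<close>, to leave room for
    \<open>t\<close> beyond \<open>e\<close> even when the absolute value of \<open>e\<close> is
    \<open>h\<close>.\<close>
  define \<alpha>0 where "\<alpha>0 = (\<alpha> + h) / 2"
  define \<beta>0 where "\<beta>0 = (\<beta> + 1 - h) / 2"
  have \<alpha>0: "h < \<alpha>0" "\<alpha>0 < \<alpha>" "0 \<le> \<alpha>0" and \<beta>0: "\<beta> < \<beta>0" "\<beta>0 < 1 - h" "\<beta>0 \<le> 1"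
    using h by (auto simp: \<alpha>0_def \<beta>0_def)
  let ?S = "{x \<in> R. \<alpha>0 < \<sigma> x \<and> \<sigma> x < \<beta>0}"
  have zero: "\<phi>' (\<sigma> x) *\<^sub>R cnj (ext u (x + t *\<^sub>R a)) = 0" if "x \<notin> ?S" "\<bar>t\<bar> \<le> h" for x t
  proof (cases "\<alpha> \<le> \<sigma> x \<and> \<sigma> x \<le> \<beta>")
    case True
    then have "x \<notin> R" using that(1) \<alpha>0 \<beta>0 by auto
    moreover have "admissible \<alpha> \<beta> t" using that(2) h by (auto simp: admissible_def)
    ultimately have "x + t *\<^sub>R a \<notin> R" using admissible_mem_R True by blast
    then show ?thesis by (simp add: ext_def)
  next
    case False
    then show ?thesis using profile_derivative_eq_0[OF \<phi>, of "\<sigma> x"] by auto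
  qed
  define k1 where "k1 = (\<lambda>x. \<phi>' (\<sigma> x) *\<^sub>R cnj (ext u (x + e *\<^sub>R a)))"
  define k2 where "k2 = (\<lambda>x. \<phi>' (\<sigma> x) *\<^sub>R cnj (ext u (x - e *\<^sub>R a)))"
  have k1: "square_integrable lebesgue k1" "\<And>x. x \<notin> ?S \<Longrightarrow> k1 x = 0"
    unfolding k1_def using sqm[OF square_integrable_cnj[OF sqt]] zero e by auto
  have k2: "square_integrable lebesgue k2" "\<And>x. x \<notin> ?S \<Longrightarrow> k2 x = 0"
    unfolding k2_def using sqm[OF square_integrable_cnj[OF sqt']] zero[of _ "- e"] e by auto
  define F1 where "F1 t = (LINT x|lebesgue. k1 x * ext u (x + t *\<^sub>R a))" for t
  define F2 where "F2 t = (LINT x|lebesgue. k2 x * ext u (x + t *\<^sub>R a))" for t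
  define F3 where "F3 t = (LINT x|lebesgue. \<phi>' (\<sigma> x) *\<^sub>R ((ext u (x - t *\<^sub>R a) - ext u (x - e *\<^sub>R a))
      * cnj (ext u (x + t *\<^sub>R a) - ext u (x + e *\<^sub>R a))))" for t
  define L where "L t = (LINT x|lebesgue. \<phi>' (\<sigma> x) *\<^sub>R (ext u (x - t *\<^sub>R a) * cnj (ext u (x + t *\<^sub>R a))))" for t
  have "(F1 has_vector_derivative (LINT x|lebesgue. k1 x * ext ?g (x + (- e) *\<^sub>R a))) (at (- e))"
    unfolding F1_def using e \<alpha>0 \<beta>0
    by (intro has_vector_derivative_translation[OF H1 \<alpha>0(3) \<beta>0(3) _ _ k1]) auto
  then have dF1: "((F1 \<circ> uminus) has_vector_derivative (- 1) *\<^sub>R (LINT x|lebesgue. k1 x * ext ?g (x + (- e) *\<^sub>R a))) (at e)"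
    by (intro vector_diff_chain_at) (auto intro!: derivative_eq_intros)
  have "(F2 has_vector_derivative (LINT x|lebesgue. k2 x * ext ?g (x + e *\<^sub>R a))) (at e)"
    unfolding F2_def using e \<alpha>0 \<beta>0
    by (intro has_vector_derivative_translation[OF H1 \<alpha>0(3) \<beta>0(3) _ _ k2]) auto
  then have dF2: "((\<lambda>t. cnj (F2 t)) has_vector_derivative cnj (LINT x|lebesgue. k2 x * ext ?g (x + e *\<^sub>R a))) (at e)"
    by (rule bounded_linear.has_vector_derivative[OF bounded_linear_cnj])
  define D where "D = l2norm lebesgue (ext ?g)"
  have dF3: "(F3 has_vector_derivative 0) (at e)"
  proof (rule has_vector_derivative_quadratic_bound)
    show "0 < min (\<alpha>0 - h) (1 - \<beta>0 - h)" using \<alpha>0 \<beta>0 by simp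
    fix t assume t: "\<bar>t - e\<bar> < min (\<alpha>0 - h) (1 - \<beta>0 - h)"
    obtain r where r: "exhausting_cutoffs ?S r"
      using exhausting_cutoffs_inner_rectangle[OF \<alpha>0(3) \<beta>0(3)] by blast
    define w where "w s s' = (\<lambda>x. if x \<in> ?S then ext u (x + s *\<^sub>R a) - ext u (x + s' *\<^sub>R a) else 0)" for s s'
    have sqw: "square_integrable lebesgue (w s s')" for s s'
      unfolding w_def
      by (intro square_integrable_if square_integrable_diff sqt exhausting_cutoffs.S_sets[OF r])
    have w: "l2norm lebesgue (w s s') \<le> D * \<bar>s - s'\<bar>" if "s' \<in> {- \<alpha>0..1 - \<beta>0}" "s \<in> {- \<alpha>0..1 - \<beta>0}" for s s'
      unfolding w_def D_def by (rule translation_Lipschitz[OF H1 \<alpha>0(3) \<beta>0(3) that])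
    have w1: "l2norm lebesgue (w (- t) (- e)) \<le> D * \<bar>t - e\<bar>" and w2: "l2norm lebesgue (w t e) \<le> D * \<bar>t - e\<bar>"
    proof -
      have "t \<in> {- \<alpha>0..1 - \<beta>0}" "e \<in> {- \<alpha>0..1 - \<beta>0}" "- t \<in> {- \<alpha>0..1 - \<beta>0}" "- e \<in> {- \<alpha>0..1 - \<beta>0}"
        using t e \<alpha>0 \<beta>0 unfolding min_less_iff_conj atLeastAtMost_iff by linarith+
      then show "l2norm lebesgue (w (- t) (- e)) \<le> D * \<bar>t - e\<bar>" "l2norm lebesgue (w t e) \<le> D * \<bar>t - e\<bar>"
        using w[of "- e" "- t"] w[of e t] by (simp_all add: abs_minus_commute)
    qed
    have "F3 t = (LINT x|lebesgue. \<phi>' (\<sigma> x) *\<^sub>R w (- t) (- e) x * cnj (w t e x))"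
      unfolding F3_def
    proof (rule Bochner_Integration.integral_cong[OF refl])
      fix x
      have ext0: "\<phi>' (\<sigma> x) = 0 \<or> (ext u (x - t *\<^sub>R a) = 0 \<and> ext u (x - e *\<^sub>R a) = 0)" if "x \<notin> ?S"
      proof (cases "\<alpha> \<le> \<sigma> x \<and> \<sigma> x \<le> \<beta>")
        case True
        then have "x \<notin> R" using that \<alpha>0 \<beta>0 by auto
        then have notin: "x - s *\<^sub>R a \<notin> R" if "\<bar>s\<bar> < \<alpha>0" "\<bar>s\<bar> < 1 - \<beta>0" for s
          using True that \<alpha>0 \<beta>0 by (auto simp: mem_R_iff)
        show ?thesis
        proof -
          have "\<bar>t\<bar> < \<alpha>0" "\<bar>t\<bar> < 1 - \<beta>0" "\<bar>e\<bar> < \<alpha>0" "\<bar>e\<bar> < 1 - \<beta>0"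
            using t e \<alpha>0 \<beta>0 unfolding min_less_iff_conj by linarith+
          then show ?thesis
            using notin by (simp add: ext_def)
        qed
      next
        case False
        then show ?thesis using profile_derivative_eq_0[OF \<phi>, of "\<sigma> x"] by auto
      qed
      then show "\<phi>' (\<sigma> x) *\<^sub>R ((ext u (x - t *\<^sub>R a) - ext u (x - e *\<^sub>R a)) * cnj (ext u (x + t *\<^sub>R a) - ext u (x + e *\<^sub>R a)))
          = \<phi>' (\<sigma> x) *\<^sub>R w (- t) (- e) x * cnj (w t e x)"
        by (cases "x \<in> ?S") (auto simp: w_def)
    qed
    then have "cmod (F3 t) \<le> l2norm lebesgue (\<lambda>x. \<phi>' (\<sigma> x) *\<^sub>R w (- t) (- e) x) * l2norm lebesgue (\<lambda>x. cnj (w t e x))"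
      using norm_integral_mult_le_l2norm[OF sqm[OF sqw] square_integrable_cnj[OF sqw]] by simp
    also have "\<dots> \<le> (B * (D * \<bar>t - e\<bar>)) * (D * \<bar>t - e\<bar>)"
    proof (rule mult_mono)
      show "l2norm lebesgue (\<lambda>x. \<phi>' (\<sigma> x) *\<^sub>R w (- t) (- e) x) \<le> B * (D * \<bar>t - e\<bar>)"
        using l2norm_scaleR_le[OF sqw cont B] mult_left_mono[OF w1 B0] by (rule order_trans)
      show "l2norm lebesgue (\<lambda>x. cnj (w t e x)) \<le> D * \<bar>t - e\<bar>"
        unfolding l2norm_cnj by (rule w2)
    qed (simp_all add: l2norm_nonneg B0 D_def)
    also have "\<dots> = (B * D * D) * (t - e)\<^sup>2"
      by (simp add: power2_eq_square flip: abs_mult)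
    finally have "cmod (F3 t) \<le> (B * D * D) * (t - e)\<^sup>2" .
    moreover have "F3 e = 0" by (simp add: F3_def)
    ultimately show "cmod (F3 t - F3 e - (t - e) *\<^sub>R 0) \<le> (B * D * D) * (t - e)\<^sup>2" by simp
  qed
  have "L t = (F1 \<circ> uminus) t + cnj (F2 t) + F3 t - L e" for t
  proof -
    have int: "integrable lebesgue (\<lambda>x. \<phi>' (\<sigma> x) *\<^sub>R (ext u (x - s *\<^sub>R a) * cnj (ext u (x + s' *\<^sub>R a))))" for s s'
      using integrable_mult_square_integrable[OF sqm[OF sqt'] square_integrable_cnj[OF sqt]] by simp
    have F1: "(F1 \<circ> uminus) t = (LINT x|lebesgue. \<phi>' (\<sigma> x) *\<^sub>R (ext u (x - t *\<^sub>R a) * cnj (ext u (x + e *\<^sub>R a))))"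
      by (simp add: F1_def k1_def mult.commute)
    have F2: "cnj (F2 t) = (LINT x|lebesgue. \<phi>' (\<sigma> x) *\<^sub>R (ext u (x - e *\<^sub>R a) * cnj (ext u (x + t *\<^sub>R a))))"
      by (simp add: F2_def k2_def flip: Bochner_Integration.integral_cnj)
    have "\<phi>' (\<sigma> x) *\<^sub>R ((ext u (x - t *\<^sub>R a) - ext u (x - e *\<^sub>R a)) * cnj (ext u (x + t *\<^sub>R a) - ext u (x + e *\<^sub>R a)))
      = \<phi>' (\<sigma> x) *\<^sub>R (ext u (x - t *\<^sub>R a) * cnj (ext u (x + t *\<^sub>R a)))
        - \<phi>' (\<sigma> x) *\<^sub>R (ext u (x - t *\<^sub>R a) * cnj (ext u (x + e *\<^sub>R a)))
        - \<phi>' (\<sigma> x) *\<^sub>R (ext u (x - e *\<^sub>R a) * cnj (ext u (x + t *\<^sub>R a)))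
        + \<phi>' (\<sigma> x) *\<^sub>R (ext u (x - e *\<^sub>R a) * cnj (ext u (x + e *\<^sub>R a)))" for x
      by (simp add: left_diff_distrib right_diff_distrib scaleR_right_diff_distrib)
    then have "F3 t = L t - (F1 \<circ> uminus) t - cnj (F2 t) + L e"
      unfolding F3_def F1 F2 L_def
      by (simp only: Bochner_Integration.integral_add Bochner_Integration.integral_diff int
          Bochner_Integration.integrable_diff Bochner_Integration.integrable_add)
    then show ?thesis by simp
  qed
  then have "L = (\<lambda>t. (F1 \<circ> uminus) t + cnj (F2 t) + F3 t - L e)" by blast
  moreover have "((\<lambda>t. (F1 \<circ> uminus) t + cnj (F2 t) + F3 t - L e) has_vector_derivative
      (- 1) *\<^sub>R (LINT x|lebesgue. k1 x * ext ?g (x + (- e) *\<^sub>R a)) + cnj (LINT x|lebesgue. k2 x * ext ?g (x + e *\<^sub>R a)) + 0 - 0) (at e)"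
    by (intro has_vector_derivative_add has_vector_derivative_diff dF1 dF2 dF3 has_vector_derivative_const)
  moreover have "(- 1) *\<^sub>R (LINT x|lebesgue. k1 x * ext ?g (x + (- e) *\<^sub>R a)) + cnj (LINT x|lebesgue. k2 x * ext ?g (x + e *\<^sub>R a)) + 0 - 0 = 0"
  proof -
    have "(LINT x|lebesgue. k1 x * ext ?g (x + (- e) *\<^sub>R a))
        = (LINT x|lebesgue. \<phi>' (\<sigma> x) *\<^sub>R (ext ?g (x - e *\<^sub>R a) * cnj (ext u (x + e *\<^sub>R a))))"
      by (simp add: k1_def mult.commute)
    also have "\<dots> = (LINT x|lebesgue. \<phi>' (\<sigma> x) *\<^sub>R (ext u (x - e *\<^sub>R a) * cnj (ext ?g (x + e *\<^sub>R a))))"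
      using e h by (intro wronskian_centered[OF \<phi> _ _ u]) auto
    also have "\<dots> = cnj (LINT x|lebesgue. k2 x * ext ?g (x + e *\<^sub>R a))"
      by (simp add: k2_def flip: Bochner_Integration.integral_cnj)
    finally show ?thesis by simp
  qed
  ultimately have "(L has_vector_derivative 0) (at e)" by metis
  then show ?thesis unfolding L_def[abs_def] .
qed

text \<open>Integrates the vanishing derivative from 0 to \<open>h\<close>. For
  \<open>\<phi>'\<close> a difference of two bumps this is the averaged four point identity of the
  wave equation.\<close>

lemma correlation_constant:
  assumes \<phi>: "profile \<phi> \<phi>' \<alpha> \<beta>" and h: "0 \<le> h" "h < \<alpha>" "h < 1 - \<beta>"
    and u: "weak_eigenfunction bc m u G"
  shows "(LINT x|lebesgue. \<phi>' (\<sigma> x) *\<^sub>R (ext u (x - h *\<^sub>R a) * cnj (ext u (x + h *\<^sub>R a))))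
    = (LINT x|lebesgue. \<phi>' (\<sigma> x) *\<^sub>R (ext u x * cnj (ext u x)))"
proof -
  define L where "L t = (LINT x|lebesgue. \<phi>' (\<sigma> x) *\<^sub>R (ext u (x - t *\<^sub>R a) * cnj (ext u (x + t *\<^sub>R a))))" for t
  have "norm (L h - L 0) \<le> 0 * \<bar>h - 0\<bar>"
  proof (rule vector_differentiable_bound[where f = L and f' = "\<lambda>t. 0" and S = "{0..h}"])
    show "(L has_vector_derivative 0) (at t within {0..h})" if "t \<in> {0..h}" for t
      unfolding L_def
      by (rule has_vector_derivative_at_within[OF correlation_has_vector_derivative_0[OF \<phi> h _ u]])
        (use that in auto)
  qed (use h in auto)
  then show ?thesis by (simp add: L_def)
qed

end

section \<open>Bump weights and their antiderivatives\<close>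

definition bump :: "real \<Rightarrow> real \<Rightarrow> real" where
  "bump h s = cutoff (s / h + 1) * cutoff (- s / h + 1)"

lemma bump_nonneg: "0 \<le> bump h s" and bump_le_1: "bump h s \<le> 1"
  by (simp_all add: bump_def cutoff_nonneg cutoff_le_1 mult_le_one)

lemma smooth_bump: "smooth (bump h)"
proof -
  have "smooth (\<lambda>s. cutoff (inverse h * s + 1) * cutoff (- inverse h * s + 1))"
    by (intro smooth_mult smooth_compose_affine[OF bounded_linear_mult_right smooth_cutoff])
  then show ?thesis
    by (simp add: bump_def[abs_def] divide_inverse mult.commute)
qed

lemma bump_eq_0: "0 < h \<Longrightarrow> h \<le> \<bar>s\<bar> \<Longrightarrow> bump h s = 0"
  by (auto simp: bump_def cutoff_eq field_simps abs_if split: if_splits)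

text \<open>Within distance \<open>h / 2\<close> of the centre both factors have arguments at least
  1 / 2, where \<open>cutoff\<close> is at least \<open>exp (- 2)\<close>.\<close>

lemma bump_ge:
  assumes "0 < h" "\<bar>s\<bar> \<le> h / 2"
  shows "exp (- 4) \<le> bump h s"
proof -
  have "exp (- 2) \<le> cutoff r" if "1 / 2 \<le> r" for r
    using that by (auto simp: cutoff_eq field_simps)
  moreover have "1 / 2 \<le> s / h + 1" "1 / 2 \<le> - s / h + 1"
    using assms by (auto simp: field_simps abs_if split: if_splits)
  ultimately have "exp (- 2) * exp (- 2) \<le> bump h s"
    unfolding bump_def by (intro mult_mono cutoff_nonneg) auto
  then show ?thesis by (simp flip: exp_add)
qed

text \<open>An antiderivative of one bump is constant on either side of it, with different
  constants. For two translates of the same bump these constants cancel on both sides, which makes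
  the difference compactly supported.\<close>

lemma bump_difference_profile:
  assumes "0 < h" "x \<le> y"
  shows "\<exists>\<phi>. profile \<phi> (\<lambda>s. bump h (s - y) - bump h (s - x)) (x - h) (y + h)"
proof -
  have "isCont (bump h) s" for s
    using smooth_continuous[OF smooth_bump] by (simp add: continuous_on_eq_continuous_at)
  then obtain \<Phi> where \<Phi>: "\<And>s. (\<Phi> has_vector_derivative bump h s) (at s)"
    using einterval_antiderivative[of "- \<infinity>" "\<infinity>" "bump h"] by auto
  have const: "\<Phi> s = \<Phi> t" if "convex S" "s \<in> S" "t \<in> S" "\<And>r. r \<in> S \<Longrightarrow> h \<le> \<bar>r\<bar>" for S s t
  proof -
    have "norm (\<Phi> s - \<Phi> t) \<le> 0 * \<bar>s - t\<bar>"
    proof (rule vector_differentiable_bound[where S = S and f' = "bump h"])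
      show "(\<Phi> has_vector_derivative bump h r) (at r within S)" for r
        by (rule has_vector_derivative_at_within[OF \<Phi>])
      show "norm (bump h r) \<le> 0" if "r \<in> S" for r
        using bump_eq_0[OF assms(1) \<open>\<And>r. r \<in> S \<Longrightarrow> h \<le> \<bar>r\<bar>\<close>[OF that]] by simp
    qed (use that in auto)
    then show ?thesis by simp
  qed
  have "profile (\<lambda>s. \<Phi> (s - y) - \<Phi> (s - x)) (\<lambda>s. bump h (s - y) - bump h (s - x)) (x - h) (y + h)"
    unfolding profile_def
  proof (intro conjI allI impI)
    have "(\<Phi> has_real_derivative bump h s) (at s)" for s
      using \<Phi> by (simp add: has_real_derivative_iff_has_vector_derivative)
    then have sh: "((\<lambda>s. \<Phi> (s - c)) has_real_derivative bump h (s - c)) (at s)" for s c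
      using DERIV_shift[of \<Phi> "bump h (s - c)" s "- c"] by simp
    show "((\<lambda>s. \<Phi> (s - y) - \<Phi> (s - x)) has_real_derivative bump h (s - y) - bump h (s - x)) (at s)" for s
      by (intro DERIV_diff sh)
    have "smooth (\<lambda>s. bump h (s - c))" for c
      using smooth_compose_affine[OF bounded_linear_ident smooth_bump, of h "- c"] by simp
    from smooth_add[OF this smooth_bounded_linear[OF bounded_linear_minus[OF bounded_linear_ident] this]]
    show "smooth (\<lambda>s. bump h (s - y) - bump h (s - x))" by simp
    show "\<Phi> (s - y) - \<Phi> (s - x) = 0" if "s < x - h \<or> y + h < s" for s
      using that
    proof
      assume "s < x - h"
      then show ?thesis using assms const[of "{..- h}" "s - y" "s - x"] by auto
    next
      assume "y + h < s"
      then show ?thesis using assms const[of "{h..}" "s - y" "s - x"] by auto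
    qed
  qed
  then show ?thesis by blast
qed

section \<open>Sequences that are logarithmically convex up to an error\<close>

definition log_convex_between :: "nat \<Rightarrow> (nat \<Rightarrow> real) \<Rightarrow> real \<Rightarrow> bool" where
  "log_convex_between N m \<delta> \<longleftrightarrow> 0 \<le> \<delta> \<and> (\<forall>i\<le>N. 0 \<le> m i) \<and> m 0 \<le> \<delta> \<and> m N \<le> \<delta> \<and>
     (\<forall>i. 1 \<le> i \<longrightarrow> i < N \<longrightarrow> m i \<le> 2 * \<delta> + sqrt (m (i - 1) * m (i + 1)))"

text \<open>Induction on how far the bound has advanced, for all \<kappa> at once. The last index
  reached satisfies it with \<kappa> squared; in the geometric mean its value is divided by \<kappa>
  and the value to its right multiplied by \<kappa>. Both then contribute
  \<open>\<kappa> * M\<close>, and averaging reproduces the coefficient \<kappa>.\<close>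

lemma log_convex_between_bound_aux:
  assumes "0 < \<kappa>"
  shows "\<exists>C\<ge>1. \<forall>m \<delta> M i. log_convex_between N m \<delta> \<longrightarrow> (\<forall>i\<le>N. m i \<le> M) \<longrightarrow> i \<le> j \<longrightarrow> i < N \<longrightarrow>
    m i \<le> C * \<delta> + \<kappa> * M"
  using assms
proof (induction j arbitrary: \<kappa>)
  case 0
  show ?case
  proof (intro exI[of _ 1] conjI allI impI)
    fix m \<delta> M i
    assume m: "log_convex_between N m \<delta>" "\<forall>i\<le>N. m i \<le> M" "i \<le> (0::nat)"
    then have "m i \<le> \<delta>" "0 \<le> m 0" "m 0 \<le> M" by (auto simp: log_convex_between_def)
    moreover from this have "0 \<le> \<kappa> * M" using 0 by (intro mult_nonneg_nonneg) auto
    ultimately show "m i \<le> 1 * \<delta> + \<kappa> * M" by simp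
  qed simp
next
  case (Suc j)
  obtain C where C: "1 \<le> C" "\<And>m \<delta> M i. log_convex_between N m \<delta> \<Longrightarrow> \<forall>i\<le>N. m i \<le> M \<Longrightarrow> i \<le> j \<Longrightarrow> i < N \<Longrightarrow>
      m i \<le> C * \<delta> + \<kappa> * M"
    using Suc.IH[OF Suc.prems] by blast
  have "0 < \<kappa>\<^sup>2" using Suc.prems by simp
  then obtain C' where C': "\<And>m \<delta> M i. log_convex_between N m \<delta> \<Longrightarrow> \<forall>i\<le>N. m i \<le> M \<Longrightarrow> i \<le> j \<Longrightarrow> i < N \<Longrightarrow>
      m i \<le> C' * \<delta> + \<kappa>\<^sup>2 * M"
    using Suc.IH[of "\<kappa>\<^sup>2"] by blast
  let ?C = "max C (2 + C' / (2 * \<kappa>))"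
  show ?case
  proof (intro exI[of _ ?C] conjI allI impI)
    show "1 \<le> ?C" using C(1) by auto
    fix m \<delta> M i
    assume lc: "log_convex_between N m \<delta>" and M: "\<forall>i\<le>N. m i \<le> M" and i: "i \<le> Suc j" "i < N"
    have \<delta>: "0 \<le> \<delta>" and m: "\<forall>i\<le>N. 0 \<le> m i"
      and rec: "\<And>i. 1 \<le> i \<Longrightarrow> i < N \<Longrightarrow> m i \<le> 2 * \<delta> + sqrt (m (i - 1) * m (i + 1))"
      using lc by (auto simp: log_convex_between_def)
    show "m i \<le> ?C * \<delta> + \<kappa> * M"
    proof (cases "i \<le> j")
      case True
      then have "m i \<le> C * \<delta> + \<kappa> * M"
        using C(2)[OF lc M] i by blast
      also have "\<dots> \<le> ?C * \<delta> + \<kappa> * M" using \<delta> by (simp add: mult_right_mono)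
      finally show ?thesis .
    next
      case False
      then have i: "i = Suc j" "Suc j < N" using i by auto
      have mj: "m j \<le> C' * \<delta> + \<kappa>\<^sup>2 * M"
        using C'[OF lc M, of j] i by simp
      have nn: "0 \<le> m j" "0 \<le> m (Suc (Suc j))" "m (Suc (Suc j)) \<le> M" using m M i by auto
      have "sqrt (m j * m (Suc (Suc j))) = sqrt ((m j / \<kappa>) * (\<kappa> * m (Suc (Suc j))))"
        using Suc.prems by simp
      also have "\<dots> \<le> (m j / \<kappa> + \<kappa> * m (Suc (Suc j))) / 2"
        using nn Suc.prems by (intro arith_geo_mean_sqrt) auto
      also have "\<dots> \<le> ((C' * \<delta> + \<kappa>\<^sup>2 * M) / \<kappa> + \<kappa> * M) / 2"
        using mj nn Suc.prems by (intro divide_right_mono add_mono mult_left_mono) auto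
      also have "\<dots> = C' / (2 * \<kappa>) * \<delta> + \<kappa> * M"
        using Suc.prems by (simp add: field_simps power2_eq_square)
      finally have "m i \<le> 2 * \<delta> + (C' / (2 * \<kappa>) * \<delta> + \<kappa> * M)"
        using rec[of i] i by simp
      also have "\<dots> = (2 + C' / (2 * \<kappa>)) * \<delta> + \<kappa> * M" by (simp add: algebra_simps)
      also have "\<dots> \<le> ?C * \<delta> + \<kappa> * M" using \<delta> by (intro add_right_mono mult_right_mono) auto
      finally show ?thesis .
    qed
  qed
qed

text \<open>With \<kappa> equal to 1 / 2, the bound at an index where the maximum is attained can be
  absorbed. The index \<open>N\<close>, which has no right neighbour, is left out of the auxiliary
  bound and handled directly.\<close>

lemma log_convex_between_bound:
  "\<exists>C\<ge>0. \<forall>m \<delta> i. log_convex_between N m \<delta> \<longrightarrow> i \<le> N \<longrightarrow> m i \<le> C * \<delta>"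
proof -
  obtain C where "1 \<le> C" and C: "\<And>m \<delta> M i. log_convex_between N m \<delta> \<Longrightarrow> \<forall>i\<le>N. m i \<le> M \<Longrightarrow> i \<le> N \<Longrightarrow> i < N \<Longrightarrow>
      m i \<le> C * \<delta> + 1 / 2 * M"
    using log_convex_between_bound_aux[of "1 / 2" N N] by auto
  show ?thesis
  proof (intro exI[of _ "2 * C"] conjI allI impI)
    show "0 \<le> 2 * C" using \<open>1 \<le> C\<close> by simp
    fix m \<delta> i
    assume lc: "log_convex_between N m \<delta>" and i: "i \<le> N"
    define M where "M = Max (m ` {..N})"
    have M: "\<forall>i\<le>N. m i \<le> M" by (auto simp: M_def)
    have \<delta>: "0 \<le> \<delta>" "m N \<le> \<delta>" using lc by (auto simp: log_convex_between_def)
    have "M \<in> m ` {..N}" unfolding M_def by (intro Max_in) auto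
    then obtain i0 where i0: "i0 \<le> N" "M = m i0" by auto
    have "M \<le> 2 * C * \<delta>"
    proof (cases "i0 = N")
      case True
      then have "M \<le> 1 * \<delta>" using i0 \<delta> by simp
      also have "\<dots> \<le> 2 * C * \<delta>" using \<open>1 \<le> C\<close> \<delta> by (intro mult_right_mono) auto
      finally show ?thesis .
    next
      case False
      then have "M \<le> C * \<delta> + 1 / 2 * M" using C[OF lc M, of i0] i0 by simp
      then show ?thesis by simp
    qed
    then show "m i \<le> 2 * C * \<delta>" using M i by (meson order_trans)
  qed
qed

section \<open>The estimate\<close>

context rectangular_part
begin

text \<open>The averaged form of the diagonal value \<open>P(c, c)\<close> of the overview, weighted
  by a bump around \<open>\<sigma> = c\<close>.\<close>

definition mass :: "real \<Rightarrow> (plane \<Rightarrow> complex) \<Rightarrow> real \<Rightarrow> real" where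
  "mass h u c = (LINT x|lebesgue. bump h (\<sigma> x - c) * (cmod (ext u x))\<^sup>2)"

lemma smooth_bump_coord: "smooth (\<lambda>x. bump h (\<sigma> x - c))"
proof -
  have "smooth (\<lambda>s. bump h (s - c))"
    using smooth_compose_affine[OF bounded_linear_ident smooth_bump, of h "- c"] by simp
  then show ?thesis by (rule smooth_compose_coord)
qed

lemma sqrt_bump_square_integrable:
  assumes "square_integrable lebesgue f"
  shows "square_integrable lebesgue (\<lambda>x. sqrt (bump h (\<sigma> x - c)) *\<^sub>R f x)"
proof (rule square_integrable_scaleR_bounded(1)[OF assms])
  show "continuous_on UNIV (\<lambda>x. sqrt (bump h (\<sigma> x - c)))"
    by (intro continuous_intros smooth_continuous smooth_bump_coord)
  show "\<bar>sqrt (bump h (\<sigma> x - c))\<bar> \<le> 1" for x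
    by (simp add: bump_nonneg bump_le_1)
qed

lemma mass_integrable:
  assumes "square_integrable lebesgue f"
  shows "integrable lebesgue (\<lambda>x. bump h (\<sigma> x - c) * (cmod (f x))\<^sup>2)"
  using sqrt_bump_square_integrable[OF assms]
  by (simp add: square_integrable_def power_mult_distrib bump_nonneg)

lemma mass_nonneg: "0 \<le> mass h u c"
  unfolding mass_def by (intro Bochner_Integration.integral_nonneg) (simp add: bump_nonneg)

lemma l2norm_translation_mass:
  assumes "square_integrable (lebesgue_on \<Omega>) u"
  shows "l2norm lebesgue (\<lambda>x. sqrt (bump h (\<sigma> x - c)) *\<^sub>R ext u (x + t *\<^sub>R a)) = sqrt (mass h u (c + t))"
proof -
  let ?F = "\<lambda>x. bump h (\<sigma> x - (c + t)) * (cmod (ext u x))\<^sup>2"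
  have "(LINT x|lebesgue. ?F (x + t *\<^sub>R a)) = mass h u (c + t)"
    unfolding mass_def
    by (rule integral_lebesgue_translation[OF borel_measurable_integrable[OF mass_integrable[OF ext_square_integrable[OF assms]]]])
  moreover have "?F (x + t *\<^sub>R a) = (cmod (sqrt (bump h (\<sigma> x - c)) *\<^sub>R ext u (x + t *\<^sub>R a)))\<^sup>2" for x
    by (simp add: power_mult_distrib bump_nonneg)
  ultimately show ?thesis
    by (simp add: l2norm_def)
qed

text \<open>Cauchy-Schwarz with the square root of the weight given to each factor; undoing the two
  translations moves the centres to \<open>c - t\<close> and \<open>c + t\<close>.\<close>

lemma correlation_le_mass:
  assumes "square_integrable (lebesgue_on \<Omega>) u"
  shows "cmod (LINT x|lebesgue. bump h (\<sigma> x - c) *\<^sub>R (ext u (x - t *\<^sub>R a) * cnj (ext u (x + t *\<^sub>R a))))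
    \<le> sqrt (mass h u (c - t) * mass h u (c + t))"
proof -
  let ?f = "\<lambda>t x. sqrt (bump h (\<sigma> x - c)) *\<^sub>R ext u (x + t *\<^sub>R a)"
  have sq: "square_integrable lebesgue (?f t)" for t
    by (intro sqrt_bump_square_integrable square_integrable_translation ext_square_integrable assms)
  have eq: "bump h (\<sigma> x - c) *\<^sub>R (ext u (x - t *\<^sub>R a) * cnj (ext u (x + t *\<^sub>R a))) = ?f (- t) x * cnj (?f t x)" for x
    by (simp add: bump_nonneg)
  have "cmod (LINT x|lebesgue. bump h (\<sigma> x - c) *\<^sub>R (ext u (x - t *\<^sub>R a) * cnj (ext u (x + t *\<^sub>R a))))
      \<le> l2norm lebesgue (?f (- t)) * l2norm lebesgue (\<lambda>x. cnj (?f t x))"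
    unfolding eq by (rule norm_integral_mult_le_l2norm[OF sq square_integrable_cnj[OF sq]])
  also have "\<dots> = sqrt (mass h u (c - t) * mass h u (c + t))"
    unfolding l2norm_cnj l2norm_translation_mass[OF assms] by (simp add: real_sqrt_mult)
  finally show ?thesis .
qed

text \<open>The cutoff lives between \<open>x - h\<close> and \<open>y + h\<close> and must stay in
  the rectangle under translations by \<open>h\<close>; hence the margins
  \<open>2 * h\<close>.\<close>

lemma mass_step:
  assumes h: "0 < h" "2 * h < x" "x \<le> y" "y + 2 * h < 1"
    and u: "weak_eigenfunction bc m u G"
  shows "mass h u y \<le> mass h u x + sqrt (mass h u (x - h) * mass h u (x + h))
    + sqrt (mass h u (y - h) * mass h u (y + h))"
proof -
  note H1 = weak_eigenfunction_H1[OF u]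
  then have squ: "square_integrable (lebesgue_on \<Omega>) u"
    by (auto simp: H1_def L2_eq_square_integrable)
  note sqt = square_integrable_translation[OF ext_square_integrable[OF squ]]
  define K where "K c t = (LINT z|lebesgue. bump h (\<sigma> z - c) *\<^sub>R (ext u (z - t *\<^sub>R a) * cnj (ext u (z + t *\<^sub>R a))))" for c t
  have int: "integrable lebesgue (\<lambda>z. bump h (\<sigma> z - c) *\<^sub>R (ext u (z - t *\<^sub>R a) * cnj (ext u (z + t *\<^sub>R a))))" for c t
  proof -
    have "square_integrable lebesgue (\<lambda>z. bump h (\<sigma> z - c) *\<^sub>R ext u (z + (- t) *\<^sub>R a))"
      by (rule square_integrable_scaleR_bounded(1)[OF sqt smooth_continuous[OF smooth_bump_coord], where B = 1])
        (simp add: bump_nonneg bump_le_1)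
    from integrable_mult_square_integrable[OF this square_integrable_cnj[OF sqt], of "t *\<^sub>R a"]
    show ?thesis by simp
  qed
  have K0: "K c 0 = of_real (mass h u c)" for c
  proof -
    have "bump h (\<sigma> z - c) *\<^sub>R (ext u z * cnj (ext u z)) = complex_of_real (bump h (\<sigma> z - c) * (cmod (ext u z))\<^sup>2)" for z
      by (simp only: scaleR_conv_of_real complex_norm_square of_real_mult)
    then show ?thesis by (simp add: K_def mass_def del: of_real_mult of_real_power)
  qed
  obtain \<phi> where \<phi>: "profile \<phi> (\<lambda>s. bump h (s - y) - bump h (s - x)) (x - h) (y + h)"
    using bump_difference_profile[OF h(1,3)] by blast
  have K_diff: "(LINT z|lebesgue. (bump h (\<sigma> z - y) - bump h (\<sigma> z - x)) *\<^sub>R (ext u (z - t *\<^sub>R a) * cnj (ext u (z + t *\<^sub>R a))))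
      = K y t - K x t" for t
    by (simp add: K_def scaleR_left_diff_distrib int)
  have "K y h - K x h = K y 0 - K x 0"
    using correlation_constant[OF \<phi> _ _ _ u, of h] h K_diff[of h] K_diff[of 0] by simp
  then have "complex_of_real (mass h u y - mass h u x) = K y h - K x h"
    by (simp add: K0)
  then have "\<bar>mass h u y - mass h u x\<bar> = cmod (K y h - K x h)"
    by (metis norm_of_real)
  also have "\<dots> \<le> cmod (K y h) + cmod (K x h)" by (rule norm_triangle_ineq4)
  finally have "mass h u y \<le> mass h u x + cmod (K x h) + cmod (K y h)" by linarith
  then show ?thesis
    using correlation_le_mass[OF squ, of h x h] correlation_le_mass[OF squ, of h y h]
    unfolding K_def by linarith
qed

text \<open>The centres \<open>c j = (real j + 2) * h\<close> run from \<open>2 * h\<close> to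
  \<open>1 - 2 * h\<close>. Every step compares with \<open>c 1\<close>, whose mass and those of its
  two neighbours are controlled near one end. As \<open>N\<close> and \<open>h\<close> come from
  \<epsilon> alone, the constant is uniform in the eigenvalue, the function and the boundary
  condition.\<close>

lemma rectangle_estimate:
  assumes "0 < \<epsilon>"
  shows "\<exists>C\<ge>0. \<forall>bc m u G. weak_eigenfunction bc m u G \<longrightarrow>
    (LINT x|lebesgue. (cmod (ext u x))\<^sup>2)
      \<le> C * (LINT x|lebesgue. indicator {x. \<sigma> x < \<epsilon> \<or> 1 - \<epsilon> < \<sigma> x} x * (cmod (ext u x))\<^sup>2)"
proof -
  let ?Z = "{x. \<sigma> x < \<epsilon> \<or> 1 - \<epsilon> < \<sigma> x}"
  \<comment> \<open>The 5 comes from the bump around \<open>c 2 = 4 * h\<close>, whose support ends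
    at \<open>5 * h\<close> and has to stay below \<epsilon>.\<close>
  obtain N0 :: nat where N0: "5 / \<epsilon> < real N0" using reals_Archimedean2 by blast
  define N where "N = N0 + 2"
  define h where "h = 1 / (real N + 4)"
  have h: "0 < h" "(real N + 4) * h = 1" by (simp_all add: h_def add_nonneg_pos)
  have "5 < \<epsilon> * (real N + 4)"
    using N0 assms by (simp add: N_def field_simps)
  then have h\<epsilon>: "5 * h < \<epsilon>"
    by (simp add: h_def field_simps add_nonneg_pos)
  obtain C where "0 \<le> C" and C: "\<And>m \<delta> i. log_convex_between N m \<delta> \<Longrightarrow> i \<le> N \<Longrightarrow> m i \<le> C * \<delta>"
    using log_convex_between_bound[of N] by blast
  have "(LINT x|lebesgue. (cmod (ext u x))\<^sup>2)
      \<le> (1 + exp 4 * (real N + 1) * C) * (LINT x|lebesgue. indicator ?Z x * (cmod (ext u x))\<^sup>2)"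
    if u: "weak_eigenfunction bc m u G" for bc m u G
  proof -
    note H1 = weak_eigenfunction_H1[OF u]
    then have "square_integrable (lebesgue_on \<Omega>) u"
      by (auto simp: H1_def L2_eq_square_integrable)
    note squ = ext_square_integrable[OF this]
    have intu: "integrable lebesgue (\<lambda>x. (cmod (ext u x))\<^sup>2)"
      using squ by (simp add: square_integrable_def)
    have "open ?Z"
      by (intro open_Collect_disj open_Collect_less continuous_on_coord continuous_on_const)
    then have intZ: "integrable lebesgue (\<lambda>x. indicator ?Z x * (cmod (ext u x))\<^sup>2)"
      using integrable_real_mult_indicator[OF _ intu, of ?Z] by (simp add: borel_open mult.commute)
    define \<delta> where "\<delta> = (LINT x|lebesgue. indicator ?Z x * (cmod (ext u x))\<^sup>2)"
    define c where "c j = (real j + 2) * h" for j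
    define M where "M j = mass h u (c j)" for j
    have M_le: "M j \<le> \<delta>" if "\<And>s. \<bar>s - c j\<bar> < h \<Longrightarrow> s < \<epsilon> \<or> 1 - \<epsilon> < s" for j
      unfolding M_def mass_def \<delta>_def
    proof (rule integral_mono[OF mass_integrable[OF squ] intZ], rule mult_right_mono)
      show "bump h (\<sigma> x - c j) \<le> indicator ?Z x" for x
        using bump_le_1[of h "\<sigma> x - c j"] bump_eq_0[OF h(1), of "\<sigma> x - c j"] that[of "\<sigma> x"]
        by (cases "x \<in> ?Z"; cases "h \<le> \<bar>\<sigma> x - c j\<bar>") (auto simp: not_le)
    qed simp
    have "M 0 \<le> \<delta>" "M 1 \<le> \<delta>" "M 2 \<le> \<delta>"
      using h(1) h\<epsilon> by (auto intro!: M_le simp: c_def)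
    \<comment> \<open>Since \<open>c N = 1 - 2 * h\<close>, this bump is supported above
      \<open>1 - 3 * h\<close>.\<close>
    moreover have "M N \<le> \<delta>"
      using h h\<epsilon> by (intro M_le) (auto simp: c_def algebra_simps)
    moreover have "M i \<le> 2 * \<delta> + sqrt (M (i - 1) * M (i + 1))" if i: "1 \<le> i" "i < N" for i
    proof -
      \<comment> \<open>The right margin required by \<open>mass_step\<close>: the total length
        \<open>(real N + 4) * h\<close> is 1 and \<open>i < N\<close>.\<close>
      have "c i + 2 * h = (real i + 4) * h" by (simp add: c_def algebra_simps)
      also have "\<dots> < (real N + 4) * h" using i h(1) by (intro mult_strict_right_mono) auto
      finally have "M i \<le> M 1 + sqrt (mass h u (c 1 - h) * mass h u (c 1 + h))
          + sqrt (mass h u (c i - h) * mass h u (c i + h))"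
        unfolding M_def using i h(1) by (intro mass_step[OF h(1) _ _ _ u]) (auto simp: c_def h(2))
      moreover have "mass h u (c j - h) = M (j - 1)" "mass h u (c j + h) = M (j + 1)" if "1 \<le> j" for j
        using that by (simp_all add: M_def c_def of_nat_diff algebra_simps)
      ultimately have "M i \<le> M 1 + sqrt (M 0 * M 2) + sqrt (M (i - 1) * M (i + 1))"
        using i by (simp add: numeral_2_eq_2)
      \<comment> \<open>Together with \<open>M 1 \<le> \<delta>\<close> this is the origin of the
        error \<open>2 * \<delta>\<close> in \<open>log_convex_between\<close>.\<close>
      moreover have "sqrt (M 0 * M 2) \<le> \<delta>"
      proof (rule real_le_lsqrt)
        have nn: "0 \<le> M j" for j by (simp add: M_def mass_nonneg)
        show "0 \<le> \<delta>" using nn[of 0] \<open>M 0 \<le> \<delta>\<close> by linarith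
        then show "M 0 * M 2 \<le> \<delta>\<^sup>2"
          unfolding power2_eq_square using nn \<open>M 0 \<le> \<delta>\<close> \<open>M 2 \<le> \<delta>\<close> by (intro mult_mono) auto
      qed
      ultimately show ?thesis using \<open>M 1 \<le> \<delta>\<close> by linarith
    qed
    moreover have "0 \<le> M j" for j by (simp add: M_def mass_nonneg)
    moreover from this[of 0] have "0 \<le> \<delta>" using \<open>M 0 \<le> \<delta>\<close> by linarith
    ultimately have "log_convex_between N M \<delta>"
      by (simp add: log_convex_between_def)
    then have "M i \<le> C * \<delta>" if "i \<le> N" for i
      using that by (rule C)
    then have sum_le: "(\<Sum>j\<le>N. M j) \<le> (real N + 1) * (C * \<delta>)"
      using sum_bounded_above[of "{..N}" M "C * \<delta>"] by (simp add: add.commute)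
    \<comment> \<open>Outside \<open>?Z\<close> some bump is at least \<open>exp (- 4)\<close>, and
      the factor \<open>exp 4\<close> compensates for this.\<close>
    have cover: "1 \<le> indicator ?Z x + exp 4 * (\<Sum>j\<le>N. bump h (\<sigma> x - c j))" for x
    proof (cases "x \<in> ?Z")
      case True
      then show ?thesis by (simp add: sum_nonneg bump_nonneg)
    next
      case False
      \<comment> \<open>Rounds \<open>\<sigma> x / h - 2\<close> to a nearest integer, so that
        \<open>c j\<close> lies within \<open>h / 2\<close> of \<open>\<sigma> x\<close>.\<close>
      define j where "j = nat \<lfloor>\<sigma> x / h - 3 / 2\<rfloor>"
      have lb: "5 * h \<le> \<sigma> x" and ub: "\<sigma> x \<le> 1 - 5 * h" using False h\<epsilon> by auto
      have "5 \<le> \<sigma> x / h" using lb h(1) by (simp add: field_simps)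
      moreover have "\<sigma> x / h \<le> real N - 1"
      proof -
        have "\<sigma> x \<le> (real N - 1) * h" using ub h(2) by (simp add: algebra_simps)
        then show ?thesis using h(1) by (simp add: field_simps)
      qed
      ultimately have j: "real j \<le> \<sigma> x / h - 3 / 2" "\<sigma> x / h - 3 / 2 < real j + 1" "real j \<le> real N"
        by (simp_all add: j_def) linarith+
      have "\<bar>\<sigma> x / h - (real j + 2)\<bar> \<le> 1 / 2" using j(1,2) by linarith
      then have "\<bar>\<sigma> x / h - (real j + 2)\<bar> * h \<le> 1 / 2 * h" using h(1) by (intro mult_right_mono) auto
      then have "\<bar>(\<sigma> x / h - (real j + 2)) * h\<bar> \<le> h / 2" using h(1) by (simp add: abs_mult)
      then have "\<bar>\<sigma> x - c j\<bar> \<le> h / 2" using h(1) by (simp add: c_def left_diff_distrib)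
      then have "exp (- 4) \<le> bump h (\<sigma> x - c j)" by (rule bump_ge[OF h(1)])
      also have "\<dots> \<le> (\<Sum>j\<le>N. bump h (\<sigma> x - c j))"
        using j(3) by (intro member_le_sum) (auto simp: bump_nonneg)
      finally have "exp 4 * exp (- 4) \<le> exp 4 * (\<Sum>j\<le>N. bump h (\<sigma> x - c j))" by simp
      then have "1 \<le> exp 4 * (\<Sum>j\<le>N. bump h (\<sigma> x - c j))" by (simp flip: exp_add)
      then show ?thesis by (rule add_increasing[OF indicator_pos_le])
    qed
    have intS: "integrable lebesgue (\<lambda>x. \<Sum>j\<le>N. bump h (\<sigma> x - c j) * (cmod (ext u x))\<^sup>2)"
      by (intro Bochner_Integration.integrable_sum mass_integrable[OF squ])
    have "(LINT x|lebesgue. (cmod (ext u x))\<^sup>2)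
        \<le> (LINT x|lebesgue. indicator ?Z x * (cmod (ext u x))\<^sup>2
            + exp 4 * (\<Sum>j\<le>N. bump h (\<sigma> x - c j) * (cmod (ext u x))\<^sup>2))"
    proof (rule integral_mono[OF intu])
      show "integrable lebesgue (\<lambda>x. indicator ?Z x * (cmod (ext u x))\<^sup>2
            + exp 4 * (\<Sum>j\<le>N. bump h (\<sigma> x - c j) * (cmod (ext u x))\<^sup>2))"
        by (intro Bochner_Integration.integrable_add intZ integrable_mult_right intS)
      show "(cmod (ext u x))\<^sup>2 \<le> indicator ?Z x * (cmod (ext u x))\<^sup>2
            + exp 4 * (\<Sum>j\<le>N. bump h (\<sigma> x - c j) * (cmod (ext u x))\<^sup>2)" for x
        using mult_right_mono[OF cover[of x], of "(cmod (ext u x))\<^sup>2"]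
        by (simp add: distrib_right sum_distrib_right mult.assoc)
    qed
    also have "\<dots> = \<delta> + exp 4 * (\<Sum>j\<le>N. M j)"
      using intZ intS mass_integrable[OF squ]
      by (simp add: \<delta>_def M_def mass_def)
    also have "\<dots> \<le> \<delta> + exp 4 * ((real N + 1) * (C * \<delta>))"
      using sum_le by simp
    also have "\<dots> = (1 + exp 4 * (real N + 1) * C) * \<delta>" by (simp add: algebra_simps)
    finally show ?thesis unfolding \<delta>_def .
  qed
  then show ?thesis
    using \<open>0 \<le> C\<close> by (intro exI[of _ "1 + exp 4 * (real N + 1) * C"] conjI allI impI) simp_all
qed

end

text \<open>Compactness of the two sides gives one radius \<open>r\<close> for all their points. One
  unit of \<sigma> has length \<open>norm a\<close>, so this radius is the width
  \<open>r / norm a\<close> in \<sigma>.\<close>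

lemma (in rectangular_frame) sides_neighbourhood:
  assumes "parallel_sides p b a \<subseteq> interior U"
  obtains \<epsilon> where "0 < \<epsilon>" "\<And>x. x \<in> R \<Longrightarrow> \<sigma> x < \<epsilon> \<or> 1 - \<epsilon> < \<sigma> x \<Longrightarrow> x \<in> U"
proof -
  have "compact (parallel_sides p b a)"
    by (auto simp: parallel_sides_def intro!: compact_Un compact_segment)
  then obtain r where r: "0 < r" "(\<Union>x\<in>parallel_sides p b a. ball x r) \<subseteq> interior U"
    using compact_subset_open_imp_ball_epsilon_subset[OF _ open_interior assms] by blast
  have near: "y + t *\<^sub>R a \<in> U" if "y \<in> parallel_sides p b a" "\<bar>t\<bar> < r / norm a" for y t
  proof -
    have "y + t *\<^sub>R a \<in> ball y r"
      using that(2) a_nonzero by (simp add: dist_norm field_simps)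
    then show ?thesis using that(1) r(2) interior_subset by blast
  qed
  show ?thesis
  proof (rule that[of "r / norm a"])
    show "0 < r / norm a" using r(1) a_nonzero by simp
    fix x assume x: "x \<in> R" "\<sigma> x < r / norm a \<or> 1 - r / norm a < \<sigma> x"
    then have x01: "0 < \<sigma> x" "\<sigma> x < 1" "0 < \<tau> x" "\<tau> x < 1" by (auto simp: mem_R_iff)
    from x(2) show "x \<in> U"
    proof
      assume "\<sigma> x < r / norm a"
      moreover have "x - \<sigma> x *\<^sub>R a \<in> parallel_sides p b a"
        using x01 by (intro parallel_sidesI(2)) auto
      ultimately have "(x - \<sigma> x *\<^sub>R a) + \<sigma> x *\<^sub>R a \<in> U" using x01 by (intro near) auto
      then show ?thesis by simp
    next
      assume "1 - r / norm a < \<sigma> x"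
      moreover have "x + (1 - \<sigma> x) *\<^sub>R a \<in> parallel_sides p b a"
        using x01 by (intro parallel_sidesI(2)) auto
      ultimately have "(x + (1 - \<sigma> x) *\<^sub>R a) + (\<sigma> x - 1) *\<^sub>R a \<in> U" using x01 by (intro near) auto
      moreover have "(x + (1 - \<sigma> x) *\<^sub>R a) + (\<sigma> x - 1) *\<^sub>R a = x"
        by (simp add: scaleR_left_diff_distrib)
      ultimately show ?thesis by simp
    qed
  qed
qed

text \<open>Testing with \<open>u\<close> itself equates \<mu> times the squared norm with the
  energy, which is real. A function of norm 0 has to be excluded, as it determines no
  eigenvalue.\<close>

lemma neg_laplacian_eigenvalue_real:
  assumes G: "form_domain bc \<Omega> u G"
    and eq: "\<And>v H. form_domain bc \<Omega> v H \<Longrightarrow>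
      (\<Sum>e\<in>Basis. LINT x|lebesgue_on \<Omega>. G e x * cnj (H e x))
        = (LINT x|lebesgue_on \<Omega>. \<mu> * u x * cnj (v x))"
    and nonzero: "(LINT x|lebesgue_on \<Omega>. (cmod (u x))\<^sup>2) \<noteq> 0"
  shows "\<mu> = complex_of_real (Re \<mu>)"
proof -
  have "(LINT x|lebesgue_on \<Omega>. \<mu> * u x * cnj (u x))
      = (LINT x|lebesgue_on \<Omega>. \<mu> * complex_of_real ((cmod (u x))\<^sup>2))"
    by (simp only: complex_norm_square mult.assoc)
  also have "\<dots> = \<mu> * of_real (LINT x|lebesgue_on \<Omega>. (cmod (u x))\<^sup>2)"
    by (simp only: integral_mult_right_zero integral_complex_of_real)
  finally have "\<mu> * of_real (LINT x|lebesgue_on \<Omega>. (cmod (u x))\<^sup>2)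
      = (\<Sum>e\<in>Basis. LINT x|lebesgue_on \<Omega>. complex_of_real ((cmod (G e x))\<^sup>2))"
    using eq[OF G] by (simp only: complex_norm_square)
  also have "\<dots> = of_real (\<Sum>e\<in>Basis. LINT x|lebesgue_on \<Omega>. (cmod (G e x))\<^sup>2)"
    by (simp only: integral_complex_of_real of_real_sum)
  finally have "Im (\<mu> * of_real (LINT x|lebesgue_on \<Omega>. (cmod (u x))\<^sup>2)) = 0"
    by (simp only: Im_complex_of_real)
  then have "Im \<mu> * (LINT x|lebesgue_on \<Omega>. (cmod (u x))\<^sup>2) = 0"
    by simp
  then show ?thesis
    using nonzero by (simp add: complex_eq_iff)
qed

theorem theorem2:
  fixes \<Omega> U :: "plane set" and p a b :: plane and bc :: boundary_condition
  assumes "partially_rectangular_billiard \<Omega> p a b"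
    and "parallel_sides p a b \<subseteq> frontier \<Omega>"
    and "parallel_sides p b a \<subseteq> interior U"
    and "U \<inter> \<Omega> \<in> sets lebesgue"
  shows "\<exists>C::real. C > 0 \<and>
    (\<forall>(\<mu>::complex) (u :: plane \<Rightarrow> complex).
       neg_laplacian bc \<Omega> u (\<lambda>x. \<mu> * u x) \<longrightarrow>
       (LINT x|lebesgue_on (U \<inter> \<Omega>). (cmod (u x))\<^sup>2)
         \<ge> 1 / C * (LINT x|lebesgue_on (rectangle p a b). (cmod (u x))\<^sup>2))"
proof -
  \<comment> \<open>An open set is disjoint from its frontier, so sides on the frontier miss
    \<Omega>.\<close>
  interpret rectangular_part p a b \<Omega>
    using assms(1,2) frontier_disjoint_eq[of \<Omega>]
    by unfold_locales (auto simp: partially_rectangular_billiard_def)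
  obtain \<epsilon> where \<epsilon>: "0 < \<epsilon>" "\<And>x. x \<in> R \<Longrightarrow> \<sigma> x < \<epsilon> \<or> 1 - \<epsilon> < \<sigma> x \<Longrightarrow> x \<in> U"
    using sides_neighbourhood[OF assms(3)] by blast
  let ?Z = "{x. \<sigma> x < \<epsilon> \<or> 1 - \<epsilon> < \<sigma> x}"
  obtain C where "0 \<le> C" and C: "\<And>bc m u G. weak_eigenfunction bc m u G \<Longrightarrow>
    (LINT x|lebesgue. (cmod (ext u x))\<^sup>2) \<le> C * (LINT x|lebesgue. indicator ?Z x * (cmod (ext u x))\<^sup>2)"
    using rectangle_estimate[OF \<epsilon>(1)] by blast
  have "(LINT x|lebesgue_on R. (cmod (u x))\<^sup>2) \<le> (C + 1) * (LINT x|lebesgue_on (U \<inter> \<Omega>). (cmod (u x))\<^sup>2)"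
    if u: "neg_laplacian bc \<Omega> u (\<lambda>x. \<mu> * u x)" for \<mu> u
  proof -
    obtain G where G: "form_domain bc \<Omega> u G" and eq: "\<And>v H. form_domain bc \<Omega> v H \<Longrightarrow>
        (\<Sum>e\<in>Basis. LINT x|lebesgue_on \<Omega>. G e x * cnj (H e x)) = (LINT x|lebesgue_on \<Omega>. \<mu> * u x * cnj (v x))"
      using u unfolding neg_laplacian_def by blast
    have "H1 \<Omega> u G" using G by (rule form_domain_H1)
    then have squ: "square_integrable (lebesgue_on \<Omega>) u"
      by (auto simp: H1_def L2_eq_square_integrable)
    have int_R: "(LINT x|lebesgue_on R. (cmod (u x))\<^sup>2) = (LINT x|lebesgue. (cmod (ext u x))\<^sup>2)"
      by (intro integral_lebesgue_on_eq R_sets) (auto simp: ext_def)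
    have U_nonneg: "0 \<le> (LINT x|lebesgue_on (U \<inter> \<Omega>). (cmod (u x))\<^sup>2)"
      by (intro Bochner_Integration.integral_nonneg) simp
    \<comment> \<open>A null function may come with a parameter that is not real, but then the
      integral over the rectangle is 0. Otherwise the parameter is real and the estimate for weak
      eigenfunctions applies.\<close>
    show ?thesis
    proof (cases "(LINT x|lebesgue_on \<Omega>. (cmod (u x))\<^sup>2) = 0")
      case True
      then have "(LINT x|lebesgue_on R. (cmod (u x))\<^sup>2) \<le> 0"
        using integral_ext_power2_le[OF squ] by (simp add: int_R)
      also have "0 \<le> (C + 1) * (LINT x|lebesgue_on (U \<inter> \<Omega>). (cmod (u x))\<^sup>2)"
        using U_nonneg \<open>0 \<le> C\<close> by simp
      finally show ?thesis .
    next
      case False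
      have "\<mu> = complex_of_real (Re \<mu>)"
        by (rule neg_laplacian_eigenvalue_real[OF G _ False]) (rule eq)
      then have "weak_eigenfunction bc (Re \<mu>) u G"
        unfolding weak_eigenfunction_def using G eq by simp
      then have le: "(LINT x|lebesgue. (cmod (ext u x))\<^sup>2)
          \<le> C * (LINT x|lebesgue. indicator ?Z x * (cmod (ext u x))\<^sup>2)"
        by (rule C)
      let ?v = "\<lambda>x. if x \<in> U \<inter> \<Omega> then u x else 0"
      have sqv: "square_integrable lebesgue ?v"
        by (rule square_integrable_restrict[OF squ _ \<Omega>_sets assms(4)]) simp
      have "(LINT x|lebesgue. indicator ?Z x * (cmod (ext u x))\<^sup>2) \<le> (LINT x|lebesgue. (cmod (?v x))\<^sup>2)"
      proof (rule integral_mono)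
        have "open ?Z"
          by (intro open_Collect_disj open_Collect_less continuous_on_coord continuous_on_const)
        then show "integrable lebesgue (\<lambda>x. indicator ?Z x * (cmod (ext u x))\<^sup>2)"
          using integrable_real_mult_indicator[of ?Z lebesgue "\<lambda>x. (cmod (ext u x))\<^sup>2"]
            ext_square_integrable[OF squ]
          by (simp add: square_integrable_def borel_open mult.commute)
        show "integrable lebesgue (\<lambda>x. (cmod (?v x))\<^sup>2)"
          using sqv by (simp add: square_integrable_def)
        show "indicator ?Z x * (cmod (ext u x))\<^sup>2 \<le> (cmod (?v x))\<^sup>2" for x
          using \<epsilon>(2)[of x] R_subset by (auto simp: ext_def indicator_def)
      qed
      also have "(LINT x|lebesgue. (cmod (?v x))\<^sup>2) = (LINT x|lebesgue_on (U \<inter> \<Omega>). (cmod (u x))\<^sup>2)"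
        by (intro integral_lebesgue_on_eq[symmetric] assms(4)) auto
      finally have "C * (LINT x|lebesgue. indicator ?Z x * (cmod (ext u x))\<^sup>2)
          \<le> C * (LINT x|lebesgue_on (U \<inter> \<Omega>). (cmod (u x))\<^sup>2)"
        using \<open>0 \<le> C\<close> by (intro mult_left_mono) auto
      then show ?thesis
        using le U_nonneg unfolding int_R distrib_right by linarith
    qed
  qed
  then show ?thesis
    \<comment> \<open>The constant \<open>C\<close> may be 0; \<open>C + 1\<close> is
      positive.\<close>
    using \<open>0 \<le> C\<close> by (intro exI[of _ "C + 1"] conjI allI impI) (auto simp: field_simps)
qed

end
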